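(* Let $g\ge 0$ be a fixed integer. Let $\{G_n\}$ be a positive linear recurrence sequence $G_n=c_1G_{n-1}+\cdots+c_LG_{n-L}$ with the additional constraint that all the coefficients $c_1,\dots,c_L$ are positive. Suppose there exists $n_0\in\mathbb{N}$ such that the random variable $K_{g,n}$ is non-trivial (i.e., is not the constant $0$) for all $n\ge n_0$. Let $\mu_{g,n}$ and $\sigma_{g,n}^2$ be the mean and variance of $K_{g,n}$. Then $\mu_{g,n}$ and $\sigma_{g,n}^2$ grow linearly in $n$, and $(K_{g,n}-\mu_{g,n})/\sigma_{g,n}$ converges weakly to the standard normal distribution $N(0,1)$ as $n\to\infty$.
   Context: A positive linear recurrence sequence (PLRS) is a sequence $\{G_n\}_{n\ge1}$ satisfying $G_n=c_1G_{n-1}+\cdots+c_LG_{n-L}$ (for $n>L$), where the $c_i$ are non-negative integers with $L\ge1$, $c_1\ge1$, $c_L\ge1$, and with initial conditions $G_1=1$ and $G_n=c_1G_{n-1}+c_2G_{n-2}+\cdots+c_{n-1}G_1+1$ for $1\le n\le L$. A decomposition $M=\sum_{i=1}^N a_iG_{N+1-i}$ with $a_1>0$ and $a_i\ge0$ is legal if either (1) $N<L$ and $a_i=c_i$ for $1\le i\le N$, or (2) there is $s\in\{1,\dots,L\}$ with $a_1=c_1,\dots,a_{s-1}=c_{s-1}$, $a_s<c_s$, $a_{s+1}=\cdots=a_{s+\ell}=0$ for some $\ell\ge0$, and the sequence $(b_i)_{i=1}^{N-s-\ell}$ with $b_i=a_{s+\ell+i}$ is either legal or empty. Every positive integer $M$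 has a unique legal decomposition (generalized Zeckendorf theorem). Writing this decomposition as $M=G_{i_1}+G_{i_2}+\cdots+G_{i_k}$ with $i_1\ge i_2\ge\cdots\ge i_k$ (each $G_j$ repeated according to its coefficient), the gaps of $M$ are $i_1-i_2,\,i_2-i_3,\dots,i_{k-1}-i_k$, and $k_g(M)$ denotes the number of gaps equal to $g$. $K_{g,n}$ is the random variable $k_g(M)$ for $M$ chosen uniformly at random from the integers in $[G_n,G_{n+1})$. *)

theory Defs
  imports "HOL-Probability.Probability"
begin

text \<open>
  The sequences \<open>c\<close> and \<open>G\<close> are indexed from \<open>1\<close>; the values of \<open>c\<close> outside \<open>{1..L}\<close> and the
  value \<open>G 0\<close> play no role.
\<close>

definition plrs :: "nat \<Rightarrow> (nat \<Rightarrow> nat) \<Rightarrow> (nat \<Rightarrow> nat) \<Rightarrow> bool" where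
  "plrs L c G \<longleftrightarrow>
     L \<ge> 1 \<and> c 1 \<ge> 1 \<and> c L \<ge> 1 \<and>
     G 1 = 1 \<and>
     (\<forall>n\<in>{1..L}. G n = (\<Sum>i=1..n-1. c i * G (n - i)) + 1) \<and>
     (\<forall>n>L. G n = (\<Sum>i=1..L. c i * G (n - i)))"

text \<open>
  A decomposition with coefficients \<open>a\<^sub>1, \<dots>, a\<^sub>N\<close> is the list \<open>a\<close> of length \<open>N\<close>, so that
  \<open>a\<^sub>i\<close> is \<open>a ! (i - 1)\<close>.
\<close>

inductive legal :: "nat \<Rightarrow> (nat \<Rightarrow> nat) \<Rightarrow> nat list \<Rightarrow> bool" for L c where
  short:
    "a \<noteq> [] \<Longrightarrow> a ! 0 > 0 \<Longrightarrow> length a < L \<Longrightarrow>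
     (\<forall>i\<in>{1..length a}. a ! (i - 1) = c i) \<Longrightarrow> legal L c a"
| block:
    "a \<noteq> [] \<Longrightarrow> a ! 0 > 0 \<Longrightarrow> s \<in> {1..L} \<Longrightarrow> s + l \<le> length a \<Longrightarrow>
     (\<forall>i\<in>{1..<s}. a ! (i - 1) = c i) \<Longrightarrow> a ! (s - 1) < c s \<Longrightarrow>
     (\<forall>i\<in>{s+1..s+l}. a ! (i - 1) = 0) \<Longrightarrow>
     drop (s + l) a = [] \<or> legal L c (drop (s + l) a) \<Longrightarrow> legal L c a"

definition decomp_value :: "(nat \<Rightarrow> nat) \<Rightarrow> nat list \<Rightarrow> nat" where
  "decomp_value G a = (\<Sum>i=1..length a. a ! (i - 1) * G (length a + 1 - i))"

definition legal_decomp :: "nat \<Rightarrow> (nat \<Rightarrow> nat) \<Rightarrow> (nat \<Rightarrow> nat) \<Rightarrow> nat \<Rightarrow> nat list" where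
  "legal_decomp L c G M = (THE a. legal L c a \<and> decomp_value G a = M)"

text \<open>The indices \<open>i\<^sub>1 \<ge> i\<^sub>2 \<ge> \<dots> \<ge> i\<^sub>k\<close> of the summands, repeated according to multiplicity.\<close>

definition summand_indices :: "nat list \<Rightarrow> nat list" where
  "summand_indices a =
     concat (map (\<lambda>i. replicate (a ! (i - 1)) (length a + 1 - i)) [1..<length a + 1])"

text \<open>
  Index lists are non-increasing, so the truncated subtraction on \<^typ>\<open>nat\<close> is the true
  difference. A decomposition with a single summand has no gaps.
\<close>

definition gaps :: "nat list \<Rightarrow> nat list" where
  "gaps is = map2 (-) is (tl is)"

definition num_gaps ::
    "nat \<Rightarrow> (nat \<Rightarrow> nat) \<Rightarrow> (nat \<Rightarrow> nat) \<Rightarrow> nat \<Rightarrow> nat \<Rightarrow> nat" where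
  "num_gaps L c G g M = count_list (gaps (summand_indices (legal_decomp L c G M))) g"

text \<open>
  The random variable \<open>K\<^bsub>g,n\<^esub>\<close> is \<^term>\<open>num_gaps L c G g\<close> on the following probability space.
\<close>

definition unif :: "(nat \<Rightarrow> nat) \<Rightarrow> nat \<Rightarrow> nat pmf" where
  "unif G n = pmf_of_set {G n..<G (n + 1)}"

definition gap_mean ::
    "nat \<Rightarrow> (nat \<Rightarrow> nat) \<Rightarrow> (nat \<Rightarrow> nat) \<Rightarrow> nat \<Rightarrow> nat \<Rightarrow> real" where
  "gap_mean L c G g n =
     measure_pmf.expectation (unif G n) (\<lambda>M. real (num_gaps L c G g M))"

definition gap_variance ::
    "nat \<Rightarrow> (nat \<Rightarrow> nat) \<Rightarrow> (nat \<Rightarrow> nat) \<Rightarrow> nat \<Rightarrow> nat \<Rightarrow> real" where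
  "gap_variance L c G g n =
     measure_pmf.variance (unif G n) (\<lambda>M. real (num_gaps L c G g M))"

text \<open>Linear growth means \<open>f(n) = C n + d + o(1)\<close> with a positive slope \<open>C\<close>.\<close>

definition grows_linearly :: "(nat \<Rightarrow> real) \<Rightarrow> bool" where
  "grows_linearly f \<longleftrightarrow> (\<exists>C d. C > 0 \<and> (\<lambda>n. f n - (C * real n + d)) \<longlonglongrightarrow> 0)"

end

theory Submission
  imports Defs "HOL-Complex_Analysis.Complex_Analysis"
begin

text \<open>
  A legal decomposition is a word in the blocks \<open>c\<^sub>1 \<dots> c\<^sub>s\<^sub>-\<^sub>1 a\<close> with \<open>a < c\<^sub>s\<close>, possibly followed by a
  truncated block. Cutting in front of the non-zero blocks, one obtains independent pieces, each a
  block followed by \<open>l\<close> zeros, and the gap between two consecutive pieces depends on the first one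
  only. Hence the polynomials \<open>U\<^sub>n(z)\<close>, the sum of \<open>z\<close> to the power of the number of gaps over the legal
  decompositions of length \<open>n\<close>, satisfy a linear recurrence whose coefficients are polynomials in
  \<open>z\<close> and are non-negative at \<open>z = 1\<close>.

  The ratios of consecutive solutions of a linear recurrence satisfy an averaging relation with
  weights summing to \<open>1\<close>. At \<open>z = 1\<close> the weights are non-negative, and the averaging is a contraction;
  this persists for complex \<open>z\<close> near \<open>1\<close>. So \<open>ln U\<^sub>n(e\<^sup>s) = n \<l>(s) + \<kappa>(s) + o(1)\<close> uniformly near
  \<open>s = 0\<close> with \<open>\<l>\<close> and \<open>\<kappa>\<close> holomorphic, which gives mean and variance by differentiation and
  the limit law through characteristic functions. The slopes \<open>\<l>'(0)\<close> and \<open>\<l>''(0)\<close> are positive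
  because \<open>exp (- \<l>)\<close> solves a renewal equation; vanishing variance would force the number of gaps in a piece
  to be proportional to its length, which is absurd as zeros can be appended.
\<close>

text \<open>Positivity is available only at \<open>z = 1\<close>. For other \<open>z\<close> the
  recurrence contains \<open>z - 1\<close> times differences of consecutive polynomials, so its
  coefficients are signed or complex and no Perron-Frobenius argument applies; following ratios
  avoids locating the roots of a polynomial of degree \<open>L + g + 1\<close>. The perturbation
  works because replacing complex weights by probability weights costs an error proportional to the
  current oscillation of the ratios: it worsens the contraction factor but adds no fixed error.

  The contraction needs positive weight on the immediate predecessor. It comes from the differencing
  in \<open>n\<close> that removes the sum over all shorter lengths and makes the recurrence finite:
  the term of length \<open>n - 1\<close> moves to the right with coefficient \<open>1\<close>.

  Positivity of all \<open>c i\<close> enters through the end of a block. The last non-zero digit is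
  then one of the last two, so the gap to the next piece is known from the last digit of the block
  and the number of zeros behind it.\<close>

subsection \<open>Contraction of averaging recurrences\<close>

text \<open>Every new value puts weight at least \<open>\<beta>\<close> on its immediate predecessor
  and the rest on values below \<open>M\<close> up to accumulated error. Hence the deficit of
  \<open>x (n-1)\<close> below \<open>M\<close> is inherited with one factor \<open>\<beta>\<close>
  per step. The bound is one-sided so that it can be applied to \<open>- x\<close> as well.\<close>

lemma weighted_average_upper:
  fixes x :: "nat \<Rightarrow> real"
  assumes D: "1 \<le> D" "D \<le> n" and \<beta>: "0 \<le> \<beta>" "\<beta> \<le> 1" and e: "0 \<le> e"
    and M: "\<And>i. i \<in> {n-D..<n} \<Longrightarrow> x i \<le> M"
    and a0: "\<And>k j. k < K \<Longrightarrow> j \<in> {1..D} \<Longrightarrow> 0 \<le> a k j"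
    and a1: "\<And>k. k < K \<Longrightarrow> (\<Sum>j=1..D. a k j) = 1"
    and ab: "\<And>k. k < K \<Longrightarrow> \<beta> \<le> a k 1"
    and rec: "\<And>k. k < K \<Longrightarrow> x (n+k) \<le> (\<Sum>j=1..D. a k j * x (n+k-j)) + e"
  shows "k < K \<Longrightarrow> x (n+k) \<le> M - \<beta>^(k+1) * (M - x (n-1)) + (k+1)*e"
proof (induction k rule: less_induct)
  case (less k)
  define P where "P = M - x (n-1)"
  have P: "0 \<le> P" using M[of "n-1"] D by (auto simp: P_def)
  have bnd: "x (n+k-j) \<le> M + k*e" if "j \<in> {1..D}" for j
  proof (cases "k < j")
    case True
    then have "n+k-j \<in> {n-D..<n}" using that D by auto
    then have "x (n+k-j) \<le> M" by (rule M)
    then show ?thesis using e by (smt (verit) mult_nonneg_nonneg of_nat_0_le_iff)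
  next
    case False
    then have "x (n+(k-j)) \<le> M - \<beta>^(k-j+1) * P + real(k-j+1)*e"
      using less.IH[of "k-j"] less.prems that unfolding P_def by (auto simp: add_ac)
    moreover have "real (k-j+1) * e \<le> k*e" using False that e by (intro mult_right_mono) auto
    moreover have "0 \<le> \<beta>^(k-j+1) * P" using \<beta> P by simp
    ultimately show ?thesis using False by simp
  qed
  have first: "x (n+k-1) \<le> M - \<beta>^k * P + k*e"
  proof (cases k)
    case 0 then show ?thesis by (simp add: P_def)
  next
    case (Suc k')
    then show ?thesis using less.IH[of k'] less.prems by (simp add: P_def add_ac)
  qed
  have "(\<Sum>j=1..D. a k j * x (n+k-j)) = a k 1 * x (n+k-1) + (\<Sum>j=2..D. a k j * x (n+k-j))"
    using D by (simp add: sum.atLeast_Suc_atMost numeral_2_eq_2)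
  also have "\<dots> \<le> a k 1 * (M - \<beta>^k * P + k*e) + (\<Sum>j=2..D. a k j * (M + k*e))"
    using a0 less.prems D by (intro add_mono mult_left_mono first sum_mono bnd) auto
  also have "(\<Sum>j=2..D. a k j * (M + k*e)) = (1 - a k 1) * (M + k*e)"
    using a1[OF less.prems] D by (simp add: sum.atLeast_Suc_atMost numeral_2_eq_2 flip: sum_distrib_right)
  also have "a k 1 * (M - \<beta>^k * P + k*e) + (1 - a k 1) * (M + k*e) = M + k*e - a k 1 * (\<beta>^k * P)"
    by (simp add: algebra_simps)
  also have "\<dots> \<le> M + k*e - \<beta> * (\<beta>^k * P)"
    using ab[OF less.prems] \<beta> P by (simp add: mult_right_mono)
  finally show ?case using rec[OF less.prems] by (simp add: P_def algebra_simps)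
qed

text \<open>The last old value \<open>p\<close> pulls all new values towards itself from both sides.
  Its deficits \<open>M - p\<close> and \<open>p - m\<close> add up to \<open>M - m\<close>, so the
  fraction \<open>\<beta>^D\<close> of the oscillation is lost. \<open>K\<close> may be smaller than
  \<open>D\<close> because in the application the recurrence becomes known one step at a
  time.\<close>

lemma weighted_average_oscillation:
  fixes x :: "nat \<Rightarrow> real"
  assumes D: "1 \<le> D" "D \<le> n" and \<beta>: "0 \<le> \<beta>" "\<beta> \<le> 1" and e: "0 \<le> e"
    and W: "\<And>i j. i \<in> {n-D..<n} \<Longrightarrow> j \<in> {n-D..<n} \<Longrightarrow> x i - x j \<le> d"
    and K: "K \<le> D"
    and a0: "\<And>k j. k < K \<Longrightarrow> j \<in> {1..D} \<Longrightarrow> 0 \<le> a k j"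
    and a1: "\<And>k. k < K \<Longrightarrow> (\<Sum>j=1..D. a k j) = 1"
    and ab: "\<And>k. k < K \<Longrightarrow> \<beta> \<le> a k 1"
    and rec: "\<And>k. k < K \<Longrightarrow> \<bar>x (n+k) - (\<Sum>j=1..D. a k j * x (n+k-j))\<bar> \<le> e"
  shows "k < K \<Longrightarrow> l < K \<Longrightarrow> x (n+k) - x (n+l) \<le> (1 - \<beta>^D) * d + 2 * real D * e"
    and "k < K \<Longrightarrow> x (n+k) - x (n-1) \<le> d + real D * e"
proof -
  define M where "M = Max (x ` {n-D..<n})"
  define m where "m = Min (x ` {n-D..<n})"
  define p where "p = x (n-1)"
  have ne: "{n-D..<n} \<noteq> {}" "finite (x ` {n-D..<n})" using D by auto
  have M: "x i \<le> M" "m \<le> x i" if "i \<in> {n-D..<n}" for i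
    using that ne by (auto simp: M_def m_def)
  have pm: "m \<le> p" "p \<le> M" using M[of "n-1"] D by (auto simp: p_def)
  have "M \<in> x ` {n-D..<n}" "m \<in> x ` {n-D..<n}" using ne unfolding M_def m_def by (auto intro: Max_in Min_in)
  then have d: "M - m \<le> d" using W by auto
  have weaken: "\<beta>^D \<le> \<beta>^(k+1)" "(real k + 1) * e \<le> real D * e" if "k < K" for k
    using that K \<beta> e power_decreasing[of "k+1" D \<beta>] by (auto intro!: mult_right_mono)
  have up: "x (n+k) \<le> M - \<beta>^D * (M - p) + real D * e" if "k < K" for k
  proof -
    have "x (n+k) \<le> M - \<beta>^(k+1) * (M - p) + (real k + 1) * e"
      unfolding p_def
      by (rule weighted_average_upper[where D = D and K = K and a = a])
         (use assms M that in \<open>auto simp: abs_le_iff algebra_simps\<close>)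
    moreover have "\<beta>^D * (M-p) \<le> \<beta>^(k+1) * (M - p)"
      using weaken[OF that] pm by (intro mult_right_mono) auto
    ultimately show ?thesis using weaken[OF that] by linarith
  qed
  have lo: "x (n+k) \<ge> m + \<beta>^D * (p - m) - real D * e" if "k < K" for k
  proof -
    have "- x (n+k) \<le> (-m) - \<beta>^(k+1) * ((-m) - (- x (n-1))) + (real k + 1) * e"
      by (rule weighted_average_upper[where D = D and K = K and a = a and x = "\<lambda>i. - x i"])
         (use assms M that in \<open>auto simp: abs_le_iff algebra_simps sum_negf\<close>)
    moreover have "\<beta>^D * (p-m) \<le> \<beta>^(k+1) * (p - m)"
      using weaken[OF that] pm by (intro mult_right_mono) auto
    ultimately show ?thesis using weaken[OF that] by (simp add: p_def)
  qed
  have b1: "\<beta>^D \<le> 1" using \<beta> by (simp add: power_le_one)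
  show "x (n+k) - x (n+l) \<le> (1 - \<beta>^D) * d + 2 * real D * e" if "k < K" "l < K"
  proof -
    have "x (n+k) - x (n+l) \<le> (1 - \<beta>^D) * (M - m) + 2 * real D * e"
      using up[OF that(1)] lo[OF that(2)] by (simp add: algebra_simps)
    moreover have "(1 - \<beta>^D) * (M - m) \<le> (1 - \<beta>^D) * d" using b1 d by (intro mult_left_mono) auto
    ultimately show ?thesis by linarith
  qed
  show "x (n+k) - x (n-1) \<le> d + real D * e" if "k < K"
  proof -
    have "0 \<le> \<beta>^D * (M-p)" using pm \<beta> by simp
    then show ?thesis using up[OF that] pm d unfolding p_def by linarith
  qed
qed

text \<open>Complex weights with sum \<open>1\<close> can leave the convex hull, so the contraction
  does not apply to them directly. What is recorded is their l1-distance to a probability vector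
  that charges lag \<open>1\<close>.\<close>

definition averaged :: "nat \<Rightarrow> real \<Rightarrow> real \<Rightarrow> (nat \<Rightarrow> complex) \<Rightarrow> nat \<Rightarrow> bool" where
  "averaged D \<beta> \<epsilon> \<rho> n \<longleftrightarrow> (\<exists>(\<alpha> :: nat \<Rightarrow> complex) (a :: nat \<Rightarrow> real).
     \<rho> n = (\<Sum>j=1..D. \<alpha> j * \<rho> (n - j)) \<and> (\<Sum>j=1..D. \<alpha> j) = 1 \<and>
     (\<forall>j\<in>{1..D}. 0 \<le> a j) \<and> (\<Sum>j=1..D. a j) = 1 \<and> \<beta> \<le> a 1 \<and>
     (\<Sum>j=1..D. norm (\<alpha> j - a j)) \<le> \<epsilon>)"

text \<open>Both weight vectors have sum \<open>1\<close>, so their difference may be tested against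
  \<open>\<rho> - p\<close> instead of \<open>\<rho>\<close>. The error is therefore governed by the
  spread \<open>r\<close> of the values and not by their size.\<close>

lemma averaged_real_weights:
  fixes \<rho> :: "nat \<Rightarrow> complex" and p :: complex
  assumes "averaged D \<beta> \<epsilon> \<rho> n" "0 \<le> r" and r: "\<And>j. j \<in> {1..D} \<Longrightarrow> norm (\<rho> (n - j) - p) \<le> r"
  obtains a :: "nat \<Rightarrow> real" where "\<forall>j\<in>{1..D}. 0 \<le> a j" "(\<Sum>j=1..D. a j) = 1" "\<beta> \<le> a 1"
    "norm (\<rho> n - (\<Sum>j=1..D. a j * \<rho> (n - j))) \<le> \<epsilon> * r"
proof -
  obtain \<alpha> :: "nat \<Rightarrow> complex" and a :: "nat \<Rightarrow> real" where
    *: "\<rho> n = (\<Sum>j=1..D. \<alpha> j * \<rho> (n - j))" "(\<Sum>j=1..D. \<alpha> j) = 1"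
     "\<forall>j\<in>{1..D}. 0 \<le> a j" "(\<Sum>j=1..D. a j) = 1" "\<beta> \<le> a 1"
     "(\<Sum>j=1..D. norm (\<alpha> j - a j)) \<le> \<epsilon>"
    using assms(1) unfolding averaged_def by blast
  have "(\<Sum>j=1..D. complex_of_real (a j)) = 1" using *(4) by (metis of_real_1 of_real_sum)
  then have "(\<Sum>j=1..D. (\<alpha> j - a j) * p) = 0"
    using *(2) by (simp add: sum_subtractf flip: sum_distrib_right)
  then have "\<rho> n - (\<Sum>j=1..D. a j * \<rho> (n - j)) = (\<Sum>j=1..D. (\<alpha> j - a j) * (\<rho> (n - j) - p))"
    using *(1) by (simp add: algebra_simps sum_subtractf sum.distrib)
  also have "norm \<dots> \<le> (\<Sum>j=1..D. norm (\<alpha> j - a j) * r)"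
    by (rule sum_norm_le) (auto simp: norm_mult intro!: mult_left_mono r)
  also have "\<dots> \<le> \<epsilon> * r" using *(6) assms(2) by (simp add: mult_right_mono flip: sum_distrib_right)
  finally show ?thesis using * that by blast
qed

text \<open>Projection to unit directions \<open>u\<close> reduces the plane to the real case. The
  hypothesis \<open>av\<close> is conditional because weights close to probabilities are available
  only while the values have not moved far; the drift bound that it asks for is proved by induction
  alongside.\<close>

lemma averaged_block:
  fixes \<rho> :: "nat \<Rightarrow> complex" and \<beta> \<epsilon> d :: real
  assumes D: "1 \<le> D" "D \<le> n" and \<beta>: "0 \<le> \<beta>" "\<beta> \<le> 1" and \<epsilon>: "0 \<le> \<epsilon>" "2 * real D * \<epsilon> \<le> 1" and d: "0 \<le> d"
    and W: "\<And>i j. i \<in> {n-D..<n} \<Longrightarrow> j \<in> {n-D..<n} \<Longrightarrow> norm (\<rho> i - \<rho> j) \<le> d"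
    and av: "\<And>k. k < D \<Longrightarrow> (\<And>i. i < k \<Longrightarrow> norm (\<rho> (n+i) - \<rho> (n-1)) \<le> 2 * d) \<Longrightarrow> averaged D \<beta> \<epsilon> \<rho> (n+k)"
  shows "k < D \<Longrightarrow> norm (\<rho> (n+k) - \<rho> (n-1)) \<le> 2 * d"
    and "k < D \<Longrightarrow> l < D \<Longrightarrow> norm (\<rho> (n+k) - \<rho> (n+l)) \<le> (1 - \<beta>^D + 4 * real D * \<epsilon>) * d"
proof -
  define p where "p = \<rho> (n-1)"
  \<comment> \<open>All values entering an average lie within \<open>2 * d\<close> of
    \<open>p\<close>, so this is the cost of passing to real weights. It turns
    \<open>2 * real D * e\<close> into the summand \<open>4 * real D * \<epsilon> * d\<close> of the
    contracted oscillation.\<close>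
  define e where "e = \<epsilon> * (2 * d)"
  have e: "0 \<le> e" "real D * e \<le> d" using \<epsilon> d mult_right_mono[of "2 * real D * \<epsilon>" 1 d] by (auto simp: e_def algebra_simps)
  have core: "inner u (\<rho> (n+k)) - inner u (\<rho> (n+l)) \<le> (1 - \<beta>^D) * d + 2 * real D * e"
      "inner u (\<rho> (n+k)) - inner u p \<le> d + real D * e"
    if K: "K \<le> D" "k < K" "l < K" and u: "norm u = 1"
      and near: "\<And>i. i + 1 < K \<Longrightarrow> norm (\<rho> (n+i) - p) \<le> 2 * d" for u :: complex and K k l
  proof -
    have "\<exists>a :: nat \<Rightarrow> real. (\<forall>j\<in>{1..D}. 0 \<le> a j) \<and> (\<Sum>j=1..D. a j) = 1 \<and> \<beta> \<le> a 1 \<and>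
            norm (\<rho> (n+i) - (\<Sum>j=1..D. a j * \<rho> (n + i - j))) \<le> e" if "i < K" for i
    proof -
      have 1: "averaged D \<beta> \<epsilon> \<rho> (n+i)"
        using av[of i] that K near unfolding p_def by auto
      have 3: "norm (\<rho> (n + i - j) - p) \<le> 2 * d" if j: "j \<in> {1..D}" for j
      proof (cases "j \<le> i")
        case True
        then show ?thesis using near[of "i-j"] \<open>i < K\<close> j by auto
      next
        case False
        have "norm (\<rho> (n + i - j) - p) \<le> d" unfolding p_def by (rule W) (use D j False in auto)
        then show ?thesis using d by simp
      qed
      have 2: "0 \<le> 2 * d" using d by simp
      show ?thesis unfolding e_def by (rule averaged_real_weights[OF 1 2 3]) auto
    qed
    then obtain a :: "nat \<Rightarrow> nat \<Rightarrow> real" where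
      a: "\<And>i. i < K \<Longrightarrow> (\<forall>j\<in>{1..D}. 0 \<le> a i j) \<and> (\<Sum>j=1..D. a i j) = 1 \<and> \<beta> \<le> a i 1 \<and>
            norm (\<rho> (n+i) - (\<Sum>j=1..D. a i j * \<rho> (n + i - j))) \<le> e" by metis
    have rec: "\<bar>inner u (\<rho> (n+i)) - (\<Sum>j=1..D. a i j * inner u (\<rho> (n + i - j)))\<bar> \<le> e" if "i < K" for i
    proof -
      have "inner u (\<rho> (n+i)) - (\<Sum>j=1..D. a i j * inner u (\<rho> (n + i - j)))
          = inner u (\<rho> (n+i) - (\<Sum>j=1..D. a i j * \<rho> (n + i - j)))"
        by (simp add: inner_diff_right inner_sum_right flip: scaleR_conv_of_real)
      also have "\<bar>\<dots>\<bar> \<le> norm u * norm (\<rho> (n+i) - (\<Sum>j=1..D. a i j * \<rho> (n + i - j)))"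
        by (rule Cauchy_Schwarz_ineq2)
      finally show ?thesis using a[OF that] u by simp
    qed
    have W': "inner u (\<rho> i) - inner u (\<rho> j) \<le> d" if "i \<in> {n-D..<n}" "j \<in> {n-D..<n}" for i j
      using W[OF that] Cauchy_Schwarz_ineq2[of u "\<rho> i - \<rho> j"] u by (simp add: inner_diff_right)
    show "inner u (\<rho> (n+k)) - inner u (\<rho> (n+l)) \<le> (1 - \<beta>^D) * d + 2 * real D * e"
      by (rule weighted_average_oscillation(1)[where a = a and K = K])
         (use D \<beta> e W' K a rec in auto)
    show "inner u (\<rho> (n+k)) - inner u p \<le> d + real D * e"
      unfolding p_def by (rule weighted_average_oscillation(2)[where a = a and K = K and \<beta> = \<beta>])
         (use D \<beta> e W' K a rec in auto)
  qed
  have norm_le: "norm (x - y) \<le> r" if "\<And>u. norm u = 1 \<Longrightarrow> inner u x - inner u y \<le> r" "0 \<le> r" for x y :: complex and r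
  proof (cases "x = y")
    case False
    have "inner (sgn (x - y)) (x - y) = inverse (norm (x - y)) * (norm (x - y))\<^sup>2"
      by (simp add: sgn_div_norm power2_norm_eq_inner)
    then have "inner (sgn (x - y)) x - inner (sgn (x - y)) y = norm (x - y)"
      using False by (simp add: power2_eq_square flip: inner_diff_right)
    then show ?thesis using that(1)[of "sgn (x - y)"] False by (simp add: norm_sgn)
  qed (use that in auto)
  have near: "norm (\<rho> (n+k) - p) \<le> 2 * d" if "k < D" for k
    using that
  proof (induction k rule: less_induct)
    case (less k)
    show ?case
    proof (rule norm_le)
      fix u :: complex assume "norm u = 1"
      then have "inner u (\<rho> (n+k)) - inner u p \<le> d + real D * e"
        \<comment> \<open>With \<open>K = k + 1\<close> only the values before \<open>n + k\<close>
          have to be near \<open>p\<close>, which is the induction hypothesis.\<close>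
        using less by (intro core(2)[where K = "k+1"]) auto
      then show "inner u (\<rho> (n+k)) - inner u p \<le> 2 * d" using e by simp
    qed (use d in simp)
  qed
  then show "k < D \<Longrightarrow> norm (\<rho> (n+k) - \<rho> (n-1)) \<le> 2 * d" by (simp add: p_def)
  have pos: "0 \<le> (1 - \<beta>^D) * d" using \<beta> d by (simp add: power_le_one)
  show "norm (\<rho> (n+k) - \<rho> (n+l)) \<le> (1 - \<beta>^D + 4 * real D * \<epsilon>) * d" if "k < D" "l < D"
  proof (rule norm_le)
    fix u :: complex assume "norm u = 1"
    then have "inner u (\<rho> (n+k)) - inner u (\<rho> (n+l)) \<le> (1 - \<beta>^D) * d + 2 * real D * e"
      using that near by (intro core(1)[where K = D]) auto
    then show "inner u (\<rho> (n+k)) - inner u (\<rho> (n+l)) \<le> (1 - \<beta>^D + 4 * real D * \<epsilon>) * d"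
      by (simp add: e_def algebra_simps)
  next
    have "0 \<le> 4 * real D * \<epsilon> * d" using \<epsilon> d by simp
    then show "0 \<le> (1 - \<beta>^D + 4 * real D * \<epsilon>) * d" using pos by (simp add: algebra_simps)
  qed
qed

text \<open>A bootstrap over blocks of length \<open>D\<close>. The drift in block \<open>b\<close>
  is at most a multiple of \<open>\<theta>^b\<close>, so the geometric sum of the drifts keeps the
  sequence within \<open>3 * d / (1 - \<theta>)\<close> of the reference value, and this is the
  region in which \<open>av\<close> keeps supplying weights.\<close>

lemma averaged_converges:
  fixes \<rho> :: "nat \<Rightarrow> complex" and \<beta> \<epsilon> d :: real and D N n :: nat
  defines "\<theta> \<equiv> 1 - \<beta>^D + 4 * real D * \<epsilon>"
  assumes D: "1 \<le> D" and \<beta>: "0 \<le> \<beta>" "\<beta> \<le> 1" and \<epsilon>: "0 \<le> \<epsilon>" "2 * real D * \<epsilon> \<le> 1"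
    and \<theta>: "\<theta> < 1" and d: "0 \<le> d"
    and W: "\<And>i j. i \<in> {N..<N+D} \<Longrightarrow> j \<in> {N..<N+D} \<Longrightarrow> norm (\<rho> i - \<rho> j) \<le> d"
    and av: "\<And>n. N + D \<le> n \<Longrightarrow> (\<And>i. i \<in> {N..<n} \<Longrightarrow> norm (\<rho> i - \<rho> (N+D-1)) \<le> 3 * d / (1 - \<theta>))
               \<Longrightarrow> averaged D \<beta> \<epsilon> \<rho> n"
  shows "N \<le> n \<Longrightarrow> norm (\<rho> n - \<rho> (N+D-1)) \<le> 3 * d / (1 - \<theta>)"
    and "N \<le> n \<Longrightarrow> norm (\<rho> (n+1) - \<rho> n) \<le> 2 * d * \<theta>^((n - N) div D)"
proof -
  define p where "p = \<rho> (N+D-1)"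
  have \<theta>0: "0 \<le> \<theta>" using \<beta> \<epsilon> by (simp add: \<theta>_def power_le_one)
  \<comment> \<open>Distance from the reference value that can be reached by the end of block
    \<open>b\<close>: the initial spread plus a drift of \<open>2 * d * \<theta>^k\<close> for each
    block passed.\<close>
  define S where "S b = d + 2 * d * (\<Sum>k<b. \<theta>^k)" for b :: nat
  have S: "S b \<le> 3 * d / (1 - \<theta>)" for b
  proof -
    have "(\<Sum>k<b. \<theta>^k) \<le> 1 / (1 - \<theta>)"
      using \<theta> \<theta>0 by (simp add: sum_gp_strict divide_right_mono)
    moreover have "1 \<le> 1 / (1 - \<theta>)" using \<theta> \<theta>0 by simp
    ultimately have "d * 1 + 2 * d * (\<Sum>k<b. \<theta>^k) \<le> d * (1 / (1 - \<theta>)) + 2 * d * (1 / (1 - \<theta>))"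
      using d by (intro add_mono mult_left_mono) auto
    then show ?thesis by (simp add: S_def)
  qed
  have S_mono: "S b \<le> S (Suc b)" for b using d \<theta>0 by (simp add: S_def algebra_simps)
  have main: "(\<forall>i\<in>{N..<N+b*D+D}. norm (\<rho> i - p) \<le> S b) \<and>
      (\<forall>i\<in>{N+b*D..<N+b*D+D}. \<forall>j\<in>{N+b*D..<N+b*D+D}. norm (\<rho> i - \<rho> j) \<le> d * \<theta>^b) \<and>
      (\<forall>n\<in>{N..<N+b*D+D-1}. norm (\<rho> (n+1) - \<rho> n) \<le> 2 * d * \<theta>^((n - N) div D))" for b
  proof (induction b)
    case 0
    have "norm (\<rho> i - p) \<le> d" if "i \<in> {N..<N+D}" for i
      unfolding p_def by (rule W) (use that D in auto)
    moreover have "norm (\<rho> (n+1) - \<rho> n) \<le> 2 * d * \<theta>^((n - N) div D)" if "n \<in> {N..<N+D-1}" for n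
    proof -
      have "norm (\<rho> (n+1) - \<rho> n) \<le> d" by (rule W) (use that in auto)
      moreover have "(n - N) div D = 0" using that by auto
      ultimately show ?thesis using d by simp
    qed
    ultimately show ?case using W by (auto simp: S_def)
  next
    case (Suc b)
    define n where "n = N + b * D + D"
    define db where "db = d * \<theta>^b"
    have n: "N + Suc b * D = n" "n - D = N + b * D" "D \<le> n" by (auto simp: n_def)
    have db: "0 \<le> db" using d \<theta>0 by (simp add: db_def)
    have IH1: "norm (\<rho> i - p) \<le> S b" if "i \<in> {N..<n}" for i using Suc that unfolding n_def by blast
    have IH2: "norm (\<rho> i - \<rho> j) \<le> db" if "i \<in> {n-D..<n}" "j \<in> {n-D..<n}" for i j
      using Suc.IH that unfolding n(2) unfolding n_def db_def by blast
    have IH3: "norm (\<rho> (i+1) - \<rho> i) \<le> 2 * d * \<theta>^((i - N) div D)" if "i \<in> {N..<n-1}" for i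
      using Suc that unfolding n_def by blast
    have shift: "norm (\<rho> (n+k) - p) \<le> S (Suc b)" if "norm (\<rho> (n+k) - \<rho> (n-1)) \<le> 2 * db" for k
    proof -
      have "norm (\<rho> (n-1) - p) \<le> S b" by (rule IH1) (use D n_def in auto)
      then show ?thesis using that norm_triangle_ineq[of "\<rho> (n+k) - \<rho> (n-1)" "\<rho> (n-1) - p"]
        by (simp add: S_def db_def algebra_simps)
    qed
    have avn: "averaged D \<beta> \<epsilon> \<rho> (n+k)"
      if near: "\<And>i. i < k \<Longrightarrow> norm (\<rho> (n+i) - \<rho> (n-1)) \<le> 2 * db" for k
    proof (rule av)
      fix i assume i: "i \<in> {N..<n+k}"
      have "norm (\<rho> i - p) \<le> S (Suc b)"
      proof (cases "i < n")
        case True then show ?thesis using IH1[of i] S_mono[of b] i by auto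
      next
        case False then show ?thesis using shift[of "i-n"] near[of "i-n"] i by auto
      qed
      then show "norm (\<rho> i - \<rho> (N+D-1)) \<le> 3 * d / (1 - \<theta>)" using S[of "Suc b"] by (simp add: p_def)
    qed (simp add: n_def)
    note blk = averaged_block[OF D n(3) \<beta> \<epsilon> db IH2 avn, folded \<theta>_def]
    have new1: "norm (\<rho> i - \<rho> (n-1)) \<le> 2 * db" if "i \<in> {n..<n+D}" for i
      using blk(1)[of "i-n"] that by auto
    have new2: "norm (\<rho> i - \<rho> j) \<le> d * \<theta>^Suc b" if "i \<in> {n..<n+D}" "j \<in> {n..<n+D}" for i j
      using blk(2)[of "i-n" "j-n"] that by (auto simp: db_def algebra_simps)
    have "norm (\<rho> i - p) \<le> S (Suc b)" if "i \<in> {N..<n+D}" for i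
    proof (cases "i < n")
      case True then show ?thesis using IH1[of i] S_mono[of b] that by auto
    next
      case False then show ?thesis using shift[of "i-n"] new1[of i] that by auto
    qed
    moreover have "norm (\<rho> (i+1) - \<rho> i) \<le> 2 * d * \<theta>^((i - N) div D)" if "i \<in> {N..<n+D-1}" for i
    proof -
      consider "i < n - 1" | "i = n - 1" | "n \<le> i" by linarith
      then show ?thesis
      proof cases
        case 1 then show ?thesis using IH3 that by auto
      next
        case 2
        have "(i - N) div D = b" using 2 D by (intro div_nat_eqI) (auto simp: n_def algebra_simps)
        then show ?thesis using new1[of n] 2 D n_def by (auto simp: db_def algebra_simps)
      next
        case 3
        have "(i - N) div D = Suc b" using 3 that D by (intro div_nat_eqI) (auto simp: n_def algebra_simps)
        moreover have "norm (\<rho> (i+1) - \<rho> i) \<le> d * \<theta>^Suc b" by (rule new2) (use 3 that in auto)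
        moreover have "0 \<le> d * \<theta>^Suc b" using d \<theta>0 by simp
        ultimately show ?thesis by simp
      qed
    qed
    ultimately show ?case unfolding n(1) using new2 by blast
  qed
  have inb: "n \<in> {N..<N+n*D+D}" "n \<in> {N..<N+(n+1)*D+D-1}" if "N \<le> n"
  proof -
    have "n \<le> n * D" using D by simp
    moreover have "(n + 1) * D = n * D + D" by simp
    ultimately show "n \<in> {N..<N+n*D+D}" "n \<in> {N..<N+(n+1)*D+D-1}"
      using that D unfolding atLeastLessThan_iff by linarith+
  qed
  show "N \<le> n \<Longrightarrow> norm (\<rho> n - \<rho> (N+D-1)) \<le> 3 * d / (1 - \<theta>)"
    using main[of n] inb(1) S[of n] order.trans unfolding p_def by blast
  show "N \<le> n \<Longrightarrow> norm (\<rho> (n+1) - \<rho> n) \<le> 2 * d * \<theta>^((n - N) div D)"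
    using main[of "n+1"] inb(2) by blast
qed

lemma summable_power_div:
  fixes \<theta> :: real
  assumes "0 \<le> \<theta>" "\<theta> < 1" "1 \<le> D"
  shows "summable (\<lambda>n. \<theta>^(n div D))"
proof (cases "\<theta> = 0")
  case True
  show ?thesis by (rule summable_finite[of "{..<D}"]) (use True assms in \<open>auto simp: power_0_left div_eq_0_iff\<close>)
next
  case False
  define r where "r = root D \<theta>"
  have r: "0 < r" "r < 1" "r^D = \<theta>" using assms False by (auto simp: r_def)
  have "summable (\<lambda>n. r^n / \<theta>)" by (intro summable_divide summable_geometric) (use r in auto)
  then show ?thesis
  proof (rule summable_comparison_test'[where N = 0])
    fix n
    have "\<theta> * \<theta>^(n div D) = r^(D + D * (n div D))" using r(3) by (simp add: power_add power_mult)
    also have "\<dots> \<le> r^n" using r assms(3) dividend_less_times_div[of D n] by (intro power_decreasing) auto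
    finally show "norm (\<theta>^(n div D)) \<le> r^n / \<theta>" using assms False by (simp add: field_simps)
  qed
qed

subsection \<open>Ratios of solutions of linear recurrences\<close>

text \<open>The rate depends on \<open>e\<close> alone, so that for a family of sequences with
  common increments bound the convergence is uniform.\<close>

lemma convergent_of_summable_increments:
  fixes \<rho> :: "nat \<Rightarrow> 'a :: banach"
  assumes e: "summable e" and inc: "\<And>n. N \<le> n \<Longrightarrow> norm (\<rho> (n+1) - \<rho> n) \<le> e (n - N)"
  obtains l where "\<rho> \<longlonglongrightarrow> l" "\<And>n. N \<le> n \<Longrightarrow> norm (\<rho> n - l) \<le> (\<Sum>i. e (i + (n - N)))"
proof -
  define g where "g n = \<rho> (N + Suc n) - \<rho> (N + n)" for n
  have g: "norm (g n) \<le> e n" for n using inc[of "N+n"] by (simp add: g_def)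
  have sg: "summable g" "summable (\<lambda>n. norm (g n))"
    by (rule summable_comparison_test'[OF e, of 0]; simp add: g)+
  have tel: "\<rho> (N + n) = \<rho> N + (\<Sum>i<n. g i)" for n
    unfolding g_def by (simp add: sum_lessThan_telescope[of "\<lambda>n. \<rho> (N + n)" n, simplified])
  have "(\<lambda>n. \<rho> (N + n)) \<longlonglongrightarrow> \<rho> N + suminf g"
    unfolding tel by (intro tendsto_intros summable_LIMSEQ sg)
  then have lim: "\<rho> \<longlonglongrightarrow> \<rho> N + suminf g"
    by (subst (asm) add.commute) (rule LIMSEQ_offset)
  moreover have "norm (\<rho> n - (\<rho> N + suminf g)) \<le> (\<Sum>i. e (i + (n - N)))" if "N \<le> n" for n
  proof -
    have "\<rho> n - (\<rho> N + suminf g) = - (\<Sum>i. g (i + (n - N)))"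
      using tel[of "n-N"] that suminf_split_initial_segment[OF sg(1), of "n-N"] by simp
    also have "norm \<dots> \<le> (\<Sum>i. norm (g (i + (n - N))))"
      using summable_norm[of "\<lambda>i. g (i + (n-N))"] sg(2) summable_iff_shift[of "\<lambda>i. norm (g i)" "n-N"] by simp
    also have "\<dots> \<le> (\<Sum>i. e (i + (n - N)))"
      using sg(2) e g by (intro suminf_le) (simp_all add: summable_iff_shift[where f = "\<lambda>i. norm (g i)"] summable_iff_shift)
    finally show ?thesis .
  qed
  ultimately show ?thesis using that by blast
qed

lemma shifted_ratio_limit:
  fixes f :: "nat \<Rightarrow> 'a :: real_normed_field"
  assumes nz: "\<And>n. N \<le> n \<Longrightarrow> f n \<noteq> 0" and lim: "(\<lambda>n. f (n+1) / f n) \<longlonglongrightarrow> \<mu>" and "\<mu> \<noteq> 0"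
  shows "(\<lambda>n. f n / f (n + j)) \<longlonglongrightarrow> 1 / \<mu>^j"
proof (induction j)
  case 0
  have "eventually (\<lambda>n. f n / f (n + 0) = 1) sequentially"
    using nz by (intro eventually_sequentiallyI[of N]) auto
  then show ?case by (simp add: tendsto_eventually)
next
  case (Suc j)
  have "(\<lambda>n. f (n + j + 1) / f (n + j)) \<longlonglongrightarrow> \<mu>" using LIMSEQ_ignore_initial_segment[OF lim, of j] by simp
  then have "(\<lambda>n. f n / f (n + j) * (1 / (f (n + j + 1) / f (n + j)))) \<longlonglongrightarrow> 1 / \<mu>^j * (1 / \<mu>)"
    by (intro tendsto_mult[OF Suc] tendsto_divide[OF tendsto_const] \<open>\<mu> \<noteq> 0\<close>)
  then have *: "(\<lambda>n. f n / f (n + j) * (1 / (f (n + j + 1) / f (n + j)))) \<longlonglongrightarrow> 1 / \<mu>^Suc j" by (simp add: mult_ac)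
  have "eventually (\<lambda>n. f n / f (n + j) * (1 / (f (n + j + 1) / f (n + j))) = f n / f (n + Suc j)) sequentially"
    using nz by (intro eventually_sequentiallyI[of N]) auto
  then show ?case using * by (rule Lim_transform_eventually[rotated])
qed

lemma characteristic_equation_of_ratio_limit:
  fixes f q :: "nat \<Rightarrow> 'a :: real_normed_field"
  assumes nz: "\<And>n. N \<le> n \<Longrightarrow> f n \<noteq> 0" and lim: "(\<lambda>n. f (n+1) / f n) \<longlonglongrightarrow> \<mu>" and "\<mu> \<noteq> 0"
    and rec: "\<And>n. N + D \<le> n \<Longrightarrow> f n = (\<Sum>j=1..D. q j * f (n - j))"
  shows "(\<Sum>j=1..D. q j / \<mu>^j) = 1"
proof -
  have "(\<lambda>n. q j * (f (n + D - j) / f (n + D))) \<longlonglongrightarrow> q j / \<mu>^j" if "j \<in> {1..D}" for j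
  proof -
    have "(\<lambda>n. f (n + (D - j)) / f (n + (D - j) + j)) \<longlonglongrightarrow> 1 / \<mu>^j"
      using LIMSEQ_ignore_initial_segment[OF shifted_ratio_limit[OF nz lim \<open>\<mu> \<noteq> 0\<close>]] .
    then have "(\<lambda>n. q j * (f (n + D - j) / f (n + D))) \<longlonglongrightarrow> q j * (1 / \<mu>^j)"
      using that by (intro tendsto_mult tendsto_const) simp
    then show ?thesis by simp
  qed
  then have 1: "(\<lambda>n. \<Sum>j=1..D. q j * (f (n + D - j) / f (n + D))) \<longlonglongrightarrow> (\<Sum>j=1..D. q j / \<mu>^j)"
    by (intro tendsto_sum)
  have "eventually (\<lambda>n. (\<Sum>j=1..D. q j * (f (n + D - j) / f (n + D))) = 1) sequentially"
  proof (rule eventually_sequentiallyI[of N])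
    fix n assume "N \<le> n"
    then have "(\<Sum>j=1..D. q j * f (n + D - j)) / f (n + D) = 1" using rec[of "n+D"] nz[of "n+D"] by simp
    then show "(\<Sum>j=1..D. q j * (f (n + D - j) / f (n + D))) = 1" by (simp add: sum_divide_distrib)
  qed
  then have "(\<lambda>n. \<Sum>j=1..D. q j * (f (n + D - j) / f (n + D))) \<longlonglongrightarrow> 1" by (rule tendsto_eventually)
  then show ?thesis using LIMSEQ_unique 1 by blast
qed

text \<open>Source of the averaging: dividing the recurrence at \<open>n\<close> by
  \<open>f n\<close> shows that the weights \<open>q j * f (n - j) / f n\<close> sum to
  \<open>1\<close>, and dividing the one at \<open>n + 1\<close> by the same \<open>f n\<close>
  expresses the new ratio through the older ratios with the same weights, because the coefficients
  do not depend on \<open>n\<close>.\<close>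

lemma ratio_averaging:
  fixes f q :: "nat \<Rightarrow> 'a :: field"
  assumes nz: "\<And>i. i \<in> {n-D..n} \<Longrightarrow> f i \<noteq> 0" and n: "D \<le> n"
    and rec: "f n = (\<Sum>j=1..D. q j * f (n - j))" "f (n+1) = (\<Sum>j=1..D. q j * f (n + 1 - j))"
  shows "(\<Sum>j=1..D. q j * f (n - j) / f n) = 1"
    and "f (n+1) / f n = (\<Sum>j=1..D. q j * f (n - j) / f n * (f (n - j + 1) / f (n - j)))"
proof -
  show "(\<Sum>j=1..D. q j * f (n - j) / f n) = 1"
    using rec(1) nz[of n] by (simp flip: sum_divide_distrib)
  have "f (n+1) / f n = (\<Sum>j=1..D. q j * f (n + 1 - j) / f n)" unfolding rec(2) by (simp add: sum_divide_distrib)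
  also have "\<dots> = (\<Sum>j=1..D. q j * f (n - j) / f n * (f (n - j + 1) / f (n - j)))"
  proof (rule sum.cong)
    fix j assume j: "j \<in> {1..D}"
    then have "f (n - j) \<noteq> 0" "n + 1 - j = n - j + 1" using n nz[of "n-j"] by (auto intro: diff_le_mono2)
    then show "q j * f (n + 1 - j) / f n = q j * f (n - j) / f n * (f (n - j + 1) / f (n - j))" by simp
  qed simp
  finally show "f (n+1) / f n = (\<Sum>j=1..D. q j * f (n - j) / f n * (f (n - j + 1) / f (n - j)))" .
qed

text \<open>Here the weights are honest probabilities, so the contraction applies with
  \<open>\<epsilon> = 0\<close>. What remains is a lower bound on the weight
  \<open>c 1 * f (n-1) / f n\<close> of lag \<open>1\<close>, that is, an upper bound on
  \<open>f n / f (n-1)\<close>.\<close>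

lemma positive_recurrence_ratio:
  fixes f c :: "nat \<Rightarrow> real"
  assumes D: "1 \<le> D" and pos: "\<And>n. N \<le> n \<Longrightarrow> 0 < f n"
    and rec: "\<And>n. N + D \<le> n \<Longrightarrow> f n = (\<Sum>j=1..D. c j * f (n - j))"
    and c: "\<And>j. j \<in> {1..D} \<Longrightarrow> 0 \<le> c j" "0 < c 1"
  obtains \<mu> where "0 < \<mu>" "(\<lambda>n. f (n+1) / f n) \<longlonglongrightarrow> \<mu>"
proof -
  \<comment> \<open>Iterating \<open>c 1 * f (n-1) \<le> f n\<close> bounds \<open>f (n - j)\<close>
    by \<open>f (n-1) / c 1^(j-1)\<close>; inserted into the recurrence this bounds
    \<open>f n\<close> by \<open>C * f (n-1)\<close>.\<close>
  define C where "C = (\<Sum>j=1..D. c j / c 1^(j-1))"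
  define \<beta> where "\<beta> = c 1 / C"
  have step: "c 1 * f (n-1) \<le> f n" if "N + D \<le> n" for n
  proof -
    have "c 1 * f (n-1) \<le> (\<Sum>j=1..D. c j * f (n - j))"
      using D that c pos by (intro member_le_sum[of 1 _ "\<lambda>j. c j * f (n - j)"]) (auto intro!: mult_nonneg_nonneg less_imp_le[OF pos])
    then show ?thesis using rec[OF that] by simp
  qed
  have C1: "c 1 \<le> C" unfolding C_def
    using D c member_le_sum[of 1 "{1..D}" "\<lambda>j. c j / c 1^(j-1)"] by auto
  then have \<beta>: "0 < \<beta>" "\<beta> \<le> 1" using c by (auto simp: \<beta>_def)
  have older: "f (n - 1 - k) \<le> f (n - 1) / c 1^k" if "N + 2 * D \<le> n" "k < D" for n k
    using that(2)
  proof (induction k)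
    case (Suc k)
    have "c 1 * f (n - 1 - Suc k) \<le> f (n - 1 - k)"
      using step[of "n-1-k"] Suc.prems that(1) by simp
    also have "\<dots> \<le> f (n - 1) / c 1^k" using Suc by simp
    finally show ?case using c by (simp add: field_simps)
  qed auto
  have up: "f n \<le> C * f (n-1)" if "N + 2 * D \<le> n" for n
  proof -
    have "f n = (\<Sum>j=1..D. c j * f (n - j))" using that by (intro rec) simp
    also have "\<dots> \<le> (\<Sum>j=1..D. c j * (f (n - 1) / c 1^(j-1)))"
    proof (intro sum_mono mult_left_mono)
      fix j assume "j \<in> {1..D}"
      then show "f (n - j) \<le> f (n - 1) / c 1^(j-1)" using older[OF that, of "j-1"] by auto
    qed (use c in auto)
    also have "\<dots> = C * f (n-1)" by (simp add: C_def sum_distrib_right)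
    finally show ?thesis .
  qed
  define \<rho> where "\<rho> n = complex_of_real (f (n+1) / f n)" for n
  define M where "M = N + 2 * D"
  define d where "d = (\<Sum>i\<in>{M..<M+D}. \<Sum>j\<in>{M..<M+D}. norm (\<rho> i - \<rho> j))"
  have av: "averaged D \<beta> 0 \<rho> n" if "M + D \<le> n" for n
  proof -
    define a where "a j = c j * f (n - j) / f n" for j
    have pos': "0 < f i" if "i \<in> {n-D..n}" for i using that \<open>M + D \<le> n\<close> by (intro pos) (auto simp: M_def)
    have fn: "0 < f n" "\<And>i. i \<in> {n-D..n} \<Longrightarrow> f i \<noteq> 0" using pos' by force+
    have 1: "(\<Sum>j=1..D. a j) = 1" "f (n+1) / f n = (\<Sum>j=1..D. a j * (f (n - j + 1) / f (n - j)))"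
      unfolding a_def by (rule ratio_averaging; use that fn rec in \<open>auto simp: M_def\<close>)+
    have 2: "0 \<le> a j" if "j \<in> {1..D}" for j
    proof -
      have "0 < f (n - j)" using that by (intro pos') auto
      then show ?thesis using c(1)[OF that] fn(1) by (simp add: a_def)
    qed
    have "c 1 * f n \<le> c 1 * (C * f (n-1))" using up[of n] that c(2) by (simp add: M_def)
    then have 3: "\<beta> \<le> a 1" using fn C1 c(2) by (simp add: \<beta>_def a_def field_simps)
    have "(\<Sum>j=1..D. complex_of_real (a j)) = 1" using 1(1) by (metis of_real_1 of_real_sum)
    moreover have "\<rho> n = (\<Sum>j=1..D. complex_of_real (a j) * \<rho> (n - j))"
      unfolding \<rho>_def 1(2) by simp
    ultimately show ?thesis unfolding averaged_def using 1 2 3 by (intro exI[of _ "\<lambda>j. complex_of_real (a j)"] exI[of _ a]) auto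
  qed
  have d: "norm (\<rho> i - \<rho> j) \<le> d" if "i \<in> {M..<M+D}" "j \<in> {M..<M+D}" for i j
  proof -
    have "norm (\<rho> i - \<rho> j) \<le> (\<Sum>j\<in>{M..<M+D}. norm (\<rho> i - \<rho> j))" using that by (intro member_le_sum) auto
    also have "\<dots> \<le> d" unfolding d_def using that by (intro member_le_sum[of i]) (auto intro!: sum_nonneg)
    finally show ?thesis .
  qed
  have "0 \<le> d" by (auto simp: d_def intro!: sum_nonneg)
  have \<theta>: "1 - \<beta>^D < 1" "0 \<le> 1 - \<beta>^D" using \<beta> by (auto simp: power_le_one)
  have inc: "norm (\<rho> (n+1) - \<rho> n) \<le> 2 * d * (1 - \<beta>^D)^((n - M) div D)" if "M \<le> n" for n
    using averaged_converges(2)[where \<rho> = \<rho> and \<epsilon> = 0 and N = M and d = d and D = D and \<beta> = \<beta> and n = n] D \<beta> \<theta> d \<open>0 \<le> d\<close> av that by auto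
  obtain l where l: "\<rho> \<longlonglongrightarrow> l"
    using convergent_of_summable_increments[OF summable_mult[OF summable_power_div[OF \<theta>(2,1) D], of "2*d"] inc] by blast
  then have lim: "(\<lambda>n. f (n+1) / f n) \<longlonglongrightarrow> Re l"
    using tendsto_Re[OF l] by (simp add: \<rho>_def)
  moreover have "c 1 \<le> Re l"
  proof (rule LIMSEQ_le_const[OF lim], intro exI allI impI)
    fix n assume "M \<le> n"
    then show "c 1 \<le> f (n+1) / f n" using step[of "n+1"] pos[of n] D by (simp add: M_def field_simps)
  qed
  ultimately show ?thesis using that c by (metis less_le_trans)
qed

text \<open>\<open>f (n - j) / f n\<close> is a product of \<open>j\<close> inverted consecutive
  ratios. The point is the order of quantifiers: \<open>r\<close> is chosen before \<open>f\<close>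
  and \<open>n\<close>.\<close>

lemma ratio_product_continuous:
  fixes \<mu> :: "'a :: real_normed_field"
  assumes "\<mu> \<noteq> 0" "0 < \<epsilon>"
  shows "\<exists>r>0. \<forall>f n. j \<le> n \<longrightarrow> (\<forall>i\<in>{n-j..n}. f i \<noteq> 0) \<longrightarrow>
    (\<forall>i\<in>{n-j..<n}. norm (f (i+1) / f i - \<mu>) \<le> r) \<longrightarrow> norm (f (n - j) / f n - 1 / \<mu>^j) \<le> \<epsilon>"
  using assms(2)
proof (induction j arbitrary: \<epsilon>)
  case 0
  then show ?case by (intro exI[of _ 1]) auto
next
  case (Suc j)
  have "((\<lambda>p. fst p * (1 / snd p)) \<longlongrightarrow> 1 / \<mu>^j * (1 / \<mu>)) (at (1 / \<mu>^j, \<mu>))"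
    using \<open>\<mu> \<noteq> 0\<close> by (intro tendsto_eq_intros refl) auto
  then obtain d where d: "0 < d" and
    D: "\<And>x y. dist (x, y) (1 / \<mu>^j, \<mu>) < d \<Longrightarrow> (x, y) \<noteq> (1 / \<mu>^j, \<mu>) \<Longrightarrow> norm (x * (1 / y) - 1 / \<mu>^j * (1 / \<mu>)) < \<epsilon>"
    unfolding tendsto_iff eventually_at using \<open>0 < \<epsilon>\<close> by (fastforce simp: dist_norm)
  have D': "norm (x * (1 / y) - 1 / \<mu>^Suc j) \<le> \<epsilon>" if "norm (x - 1 / \<mu>^j) \<le> d/3" "norm (y - \<mu>) \<le> d/3" for x y
  proof (cases "(x, y) = (1 / \<mu>^j, \<mu>)")
    case False
    have "dist (x, y) (1 / \<mu>^j, \<mu>) \<le> dist x (1 / \<mu>^j) + dist y \<mu>"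
      unfolding dist_Pair_Pair by (rule sqrt_sum_squares_le_sum) auto
    also have "\<dots> < d" using that d by (simp add: dist_norm)
    finally show ?thesis using D[OF _ False] by (simp add: less_imp_le mult_ac)
  qed (use Suc.prems in \<open>auto simp: mult_ac\<close>)
  obtain r where r: "0 < r" and R: "\<And>f n. j \<le> n \<Longrightarrow> (\<forall>i\<in>{n-j..n}. f i \<noteq> 0) \<Longrightarrow>
    (\<forall>i\<in>{n-j..<n}. norm (f (i+1) / f i - \<mu>) \<le> r) \<Longrightarrow> norm (f (n - j) / f n - 1 / \<mu>^j) \<le> d/3"
    using Suc.IH[of "d/3"] d by auto
  show ?case
  proof (intro exI[of _ "min r (d/3)"] conjI allI impI)
    fix f :: "nat \<Rightarrow> 'a" and n
    assume n: "Suc j \<le> n" and nz: "\<forall>i\<in>{n - Suc j..n}. f i \<noteq> 0"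
      and near: "\<forall>i\<in>{n - Suc j..<n}. norm (f (i+1) / f i - \<mu>) \<le> min r (d/3)"
    have e: "n - Suc j + 1 = n - j" using n by simp
    have 1: "norm (f (n - j) / f n - 1 / \<mu>^j) \<le> d/3"
      using n nz near by (intro R) auto
    have "norm (f (n - Suc j + 1) / f (n - Suc j) - \<mu>) \<le> d/3"
      using near n by force
    then have "norm (f (n - j) / f n * (1 / (f (n - j) / f (n - Suc j))) - 1 / \<mu>^Suc j) \<le> \<epsilon>"
      unfolding e by (rule D'[OF 1])
    moreover have "f (n - j) \<noteq> 0" using nz by auto
    ultimately show "norm (f (n - Suc j) / f n - 1 / \<mu>^Suc j) \<le> \<epsilon>" by simp
  qed (use r d in auto)
qed

text \<open>As long as the ratios stay near \<open>\<mu>\<close>, the weights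
  \<open>q j * f (n - j) / f n\<close> stay near \<open>c j / \<mu>^j\<close>, which is a
  probability vector by the characteristic equation. The averaging then keeps the ratios near
  \<open>\<mu>\<close>. All constants precede \<open>q\<close>, \<open>f\<close> and
  \<open>N\<close>; this gives uniformity in the parameter later.\<close>

lemma recurrence_ratio_stable:
  fixes c :: "nat \<Rightarrow> real" and \<mu> r :: real
  assumes D: "1 \<le> D" and c: "\<And>j. j \<in> {1..D} \<Longrightarrow> 0 \<le> c j" "0 < c 1"
    and \<mu>: "0 < \<mu>" "(\<Sum>j=1..D. c j / \<mu>^j) = 1" and r: "0 < r"
  obtains \<eta> \<theta> K :: real where "0 < \<eta>" "0 \<le> \<theta>" "\<theta> < 1"
    "\<forall>q f N n. (\<forall>j\<in>{1..D}. norm (q j - complex_of_real (c j)) \<le> \<eta>) \<longrightarrow>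
       (\<forall>n\<ge>N + D. f n = (\<Sum>j=1..D. q j * f (n - j))) \<longrightarrow>
       (\<forall>i\<in>{N..<N+D}. norm (f (i+1) / f i - complex_of_real \<mu>) \<le> \<eta>) \<longrightarrow> N \<le> n \<longrightarrow>
       f n \<noteq> 0 \<and> norm (f (n+1) / f n - complex_of_real \<mu>) \<le> r \<and>
       norm (f (n+2) / f (n+1) - f (n+1) / f n) \<le> K * \<theta>^((n - N) div D)"
proof -
  define \<beta> where "\<beta> = c 1 / \<mu>"
  \<comment> \<open>Half of the gain \<open>\<beta>^D\<close> is sacrificed to the perturbation, so
    that \<open>\<theta> = 1 - \<beta>^D / 2\<close>.\<close>
  define \<epsilon> where "\<epsilon> = \<beta>^D / (8 * real D)"
  define \<theta> where "\<theta> = 1 - \<beta>^D + 4 * real D * \<epsilon>"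
  have "\<beta> \<le> (\<Sum>j=1..D. c j / \<mu>^j)"
    using D c \<mu> member_le_sum[of 1 "{1..D}" "\<lambda>j. c j / \<mu>^j"] by (simp add: \<beta>_def)
  then have \<beta>: "0 < \<beta>" "\<beta> \<le> 1" using \<mu> c by (auto simp: \<beta>_def)
  then have \<beta>D: "0 < \<beta>^D" "\<beta>^D \<le> 1" by (auto simp: power_le_one)
  have \<theta>': "\<theta> = 1 - \<beta>^D / 2" using D by (simp add: \<theta>_def \<epsilon>_def field_simps)
  have \<epsilon>: "0 < \<epsilon>" "2 * real D * \<epsilon> \<le> 1" and \<theta>: "0 \<le> \<theta>" "\<theta> < 1"
    unfolding \<theta>' using \<beta>D D by (auto simp: \<epsilon>_def)
  have "\<exists>s>0. \<forall>q f n. j \<le> n \<longrightarrow> norm (q - complex_of_real (c j)) \<le> s \<longrightarrow> (\<forall>i\<in>{n-j..n}. f i \<noteq> 0) \<longrightarrow>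
      (\<forall>i\<in>{n-j..<n}. norm (f (i+1) / f i - complex_of_real \<mu>) \<le> s) \<longrightarrow>
      norm (q * f (n - j) / f n - of_real (c j / \<mu>^j)) \<le> \<epsilon> / D" for j
  proof -
    have \<mu>0: "complex_of_real \<mu> \<noteq> 0" using \<mu> by simp
    define a where "a = 1 / complex_of_real \<mu>^j"
    have "((\<lambda>p. fst p * snd p) \<longlongrightarrow> complex_of_real (c j) * a) (at (complex_of_real (c j), a))"
      by (intro tendsto_eq_intros refl) auto
    moreover have "0 < \<epsilon> / D" using \<epsilon> D by simp
    ultimately obtain d where d: "0 < d" and
      dd: "\<And>x y. dist (x, y) (complex_of_real (c j), a) < d \<Longrightarrow> (x, y) \<noteq> (complex_of_real (c j), a) \<Longrightarrow> norm (x * y - complex_of_real (c j) * a) < \<epsilon> / D"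
      unfolding tendsto_iff eventually_at by (fastforce simp: dist_norm)
    obtain s where s: "0 < s" and
      ss: "\<And>f n. j \<le> n \<Longrightarrow> (\<forall>i\<in>{n-j..n}. f i \<noteq> 0) \<Longrightarrow>
         (\<forall>i\<in>{n-j..<n}. norm (f (i+1) / f i - complex_of_real \<mu>) \<le> s) \<Longrightarrow> norm (f (n - j) / f n - a) \<le> d / 3"
      unfolding a_def using ratio_product_continuous[OF \<mu>0, of "d/3" j] d by auto
    show ?thesis
    proof (intro exI[of _ "min s (d/3)"] conjI allI impI)
      fix q :: complex and f :: "nat \<Rightarrow> complex" and n
      assume *: "j \<le> n" "norm (q - complex_of_real (c j)) \<le> min s (d/3)" "\<forall>i\<in>{n-j..n}. f i \<noteq> 0"
        "\<forall>i\<in>{n-j..<n}. norm (f (i+1) / f i - complex_of_real \<mu>) \<le> min s (d/3)"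
      have "norm (f (n - j) / f n - a) \<le> d / 3" by (rule ss) (use * in auto)
      then have "dist q (complex_of_real (c j)) + dist (f (n - j) / f n) a < d" using *(2) d by (simp add: dist_norm)
      moreover have "dist (q, f (n - j) / f n) (complex_of_real (c j), a) \<le> dist q (complex_of_real (c j)) + dist (f (n - j) / f n) a"
        unfolding dist_Pair_Pair by (rule sqrt_sum_squares_le_sum) auto
      ultimately have "norm (q * (f (n - j) / f n) - complex_of_real (c j) * a) \<le> \<epsilon> / D"
        using dd[of q "f (n - j) / f n"] \<epsilon>(1) by (cases "(q, f (n - j) / f n) = (complex_of_real (c j), a)") auto
      then show "norm (q * f (n - j) / f n - of_real (c j / \<mu>^j)) \<le> \<epsilon> / D" by (simp add: a_def)
    qed (use s d in auto)
  qed
  then obtain s :: "nat \<Rightarrow> real" where s: "\<And>j. 0 < s j" and S: "\<And>j q f n. j \<le> n \<Longrightarrow>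
      norm (q - complex_of_real (c j)) \<le> s j \<Longrightarrow> (\<forall>i\<in>{n-j..n}. f i \<noteq> 0) \<Longrightarrow>
      (\<forall>i\<in>{n-j..<n}. norm (f (i+1) / f i - complex_of_real \<mu>) \<le> s j) \<Longrightarrow>
      norm (q * f (n - j) / f n - of_real (c j / \<mu>^j)) \<le> \<epsilon> / D" by metis
  \<comment> \<open>Radius within which the ratios must remain: \<open>\<mu>/2\<close> keeps them
    away from \<open>0\<close>, and the \<open>s j\<close> keep each weight within
    \<open>\<epsilon> / D\<close> of its limit.\<close>
  define R where "R = min (min r (\<mu>/2)) (Min (s ` {1..D}))"
  have R: "0 < R" "R \<le> r" "R \<le> \<mu>/2" "\<And>j. j \<in> {1..D} \<Longrightarrow> R \<le> s j"
    using r \<mu> s D by (auto simp: R_def min_le_iff_disj)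
  \<comment> \<open>Starting within \<open>\<eta>\<close> of \<open>\<mu>\<close> gives spread
    \<open>2 * \<eta>\<close> and hence a total excursion of
    \<open>\<eta> + 3 * (2 * \<eta>) / (1 - \<theta>) = \<eta> * F\<close>, which has to be
    \<open>R\<close>.\<close>
  define F where "F = 1 + 6 / (1 - \<theta>)"
  define \<eta> where "\<eta> = R / F"
  have F: "1 \<le> F" using \<theta> by (simp add: F_def)
  have \<eta>: "0 < \<eta>" "\<eta> \<le> R" "\<eta> + 3 * (2 * \<eta>) / (1 - \<theta>) = R"
  proof -
    have "\<eta> * F = R" using F by (simp add: \<eta>_def)
    then show "\<eta> + 3 * (2 * \<eta>) / (1 - \<theta>) = R" by (simp add: F_def algebra_simps)
    show "0 < \<eta>" using R(1) F by (simp add: \<eta>_def)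
    show "\<eta> \<le> R" using R(1) F mult_left_mono[OF F, of R] by (simp add: \<eta>_def divide_le_eq)
  qed
  show ?thesis
  proof (rule that[OF \<eta>(1) \<theta>], intro allI impI)
    fix q f :: "nat \<Rightarrow> complex" and N n
    assume "\<forall>j\<in>{1..D}. norm (q j - complex_of_real (c j)) \<le> \<eta>"
      and "\<forall>n\<ge>N + D. f n = (\<Sum>j=1..D. q j * f (n - j))"
      and "\<forall>i\<in>{N..<N+D}. norm (f (i+1) / f i - complex_of_real \<mu>) \<le> \<eta>"
      and n: "N \<le> n"
    then have q: "\<And>j. j \<in> {1..D} \<Longrightarrow> norm (q j - complex_of_real (c j)) \<le> \<eta>"
      and rec: "\<And>n. N + D \<le> n \<Longrightarrow> f n = (\<Sum>j=1..D. q j * f (n - j))"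
      and init: "\<And>i. i \<in> {N..<N+D} \<Longrightarrow> norm (f (i+1) / f i - complex_of_real \<mu>) \<le> \<eta>"
      by blast+
    define \<rho> where "\<rho> n = f (n+1) / f n" for n
    have W: "norm (\<rho> i - \<rho> j) \<le> 2 * \<eta>" if "i \<in> {N..<N+D}" "j \<in> {N..<N+D}" for i j
      using init[OF that(1)] init[OF that(2)] norm_triangle_ineq4[of "\<rho> i - \<mu>" "\<rho> j - \<mu>"] by (simp add: \<rho>_def)
    have last_in: "N+D-1 \<in> {N..<N+D}" using D by auto
    have near: "norm (\<rho> i - \<mu>) \<le> R" if "norm (\<rho> i - \<rho> (N+D-1)) \<le> 3 * (2 * \<eta>) / (1 - \<theta>)" for i
      using that init[OF last_in] norm_triangle_ineq[of "\<rho> i - \<rho> (N+D-1)" "\<rho> (N+D-1) - \<mu>"] \<eta>(3)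
      by (simp add: \<rho>_def)
    have nz: "f i \<noteq> 0 \<and> f (i+1) \<noteq> 0" if "norm (\<rho> i - \<mu>) \<le> R" for i
    proof -
      \<comment> \<open>Since division by \<open>0\<close> yields \<open>0\<close>, a non-zero ratio
        certifies that both its numerator and its denominator are non-zero.\<close>
      have "\<rho> i \<noteq> 0" using that R(1,3) \<mu>(1) by (auto simp: norm_minus_commute)
      then show ?thesis by (auto simp: \<rho>_def)
    qed
    have av: "averaged D \<beta> \<epsilon> \<rho> m"
      if m: "N + D \<le> m" and inv: "\<And>i. i \<in> {N..<m} \<Longrightarrow> norm (\<rho> i - \<rho> (N+D-1)) \<le> 3 * (2 * \<eta>) / (1 - \<theta>)" for m
    proof -
      have good: "norm (\<rho> i - \<mu>) \<le> R" if "i \<in> {N..<m}" for i using near inv that by blast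
      have fnz: "f i \<noteq> 0" if "i \<in> {m-D..m}" for i
      proof (cases "i = m")
        case True then show ?thesis using nz[OF good[of "m-1"]] m D by auto
      next
        case False
        then have "i \<in> {N..<m}" using m that by auto
        then show ?thesis using nz good by blast
      qed
      have 1: "(\<Sum>j=1..D. q j * f (m - j) / f m) = 1" "\<rho> m = (\<Sum>j=1..D. q j * f (m - j) / f m * \<rho> (m - j))"
        unfolding \<rho>_def by (rule ratio_averaging; use m fnz rec in auto)+
      have "norm (q j * f (m - j) / f m - of_real (c j / \<mu>^j)) \<le> \<epsilon> / D" if j: "j \<in> {1..D}" for j
      proof (rule S)
        show "norm (q j - complex_of_real (c j)) \<le> s j" using q[OF j] \<eta>(2) R(4)[OF j] by linarith
        show "\<forall>i\<in>{m-j..m}. f i \<noteq> 0" using j by (auto intro!: fnz)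
        show "\<forall>i\<in>{m-j..<m}. norm (f (i+1) / f i - complex_of_real \<mu>) \<le> s j"
        proof
          fix i assume "i \<in> {m-j..<m}"
          then have "norm (\<rho> i - \<mu>) \<le> R" using j m by (intro good) auto
          then show "norm (f (i+1) / f i - complex_of_real \<mu>) \<le> s j" using R(4)[OF j] by (simp add: \<rho>_def)
        qed
      qed (use j m in auto)
      then have "(\<Sum>j=1..D. norm (q j * f (m - j) / f m - of_real (c j / \<mu>^j))) \<le> (\<Sum>j=1..D. \<epsilon> / D)"
        by (rule sum_mono)
      also have "\<dots> = \<epsilon>" using D by simp
      finally have 2: "(\<Sum>j=1..D. norm (q j * f (m - j) / f m - of_real (c j / \<mu>^j))) \<le> \<epsilon>" .
      show ?thesis unfolding averaged_def
        by (rule exI[of _ "\<lambda>j. q j * f (m - j) / f m"], rule exI[of _ "\<lambda>j. c j / \<mu>^j"])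
           (use 1 2 c \<mu> in \<open>auto simp: \<beta>_def\<close>)
    qed
    have conv: "norm (\<rho> n - \<rho> (N+D-1)) \<le> 3 * (2 * \<eta>) / (1 - \<theta>)"
      "norm (\<rho> (n+1) - \<rho> n) \<le> 2 * (2 * \<eta>) * \<theta>^((n - N) div D)"
      using averaged_converges[where \<rho> = \<rho> and \<epsilon> = \<epsilon> and N = N and d = "2 * \<eta>" and D = D and \<beta> = \<beta> and n = n, folded \<theta>_def]
        D \<beta> \<epsilon> \<theta> W \<eta> av n by auto
    then show "f n \<noteq> 0 \<and> norm (f (n+1) / f n - complex_of_real \<mu>) \<le> r \<and>
       norm (f (n+2) / f (n+1) - f (n+1) / f n) \<le> 4 * \<eta> * \<theta>^((n - N) div D)"
      using near[OF conv(1)] nz[OF near[OF conv(1)]] R(2) by (simp add: \<rho>_def)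
  qed
qed

section \<open>Logarithms: from ratios to quasi-powers\<close>

lemma Ln_Lipschitz:
  assumes "0 < m" "m \<le> Re x" "m \<le> Re y"
  shows "norm (Ln x - Ln y) \<le> (1/m) * norm (x - y)"
proof (rule field_differentiable_bound)
  show "convex {z. m \<le> Re z}" by (rule convex_halfspace_Re_ge)
  show "(Ln has_field_derivative inverse z) (at z within {z. m \<le> Re z})" if "z \<in> {z. m \<le> Re z}" for z
    using that assms(1) by (intro has_field_derivative_at_within[OF has_field_derivative_Ln]) (auto simp: complex_nonpos_Reals_iff)
  show "norm (inverse z) \<le> 1 / m" if z: "z \<in> {z. m \<le> Re z}" for z
  proof -
    have "m \<le> norm z" using z complex_Re_le_cmod[of z] by simp
    then have "inverse (norm z) \<le> inverse m" using assms(1) by (rule le_imp_inverse_le)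
    then show ?thesis unfolding norm_inverse by (simp add: inverse_eq_divide)
  qed
qed (use assms in auto)

text \<open>Only finitely many continuous functions of \<open>s\<close> have to be controlled near
  \<open>0\<close>: the coefficients and one window of \<open>D\<close> ratios, taken so late that
  at \<open>s = 0\<close> they are already close to \<open>\<mu>\<close>.
  \<open>recurrence_ratio_stable\<close> then handles all later \<open>n\<close> with constants
  independent of \<open>s\<close>, and uniform limits of holomorphic functions are
  holomorphic.\<close>

theorem quasi_power_recurrence:
  fixes F q :: "nat \<Rightarrow> complex \<Rightarrow> complex" and f c :: "nat \<Rightarrow> real"
  assumes D: "1 \<le> D"
    and F: "\<And>n. F n holomorphic_on UNIV" and q: "\<And>j. q j holomorphic_on UNIV"
    and rec: "\<And>n s. N + D \<le> n \<Longrightarrow> F n s = (\<Sum>j=1..D. q j s * F (n - j) s)"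
    and c: "\<And>j. j \<in> {1..D} \<Longrightarrow> q j 0 = c j" "\<And>j. j \<in> {1..D} \<Longrightarrow> 0 \<le> c j" "0 < c 1"
    and f: "\<And>n. N \<le> n \<Longrightarrow> F n 0 = f n" "\<And>n. N \<le> n \<Longrightarrow> 0 < f n"
  obtains \<delta> \<l> \<psi> M \<kappa> where "0 < \<delta>" "\<l> holomorphic_on ball 0 \<delta>" "\<forall>n. \<psi> n holomorphic_on ball 0 \<delta>"
    "\<forall>n\<ge>M. \<forall>s\<in>ball 0 \<delta>. exp (\<psi> n s) = F n s"
    "uniform_limit (ball 0 \<delta>) (\<lambda>n s. \<psi> n s - of_nat n * \<l> s) \<kappa> sequentially"
    "\<forall>s\<in>ball 0 \<delta>. (\<Sum>j=1..D. q j s / exp (\<l> s)^j) = 1"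
    "\<forall>s\<in>ball 0 \<delta>. (\<lambda>n. F (n+1) s / F n s) \<longlonglongrightarrow> exp (\<l> s)"
proof -
  have frec: "f n = (\<Sum>j=1..D. c j * f (n - j))" if "N + D \<le> n" for n
  proof -
    have "complex_of_real (f n) = (\<Sum>j=1..D. q j 0 * F (n - j) 0)" using rec[OF that, of 0] f(1)[of n] that by simp
    also have "\<dots> = (\<Sum>j=1..D. complex_of_real (c j * f (n - j)))"
      using that f(1) c(1) by (intro sum.cong) auto
    finally have "complex_of_real (f n) = complex_of_real (\<Sum>j=1..D. c j * f (n - j))" by simp
    then show ?thesis unfolding of_real_eq_iff .
  qed
  obtain \<mu> where \<mu>: "0 < \<mu>" and flim: "(\<lambda>n. f (n+1) / f n) \<longlonglongrightarrow> \<mu>"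
    by (rule positive_recurrence_ratio[OF D f(2) frec c(2,3)])
  have char: "(\<Sum>j=1..D. c j / \<mu>^j) = 1"
  proof (rule characteristic_equation_of_ratio_limit[of N f])
    show "f n \<noteq> 0" if "N \<le> n" for n using f(2)[OF that] by simp
  qed (use \<mu> flim frec in auto)
  obtain \<eta> \<theta> K :: real where \<eta>: "0 < \<eta>" and \<theta>: "0 \<le> \<theta>" "\<theta> < 1" and
    stable: "\<forall>q f N n. (\<forall>j\<in>{1..D}. norm (q j - complex_of_real (c j)) \<le> \<eta>) \<longrightarrow>
       (\<forall>n\<ge>N + D. f n = (\<Sum>j=1..D. q j * f (n - j))) \<longrightarrow>
       (\<forall>i\<in>{N..<N+D}. norm (f (i+1) / f i - complex_of_real \<mu>) \<le> \<eta>) \<longrightarrow> N \<le> n \<longrightarrow>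
       f n \<noteq> 0 \<and> norm (f (n+1) / f n - complex_of_real \<mu>) \<le> \<mu> / 2 \<and>
       norm (f (n+2) / f (n+1) - f (n+1) / f n) \<le> K * \<theta>^((n - N) div D)"
    by (rule recurrence_ratio_stable[OF D c(2,3) \<mu> char half_gt_zero[OF \<mu>]])
  have "eventually (\<lambda>n. dist (f (n+1) / f n) \<mu> < \<eta>) sequentially" using flim \<eta> by (simp add: tendsto_iff)
  then obtain M0 where M0: "\<And>n. M0 \<le> n \<Longrightarrow> dist (f (n+1) / f n) \<mu> < \<eta>" by (auto simp: eventually_sequentially)
  define M where "M = max M0 N"
  have M: "N \<le> M" by (simp add: M_def)
  have cont: "(F n \<longlongrightarrow> F n 0) (nhds 0)" "(q n \<longlongrightarrow> q n 0) (nhds 0)" for n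
    using F[of n] q[of n]
    by (auto dest!: holomorphic_on_imp_continuous_on simp: continuous_on_eq_continuous_at isCont_def tendsto_at_iff_tendsto_nhds)
  have "eventually (\<lambda>s. norm (q j s - complex_of_real (c j)) < \<eta>) (nhds 0)" if "j \<in> {1..D}" for j
  proof -
    have "((\<lambda>s. norm (q j s - complex_of_real (c j))) \<longlongrightarrow> norm (q j 0 - complex_of_real (c j))) (nhds 0)"
      by (intro tendsto_norm tendsto_diff tendsto_const cont)
    then show ?thesis by (rule order_tendstoD) (use \<eta> c(1)[OF that] in simp)
  qed
  moreover have "eventually (\<lambda>s. norm (F (i+1) s / F i s - complex_of_real \<mu>) < \<eta>) (nhds 0)" if "i \<in> {M..<M+D}" for i
  proof -
    have i: "N \<le> i" "M0 \<le> i" using that by (auto simp: M_def)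
    have "F i 0 \<noteq> 0" using f[OF i(1)] by simp
    then have "((\<lambda>s. norm (F (i+1) s / F i s - complex_of_real \<mu>)) \<longlongrightarrow> norm (F (i+1) 0 / F i 0 - complex_of_real \<mu>)) (nhds 0)"
      by (intro tendsto_norm tendsto_diff tendsto_divide tendsto_const cont)
    moreover have "F (i+1) 0 / F i 0 - complex_of_real \<mu> = complex_of_real (f (i+1) / f i - \<mu>)" using f i by simp
    then have "norm (F (i+1) 0 / F i 0 - complex_of_real \<mu>) < \<eta>"
      using M0[OF i(2)] by (simp only: norm_of_real dist_real_def)
    ultimately show ?thesis by (rule order_tendstoD)
  qed
  moreover have "eventually (\<lambda>s. 0 < Re (F M s)) (nhds 0)"
    by (rule order_tendstoD(1)[OF tendsto_Re[OF cont(1)]]) (use f[OF M] in simp)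
  ultimately have "eventually (\<lambda>s. (\<forall>j\<in>{1..D}. norm (q j s - complex_of_real (c j)) < \<eta>) \<and>
      (\<forall>i\<in>{M..<M+D}. norm (F (i+1) s / F i s - complex_of_real \<mu>) < \<eta>) \<and> 0 < Re (F M s)) (nhds 0)"
    by (intro eventually_conj eventually_ball_finite) auto
  then obtain \<delta> where \<delta>: "0 < \<delta>" and near:
    "\<And>s. s \<in> ball 0 \<delta> \<Longrightarrow> (\<forall>j\<in>{1..D}. norm (q j s - complex_of_real (c j)) < \<eta>) \<and>
      (\<forall>i\<in>{M..<M+D}. norm (F (i+1) s / F i s - complex_of_real \<mu>) < \<eta>) \<and> 0 < Re (F M s)"
    unfolding eventually_nhds_metric by (auto simp: dist_commute)
  define B where "B = ball (0::complex) \<delta>"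
  define \<rho> where "\<rho> n s = F (n+1) s / F n s" for n s
  have st: "F n s \<noteq> 0" "norm (\<rho> n s - \<mu>) \<le> \<mu> / 2" "norm (\<rho> (n+1) s - \<rho> n s) \<le> K * \<theta>^((n - M) div D)"
    if "s \<in> B" "M \<le> n" for s n
  proof -
    have "F n s \<noteq> 0 \<and> norm (F (n+1) s / F n s - complex_of_real \<mu>) \<le> \<mu> / 2 \<and>
           norm (F (n+2) s / F (n+1) s - F (n+1) s / F n s) \<le> K * \<theta>^((n - M) div D)"
      using near[of s] that M
      by (intro stable[rule_format, where f = "\<lambda>n. F n s" and q = "\<lambda>j. q j s"] rec) (auto simp: B_def less_imp_le)
    then show "F n s \<noteq> 0" "norm (\<rho> n s - \<mu>) \<le> \<mu> / 2" "norm (\<rho> (n+1) s - \<rho> n s) \<le> K * \<theta>^((n - M) div D)"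
      by (auto simp: \<rho>_def)
  qed
  define T where "T = (\<Sum>i. K * \<theta>^(i div D))"
  define e where "e k = \<theta>^(k div D) * T" for k
  note sum\<theta> = summable_power_div[OF \<theta> D]
  have K0: "0 \<le> K" 
  proof -
    have "0 \<in> B" using \<delta> by (simp add: B_def)
    then have "norm (\<rho> (M+1) 0 - \<rho> M 0) \<le> K" using st(3)[of 0 M] by simp
    then show ?thesis using norm_ge_zero order.trans by blast
  qed
  define \<Lambda> where "\<Lambda> s = lim (\<lambda>n. \<rho> n s)" for s
  have \<Lambda>_tail: "(\<lambda>n. \<rho> n s) \<longlonglongrightarrow> \<Lambda> s \<and> (\<forall>n\<ge>M. norm (\<rho> n s - \<Lambda> s) \<le> e (n - M))" if s: "s \<in> B" for s
  proof -
    from convergent_of_summable_increments[of "\<lambda>i. K * \<theta>^(i div D)" M "\<lambda>n. \<rho> n s", OF summable_mult[OF sum\<theta>] st(3)[OF s]]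
    obtain l where l: "(\<lambda>n. \<rho> n s) \<longlonglongrightarrow> l"
      and tail: "\<And>n. M \<le> n \<Longrightarrow> norm (\<rho> n s - l) \<le> (\<Sum>i. K * \<theta>^((i + (n - M)) div D))" by blast
    have "\<Lambda> s = l" unfolding \<Lambda>_def by (rule limI[OF l])
    moreover have le: "(\<Sum>i. K * \<theta>^((i + k) div D)) \<le> e k" for k
    proof -
      have "(\<Sum>i. K * \<theta>^((i + k) div D)) \<le> (\<Sum>i. \<theta>^(k div D) * (K * \<theta>^(i div D)))"
      proof (rule suminf_le)
        fix i
        have "\<theta>^((i + k) div D) \<le> \<theta>^(k div D + i div D)"
          using \<theta> div_add1_eq[of i k D] by (intro power_decreasing) auto
        then show "K * \<theta>^((i + k) div D) \<le> \<theta>^(k div D) * (K * \<theta>^(i div D))"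
          using K0 by (auto simp: power_add mult_ac intro: mult_left_mono)
      next
        show "summable (\<lambda>i. K * \<theta>^((i + k) div D))"
          using summable_iff_shift[of "\<lambda>i. K * \<theta>^(i div D)" k] summable_mult[OF sum\<theta>, of K] by simp
      qed (intro summable_mult sum\<theta>)
      also have "\<dots> = e k" unfolding e_def T_def by (rule suminf_mult[OF summable_mult[OF sum\<theta>]])
      finally show ?thesis .
    qed
    moreover have "norm (\<rho> n s - l) \<le> e (n - M)" if "M \<le> n" for n
      using tail[OF that] le by (rule order.trans)
    ultimately show ?thesis using l by simp
  qed
  then have \<Lambda>: "\<And>s. s \<in> B \<Longrightarrow> (\<lambda>n. \<rho> n s) \<longlonglongrightarrow> \<Lambda> s"
    and tail: "\<And>s n. s \<in> B \<Longrightarrow> M \<le> n \<Longrightarrow> norm (\<rho> n s - \<Lambda> s) \<le> e (n - M)" by auto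
  have e: "summable e" unfolding e_def by (intro summable_mult2 sum\<theta>)
  have Re_\<rho>: "\<mu> / 2 \<le> Re (\<rho> n s)" if "s \<in> B" "M \<le> n" for n s
    using st(2)[OF that] complex_Re_le_cmod[of "\<mu> - \<rho> n s"] by (simp add: norm_minus_commute)
  have Re_\<Lambda>: "\<mu> / 2 \<le> Re (\<Lambda> s)" if "s \<in> B" for s
    using Re_\<rho> that by (intro LIMSEQ_le_const[OF tendsto_Re[OF \<Lambda>[OF that]]]) auto
  have nonpos: "z \<notin> \<real>\<^sub>\<le>\<^sub>0" if "0 < Re z" for z using that by (auto simp: complex_nonpos_Reals_iff)
  have opB: "open B" by (simp add: B_def)
  have F_hol: "F n holomorphic_on B" for n using F holomorphic_on_subset by blast
  have \<rho>_hol: "\<rho> n holomorphic_on B" if "M \<le> n" for n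
    unfolding \<rho>_def using st(1) that F_hol by (intro holomorphic_intros) auto
  have unif: "uniform_limit B (\<lambda>n. \<rho> (n + M)) \<Lambda> sequentially"
  proof (rule uniform_limitI)
    fix \<epsilon> :: real assume "0 < \<epsilon>"
    then have "eventually (\<lambda>n. e n < \<epsilon>) sequentially" using order_tendstoD(2)[OF summable_LIMSEQ_zero[OF e]] by blast
    then show "eventually (\<lambda>n. \<forall>s\<in>B. dist (\<rho> (n + M) s) (\<Lambda> s) < \<epsilon>) sequentially"
    proof eventually_elim
      case (elim n)
      then show ?case using tail[of _ "n + M"] by (fastforce simp: dist_norm)
    qed
  qed
  have \<Lambda>_hol: "\<Lambda> holomorphic_on B"
  proof (rule holomorphic_uniform_sequence[OF opB, where f = "\<lambda>n. \<rho> (n + M)"])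
    show "\<rho> (n + M) holomorphic_on B" for n by (rule \<rho>_hol) simp
    show "\<exists>d>0. cball x d \<subseteq> B \<and> uniform_limit (cball x d) (\<lambda>n. \<rho> (n + M)) \<Lambda> sequentially" if "x \<in> B" for x
      using opB that uniform_limit_on_subset[OF unif] unfolding open_contains_cball by blast
  qed
  define \<l> where "\<l> s = Ln (\<Lambda> s)" for s
  define L where "L n s = Ln (\<rho> (M + n) s)" for n s
  have \<l>_hol: "\<l> holomorphic_on B" unfolding \<l>_def
    using Re_\<Lambda> \<mu> by (intro holomorphic_on_Ln' \<Lambda>_hol nonpos) force
  have L_hol: "L n holomorphic_on B" for n unfolding L_def
    using Re_\<rho>[of _ "M+n"] \<mu> by (intro holomorphic_on_Ln' \<rho>_hol nonpos) force+
  have exp_\<l>: "exp (\<l> s) = \<Lambda> s" if "s \<in> B" for s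
    using Re_\<Lambda>[OF that] \<mu> by (auto simp: \<l>_def intro!: exp_Ln)
  have L_\<l>: "norm (L n s - \<l> s) \<le> (1 / (\<mu>/2)) * e n" if "s \<in> B" for n s
  proof -
    have "norm (L n s - \<l> s) \<le> (1 / (\<mu>/2)) * norm (\<rho> (M + n) s - \<Lambda> s)"
      unfolding L_def \<l>_def using \<mu> Re_\<rho>[OF that, of "M+n"] Re_\<Lambda>[OF that] by (intro Ln_Lipschitz) auto
    also have "\<dots> \<le> (1 / (\<mu>/2)) * e n" using tail[OF that, of "M+n"] \<mu> by (intro mult_left_mono) auto
    finally show ?thesis .
  qed
  \<comment> \<open>A logarithm of \<open>F n s\<close> built from logarithms of ratios. These stay
    in the right half-plane, whereas \<open>F n s\<close> itself may wind around \<open>0\<close> as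
    \<open>n\<close> grows, so that its principal logarithm would not be holomorphic in
    \<open>s\<close>.\<close>
  define \<psi> where "\<psi> n s = Ln (F M s) + (\<Sum>i<n-M. L i s)" for n s
  define \<kappa> where "\<kappa> s = (Ln (F M s) - of_nat M * \<l> s) + (\<Sum>i. L i s - \<l> s)" for s
  have "uniform_limit B (\<lambda>n s. \<Sum>i<n. L i s - \<l> s) (\<lambda>s. \<Sum>i. L i s - \<l> s) sequentially"
    by (rule Weierstrass_m_test[OF L_\<l>]) (auto intro: summable_mult e)
  then have "uniform_limit B (\<lambda>n s. \<Sum>i<n-M. L i s - \<l> s) (\<lambda>s. \<Sum>i. L i s - \<l> s) sequentially"
    by (rule filterlim_compose) (rule filterlim_minus_const_nat_at_top)
  then have "uniform_limit B (\<lambda>n s. (Ln (F M s) - of_nat M * \<l> s) + (\<Sum>i<n-M. L i s - \<l> s)) \<kappa> sequentially"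
    unfolding \<kappa>_def by (intro uniform_limit_intros)
  moreover have "eventually (\<lambda>n. \<forall>s\<in>B. (Ln (F M s) - of_nat M * \<l> s) + (\<Sum>i<n-M. L i s - \<l> s) = \<psi> n s - of_nat n * \<l> s) sequentially"
    by (intro eventually_sequentiallyI[of M]) (auto simp: \<psi>_def sum_subtractf of_nat_diff algebra_simps)
  ultimately have ulim: "uniform_limit B (\<lambda>n s. \<psi> n s - of_nat n * \<l> s) \<kappa> sequentially"
    by (subst (asm) uniform_limit_cong) auto
  have exp_\<psi>: "exp (\<psi> (M + k) s) = F (M + k) s" if "s \<in> B" for k s
  proof (induction k)
    case 0
    then show ?case using st(1)[OF that, of M] by (simp add: \<psi>_def)
  next
    case (Suc k)
    have "\<rho> (M + k) s \<noteq> 0" using Re_\<rho>[OF that, of "M+k"] \<mu> by auto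
    then have "exp (\<psi> (M + Suc k) s) = exp (\<psi> (M + k) s) * \<rho> (M + k) s" by (simp add: \<psi>_def exp_add L_def)
    then show ?case using Suc st(1)[OF that, of "M+k"] by (simp add: \<rho>_def)
  qed
  have H1: "\<psi> n holomorphic_on ball 0 \<delta>" for n unfolding \<psi>_def B_def[symmetric]
    using near by (intro holomorphic_on_add holomorphic_on_sum holomorphic_on_Ln' F_hol L_hol nonpos) (auto simp: B_def)
  have H2: "exp (\<psi> n s) = F n s" if "M \<le> n" "s \<in> ball 0 \<delta>" for n s
    using exp_\<psi>[of s "n-M"] that by (simp add: B_def)
  have H3: "(\<lambda>n. F (n+1) s / F n s) \<longlonglongrightarrow> exp (\<l> s)" if "s \<in> ball 0 \<delta>" for s
    using \<Lambda>[of s] exp_\<l>[of s] that by (simp add: B_def \<rho>_def)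
  have H4: "(\<Sum>j=1..D. q j s / exp (\<l> s)^j) = 1" if "s \<in> ball 0 \<delta>" for s
  proof (rule characteristic_equation_of_ratio_limit[of M "\<lambda>n. F n s"])
    show "F n s \<noteq> 0" if "M \<le> n" for n using st(1)[of s n] that \<open>s \<in> ball 0 \<delta>\<close> by (simp add: B_def)
    show "F n s = (\<Sum>j=1..D. q j s * F (n - j) s)" if "M + D \<le> n" for n using rec[of n s] that M by simp
  qed (use H3[OF that] in auto)
  show ?thesis
    using that[of \<delta> \<l> \<psi> M \<kappa>] \<delta> \<l>_hol[unfolded B_def] H1 H2 ulim[unfolded B_def] H4 H3 by blast
qed

subsection \<open>From quasi-powers to the central limit theorem\<close>

text \<open>Used in two directions: along the imaginary axis for the characteristic functions and
  along the real axis for the positivity of the slopes.\<close>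

lemma holomorphic_second_order_quotient:
  assumes f: "f holomorphic_on ball 0 \<delta>" and \<delta>: "0 < \<delta>"
  shows "((\<lambda>s. (f s - f 0 - deriv f 0 * s) / s\<^sup>2) \<longlongrightarrow> (deriv ^^ 2) f 0 / 2) (at 0)"
proof -
  have hol: "(deriv ^^ i) f holomorphic_on ball 0 \<delta>" for i by (rule holomorphic_higher_deriv[OF f]) simp
  have der: "((deriv ^^ i) f has_field_derivative (deriv ^^ Suc i) f x) (at x within cball 0 (\<delta>/2))"
    if "x \<in> cball 0 (\<delta>/2)" for i x
  proof -
    have "x \<in> ball 0 \<delta>" using that \<delta> by auto
    then show ?thesis using holomorphic_derivI[OF hol[of i] open_ball] by (auto intro: has_field_derivative_at_within)
  qed
  have "compact ((deriv ^^ 3) f ` cball 0 (\<delta>/2))"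
    using hol[of 3] \<delta> by (intro compact_continuous_image holomorphic_on_imp_continuous_on) (auto elim!: holomorphic_on_subset)
  then obtain B where B: "\<And>x. x \<in> cball 0 (\<delta>/2) \<Longrightarrow> norm ((deriv ^^ 3) f x) \<le> B"
    using compact_imp_bounded bounded_iff by (metis imageI)
  have bound: "norm ((f s - f 0 - deriv f 0 * s) / s\<^sup>2 - (deriv ^^ 2) f 0 / 2) \<le> B * norm s"
    if s: "s \<in> cball 0 (\<delta>/2)" "s \<noteq> 0" for s
  proof -
    have "norm ((deriv ^^ 0) f s - (\<Sum>i\<le>2. (deriv ^^ i) f 0 * (s - 0)^i / fact i)) \<le> B * norm (s - 0)^Suc 2 / fact 2"
      by (rule complex_Taylor[where S = "cball 0 (\<delta>/2)" and f = "\<lambda>i. (deriv ^^ i) f"])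
         (use der B s \<delta> in \<open>auto simp: numeral_3_eq_3 numeral_2_eq_2\<close>)
    then have "norm (f s - f 0 - deriv f 0 * s - (deriv ^^ 2) f 0 / 2 * s\<^sup>2) \<le> B * norm s * (norm s)\<^sup>2 / 2"
      by (simp add: numeral_2_eq_2 algebra_simps norm_mult)
    moreover have "0 \<le> B" using B[OF s(1)] norm_ge_zero order.trans by blast
    ultimately have "norm (f s - f 0 - deriv f 0 * s - (deriv ^^ 2) f 0 / 2 * s\<^sup>2) \<le> B * norm s * (norm s)\<^sup>2"
      by (smt (verit) field_sum_of_halves mult_nonneg_nonneg norm_ge_zero zero_le_power2)
    moreover have "(f s - f 0 - deriv f 0 * s) / s\<^sup>2 - (deriv ^^ 2) f 0 / 2 = (f s - f 0 - deriv f 0 * s - (deriv ^^ 2) f 0 / 2 * s\<^sup>2) / s\<^sup>2"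
      using s by (simp add: diff_divide_distrib)
    ultimately show ?thesis using s by (simp add: norm_divide norm_power divide_le_eq)
  qed
  show ?thesis
  proof (rule Lim_null[THEN iffD2], rule Lim_null_comparison)
    show "eventually (\<lambda>s. norm ((f s - f 0 - deriv f 0 * s) / s\<^sup>2 - (deriv ^^ 2) f 0 / 2) \<le> B * norm s) (at 0)"
      unfolding eventually_at using \<delta> bound by (intro exI[of _ "\<delta>/2"]) auto
    show "((\<lambda>s. B * norm s) \<longlongrightarrow> 0) (at 0)" by (intro tendsto_eq_intros refl) auto
  qed
qed

text \<open>\<open>exp \<psi>\<close> is the moment generating function times the cardinality of
  \<open>A\<close>. The factor is an additive constant in \<open>\<psi>\<close> and disappears under
  differentiation, which leaves the first two cumulants.\<close>

lemma cumulants_of_uniform: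
  fixes X :: "'a \<Rightarrow> nat"
  assumes A: "finite A" "A \<noteq> {}" and \<delta>: "0 < \<delta>" and \<psi>: "\<psi> holomorphic_on ball 0 \<delta>"
    and mgf: "\<And>s. s \<in> ball 0 \<delta> \<Longrightarrow> exp (\<psi> s) = (\<Sum>a\<in>A. exp (s * of_nat (X a)))"
  shows "deriv \<psi> 0 = of_real (measure_pmf.expectation (pmf_of_set A) (\<lambda>a. real (X a)))"
    and "(deriv ^^ 2) \<psi> 0 = of_real (measure_pmf.variance (pmf_of_set A) (\<lambda>a. real (X a)))"
proof -
  define f where "f k s = (\<Sum>a\<in>A. of_nat (X a)^k * exp (s * complex_of_nat (X a)))" for k s
  have f': "(f k has_field_derivative f (Suc k) s) (at s)" for k s
    unfolding f_def by (auto intro!: derivative_eq_intros sum.cong simp: mult_ac)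
  have exp_\<psi>: "exp (\<psi> s) = f 0 s" if "s \<in> ball 0 \<delta>" for s using mgf[OF that] by (simp add: f_def)
  have \<psi>': "(\<psi> has_field_derivative deriv \<psi> s) (at s)" if "s \<in> ball 0 \<delta>" for s
    using holomorphic_derivI[OF \<psi> open_ball that] .
  have d1: "deriv \<psi> s = f 1 s / f 0 s" if s: "s \<in> ball 0 \<delta>" for s
  proof -
    have "((\<lambda>s. exp (\<psi> s)) has_field_derivative exp (\<psi> s) * deriv \<psi> s) (at s)"
      using DERIV_chain2[OF DERIV_exp \<psi>'[OF s]] .
    then have "(f 0 has_field_derivative exp (\<psi> s) * deriv \<psi> s) (at s)"
      by (rule has_field_derivative_transform_within_open[OF _ open_ball s]) (use exp_\<psi> in auto)
    then have "f 1 s = f 0 s * deriv \<psi> s" using DERIV_unique f'[of 0 s] exp_\<psi>[OF s] by fastforce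
    then show ?thesis using exp_\<psi>[OF s] by (metis exp_not_eq_zero nonzero_mult_div_cancel_left)
  qed
  have c0: "f 0 0 = card A" "f 0 0 \<noteq> 0" using A by (auto simp: f_def)
  have "((\<lambda>s. f 1 s / f 0 s) has_field_derivative (f 2 0 * f 0 0 - f 1 0 * f 1 0) / (f 0 0 * f 0 0)) (at 0)"
    using DERIV_divide[OF f'[of 1 0] f'[of 0 0] c0(2)] by (simp add: numeral_2_eq_2)
  then have "(deriv \<psi> has_field_derivative (f 2 0 * f 0 0 - f 1 0 * f 1 0) / (f 0 0 * f 0 0)) (at 0)"
    by (rule has_field_derivative_transform_within_open[OF _ open_ball[of 0 \<delta>]]) (use \<delta> d1 in auto)
  then have d2: "(deriv ^^ 2) \<psi> 0 = f 2 0 / f 0 0 - (f 1 0 / f 0 0)\<^sup>2"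
    using c0(2) by (simp add: DERIV_imp_deriv numeral_2_eq_2 field_simps)
  have E: "measure_pmf.expectation (pmf_of_set A) (\<lambda>a. real (X a)^k) = Re (f k 0) / card A" "Im (f k 0) = 0" for k
    using A by (auto simp: f_def integral_pmf_of_set simp flip: of_nat_power of_nat_sum)
  have E': "complex_of_real (measure_pmf.expectation (pmf_of_set A) (\<lambda>a. real (X a)^k)) = f k 0 / f 0 0" for k
    unfolding E c0 by (simp add: complex_eq_iff E)
  show "deriv \<psi> 0 = of_real (measure_pmf.expectation (pmf_of_set A) (\<lambda>a. real (X a)))"
    using E'[of 1] d1[of 0] \<delta> by simp
  have "measure_pmf.variance (pmf_of_set A) (\<lambda>a. real (X a)) =
     measure_pmf.expectation (pmf_of_set A) (\<lambda>a. real (X a)^2) - (measure_pmf.expectation (pmf_of_set A) (\<lambda>a. real (X a)))\<^sup>2"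
    using A by (intro measure_pmf.variance_eq integrable_measure_pmf_finite) auto
  then show "(deriv ^^ 2) \<psi> 0 = of_real (measure_pmf.variance (pmf_of_set A) (\<lambda>a. real (X a)))"
    unfolding d2 using E'[of 1] E'[of 2] by simp
qed

lemma char_standardized_uniform:
  fixes X :: "'a \<Rightarrow> nat"
  assumes A: "finite A" "A \<noteq> {}"
  shows "char (distr (measure_pmf (pmf_of_set A)) borel (\<lambda>a. (real (X a) - m) / \<sigma>)) t =
    exp (- (\<i> * t / \<sigma>) * m) * (\<Sum>a\<in>A. exp (\<i> * t / \<sigma> * of_nat (X a))) / card A"
proof -
  have "char (distr (measure_pmf (pmf_of_set A)) borel (\<lambda>a. (real (X a) - m) / \<sigma>)) t =
      (\<Sum>a\<in>A. pmf (pmf_of_set A) a *\<^sub>R iexp (t * ((real (X a) - m) / \<sigma>)))"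
    unfolding char_def using A by (subst integral_distr) (auto simp: set_pmf_of_set[OF A(2,1)] simp del: pmf_of_set intro!: integral_measure_pmf)
  also have "\<dots> = (\<Sum>a\<in>A. exp (- (\<i> * t / \<sigma>) * m) * exp (\<i> * t / \<sigma> * of_nat (X a)) / card A)"
    using A by (intro sum.cong refl)
      (simp add: scaleR_conv_of_real divide_inverse algebra_simps flip: exp_add)
  finally show ?thesis by (simp add: sum_distrib_left sum_divide_distrib)
qed

text \<open>Uniform convergence of holomorphic functions passes to derivatives, so the cumulants are
  linear in \<open>n\<close> up to \<open>o(1)\<close> rather than merely asymptotically linear. The
  limit law is conditional on \<open>0 < v\<close>, since nothing here excludes degenerate
  families.\<close>

theorem quasi_power_CLT:
  fixes X :: "nat \<Rightarrow> nat" and A :: "nat \<Rightarrow> nat set" and \<l> \<kappa> :: "complex \<Rightarrow> complex" and \<psi> :: "nat \<Rightarrow> complex \<Rightarrow> complex"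
  defines "E \<equiv> \<lambda>n. measure_pmf.expectation (pmf_of_set (A n)) (\<lambda>a. real (X a))"
    and "V \<equiv> \<lambda>n. measure_pmf.variance (pmf_of_set (A n)) (\<lambda>a. real (X a))"
  assumes A: "\<And>n. M \<le> n \<Longrightarrow> finite (A n) \<and> A n \<noteq> {}"
    and \<delta>: "0 < \<delta>" and \<l>: "\<l> holomorphic_on ball 0 \<delta>" and \<psi>: "\<And>n. \<psi> n holomorphic_on ball 0 \<delta>"
    and mgf: "\<And>n s. M \<le> n \<Longrightarrow> s \<in> ball 0 \<delta> \<Longrightarrow> exp (\<psi> n s) = (\<Sum>a\<in>A n. exp (s * of_nat (X a)))"
    and lim: "uniform_limit (ball 0 \<delta>) (\<lambda>n s. \<psi> n s - of_nat n * \<l> s) \<kappa> sequentially"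
  obtains \<mu> v \<mu>' v' where "deriv \<l> 0 = of_real \<mu>" "(deriv ^^ 2) \<l> 0 = of_real v" "0 \<le> \<mu>"
    "(\<lambda>n. E n - (\<mu> * real n + \<mu>')) \<longlonglongrightarrow> 0" "(\<lambda>n. V n - (v * real n + v')) \<longlonglongrightarrow> 0"
    "0 < v \<longrightarrow> weak_conv_m
         (\<lambda>n. distr (measure_pmf (pmf_of_set (A n))) borel (\<lambda>a. (real (X a) - E n) / sqrt (V n)))
         std_normal_distribution"
proof -
  define \<epsilon> where "\<epsilon> n s = \<psi> n s - of_nat n * \<l> s" for n s
  have \<epsilon>_lim: "uniform_limit (ball 0 \<delta>) \<epsilon> \<kappa> sequentially" using lim by (simp add: \<epsilon>_def[abs_def])
  have \<epsilon>_hol: "\<epsilon> n holomorphic_on ball 0 \<delta>" for n unfolding \<epsilon>_def by (intro holomorphic_intros \<psi> \<l>)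
  have 0: "0 \<in> ball 0 \<delta>" using \<delta> by simp
  have d\<epsilon>: "(deriv ^^ k) (\<epsilon> n) 0 = (deriv ^^ k) (\<psi> n) 0 - of_nat n * (deriv ^^ k) \<l> 0" for k n
  proof -
    have "(deriv ^^ k) (\<epsilon> n) 0 = (deriv ^^ k) (\<psi> n) 0 - (deriv ^^ k) (\<lambda>s. of_nat n * \<l> s) 0"
      unfolding \<epsilon>_def by (rule higher_deriv_diff[OF \<psi> _ open_ball 0]) (intro holomorphic_intros \<l>)
    then show ?thesis using higher_deriv_cmult[OF \<l> 0 open_ball] by simp
  qed
  \<comment> \<open>Nothing is assumed about \<open>\<l>\<close> being real on the real axis; its
    derivatives at \<open>0\<close> are real as limits of the real quotients
    \<open>g n / real n\<close>.\<close>
  have real_slope: "\<exists>x y. (deriv ^^ k) \<l> 0 = of_real x \<and> (\<lambda>n. g n - (x * real n + y)) \<longlonglongrightarrow> 0 \<and> (\<lambda>n. g n / real n) \<longlonglongrightarrow> x"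
    if g: "\<And>n. M \<le> n \<Longrightarrow> (deriv ^^ k) (\<psi> n) 0 = complex_of_real (g n)" for k g
  proof -
    let ?d = "(deriv ^^ k) \<l> 0"
    have "(\<lambda>n. (deriv ^^ k) (\<epsilon> n) 0) \<longlonglongrightarrow> (deriv ^^ k) \<kappa> 0"
      by (rule higher_deriv_complex_uniform_limit[OF \<epsilon>_lim]) (use \<epsilon>_hol 0 in auto)
    then have l1: "(\<lambda>n. complex_of_real (g n) - of_nat n * ?d) \<longlonglongrightarrow> (deriv ^^ k) \<kappa> 0"
      by (rule Lim_transform_eventually) (auto intro!: eventually_sequentiallyI[of M] simp: d\<epsilon> g)
    have "(\<lambda>n. (complex_of_real (g n) - of_nat n * ?d) * of_real (1 / real n) + ?d) \<longlonglongrightarrow> (deriv ^^ k) \<kappa> 0 * of_real 0 + ?d"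
      by (intro tendsto_intros l1 lim_1_over_n)
    moreover have "eventually (\<lambda>n. (complex_of_real (g n) - of_nat n * ?d) * of_real (1 / real n) + ?d = complex_of_real (g n / real n)) sequentially"
      by (intro eventually_sequentiallyI[of 1]) (simp add: field_simps)
    ultimately have "(\<lambda>n. complex_of_real (g n / real n)) \<longlonglongrightarrow> (deriv ^^ k) \<kappa> 0 * of_real 0 + ?d"
      by (rule Lim_transform_eventually)
    then have l2: "(\<lambda>n. complex_of_real (g n / real n)) \<longlonglongrightarrow> ?d" by simp
    then have im: "Im ?d = 0" using tendsto_Im[OF l2] by (simp add: LIMSEQ_const_iff)
    then have re: "?d = of_real (Re ?d)" by (simp add: complex_eq_iff)
    have "(\<lambda>n. g n - real n * Re ?d) \<longlonglongrightarrow> Re ((deriv ^^ k) \<kappa> 0)" using tendsto_Re[OF l1] im by simp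
    then have "(\<lambda>n. g n - real n * Re ?d - Re ((deriv ^^ k) \<kappa> 0)) \<longlonglongrightarrow> 0" by (simp add: LIM_zero_iff)
    moreover have "(\<lambda>n. g n / real n) \<longlonglongrightarrow> Re ?d" using tendsto_Re[OF l2] by simp
    ultimately show ?thesis using re
      by (intro exI[of _ "Re ?d"] exI[of _ "Re ((deriv ^^ k) \<kappa> 0)"]) (simp add: algebra_simps)
  qed
  have cum: "deriv (\<psi> n) 0 = of_real (E n)" "(deriv ^^ 2) (\<psi> n) 0 = of_real (V n)" if "M \<le> n" for n
    unfolding E_def V_def using cumulants_of_uniform[OF _ _ \<delta> \<psi> mgf[OF that]] A[OF that] by auto
  obtain \<mu> \<mu>' where \<mu>: "deriv \<l> 0 = of_real \<mu>" "(\<lambda>n. E n - (\<mu> * real n + \<mu>')) \<longlonglongrightarrow> 0" "(\<lambda>n. E n / real n) \<longlonglongrightarrow> \<mu>"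
    using real_slope[of 1 E] cum(1) by auto
  obtain v v' where v: "(deriv ^^ 2) \<l> 0 = of_real v" "(\<lambda>n. V n - (v * real n + v')) \<longlonglongrightarrow> 0" "(\<lambda>n. V n / real n) \<longlonglongrightarrow> v"
    using real_slope[of 2 V] cum(2) by auto
  have "0 \<le> E n" for n unfolding E_def by (intro integral_nonneg_AE) auto
  then have \<mu>0: "0 \<le> \<mu>" by (intro LIMSEQ_le_const[OF \<mu>(3)]) auto
  \<comment> \<open>Filling the removable singularity makes the second-order expansion of
    \<open>\<l>\<close> an exact identity with continuous coefficient, so no remainder term has to
    be carried along \<open>s n\<close>.\<close>
  define R where "R s = (if s = 0 then of_real v / 2 else (\<l> s - \<l> 0 - deriv \<l> 0 * s) / s\<^sup>2)" for s
  have "((\<lambda>s. (\<l> s - \<l> 0 - deriv \<l> 0 * s) / s\<^sup>2) \<longlongrightarrow> R 0) (at 0)"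
    using holomorphic_second_order_quotient[OF \<l> \<delta>] by (simp add: R_def v)
  then have "(R \<longlongrightarrow> R 0) (at 0)"
    by (rule Lim_transform_eventually) (auto simp: R_def eventually_at_filter)
  then have R: "isCont R 0" by (simp add: isCont_def)
  have R_eq: "\<l> s - \<l> 0 - deriv \<l> 0 * s = R s * s\<^sup>2" for s by (simp add: R_def)
  have weak: "weak_conv_m (\<lambda>n. distr (measure_pmf (pmf_of_set (A n))) borel (\<lambda>a. (real (X a) - E n) / sqrt (V n)))
         std_normal_distribution" if v0: "0 < v"
  proof (rule levy_continuity)
    show "real_distribution (distr (measure_pmf (pmf_of_set (A n))) borel (\<lambda>a. (real (X a) - E n) / sqrt (V n)))" for n
      by (rule prob_space.real_distribution_distr[OF measure_pmf.prob_space_axioms]) simp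
    show "real_distribution std_normal_distribution" by (rule real_dist_normal_dist)
    fix t :: real
    define \<sigma> where "\<sigma> n = sqrt (V n)" for n
    define s where "s n = \<i> * complex_of_real t / complex_of_real (\<sigma> n)" for n
    have "filterlim (\<lambda>n. V n / real n * real n) at_top sequentially"
      by (rule filterlim_tendsto_pos_mult_at_top[OF v(3) v0 filterlim_real_sequentially])
    moreover have "eventually (\<lambda>n. V n / real n * real n = V n) sequentially"
      by (intro eventually_sequentiallyI[of 1]) simp
    ultimately have Vtop: "filterlim V at_top sequentially" by (rule filterlim_cong[OF refl refl, THEN iffD1, rotated])
    then have \<sigma>top: "filterlim \<sigma> at_top sequentially"
      unfolding \<sigma>_def by (rule filterlim_compose[OF sqrt_at_top])
    have "(\<lambda>n. t / \<sigma> n) \<longlonglongrightarrow> 0" by (rule real_tendsto_divide_at_top[OF tendsto_const \<sigma>top])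
    then have "(\<lambda>n. \<i> * complex_of_real (t / \<sigma> n)) \<longlonglongrightarrow> \<i> * complex_of_real 0" by (intro tendsto_intros)
    then have s0: "s \<longlonglongrightarrow> 0" by (simp add: s_def[abs_def])
    have ev_ball: "eventually (\<lambda>n. s n \<in> ball 0 \<delta>) sequentially"
      using order_tendstoD(2)[OF tendsto_norm[OF s0], of \<delta>] \<delta> by simp
    have ev_V: "eventually (\<lambda>n. 0 < V n) sequentially" using Vtop unfolding filterlim_at_top_dense by blast
    have evM: "eventually (\<lambda>n. M \<le> n) sequentially" by (rule eventually_ge_at_top)
    have \<kappa>_cont: "isCont \<kappa> 0"
    proof -
      have "continuous_on (ball 0 \<delta>) \<kappa>"
        by (rule uniform_limit_theorem[OF always_eventually \<epsilon>_lim]) (simp_all add: holomorphic_on_imp_continuous_on \<epsilon>_hol)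
      then show ?thesis using 0 by (simp add: continuous_on_eq_continuous_at)
    qed
    have \<epsilon>_conv: "(\<lambda>n. \<epsilon> n (z n)) \<longlonglongrightarrow> \<kappa> 0" if z: "z \<longlonglongrightarrow> 0" for z
    proof -
      have evz: "eventually (\<lambda>n. z n \<in> ball 0 \<delta>) sequentially" using order_tendstoD(2)[OF tendsto_norm[OF z], of \<delta>] \<delta> by simp
      have "(\<lambda>n. \<epsilon> n (z n) - \<kappa> (z n)) \<longlonglongrightarrow> 0"
      proof (rule tendstoI)
        fix r :: real assume "0 < r"
        then have "eventually (\<lambda>n. \<forall>w\<in>ball 0 \<delta>. dist (\<epsilon> n w) (\<kappa> w) < r) sequentially"
          using \<epsilon>_lim unfolding uniform_limit_iff by blast
        then show "eventually (\<lambda>n. dist (\<epsilon> n (z n) - \<kappa> (z n)) 0 < r) sequentially"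
          using evz
        proof eventually_elim
          case (elim n)
          then have "dist (\<epsilon> n (z n)) (\<kappa> (z n)) < r" by blast
          then show ?case by (simp add: dist_norm)
        qed
      qed
      moreover have "(\<lambda>n. \<kappa> (z n)) \<longlonglongrightarrow> \<kappa> 0" using isCont_tendsto_compose[OF \<kappa>_cont z] .
      ultimately have "(\<lambda>n. (\<epsilon> n (z n) - \<kappa> (z n)) + \<kappa> (z n)) \<longlonglongrightarrow> 0 + \<kappa> 0" by (rule tendsto_add)
      then show ?thesis by simp
    qed
    have part1: "(\<lambda>n. \<epsilon> n (s n) - \<epsilon> n 0) \<longlonglongrightarrow> \<kappa> 0 - \<kappa> 0"
      by (intro tendsto_diff \<epsilon>_conv s0 tendsto_const)
    have "(\<lambda>n. 1 / (V n / real n)) \<longlonglongrightarrow> 1 / v" by (rule tendsto_divide[OF tendsto_const v(3)]) (use v0 in simp)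
    then have "(\<lambda>n. complex_of_real (- t\<^sup>2 * (1 / (V n / real n)))) \<longlonglongrightarrow> complex_of_real (- t\<^sup>2 * (1 / v))"
      by (intro tendsto_of_real tendsto_mult tendsto_const)
    moreover have "eventually (\<lambda>n. complex_of_real (- t\<^sup>2 * (1 / (V n / real n))) = of_nat n * (s n)\<^sup>2) sequentially"
      using ev_V
    proof eventually_elim
      case (elim n)
      have "(s n)\<^sup>2 = - complex_of_real (t\<^sup>2 / V n)"
        using elim by (simp add: s_def \<sigma>_def power_mult_distrib power_divide flip: of_real_power)
      then show ?case by simp
    qed
    ultimately have ns2: "(\<lambda>n. of_nat n * (s n)\<^sup>2) \<longlonglongrightarrow> complex_of_real (- t\<^sup>2 / v)"
      by (auto dest: Lim_transform_eventually)
    have part2: "(\<lambda>n. R (s n) * (of_nat n * (s n)\<^sup>2)) \<longlonglongrightarrow> R 0 * complex_of_real (- t\<^sup>2 / v)"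
      by (intro tendsto_mult ns2 isCont_tendsto_compose[OF R s0])
    \<comment> \<open>The mean differs from \<open>\<mu> * real n\<close> by a bounded amount, and
      \<open>s n\<close> tends to \<open>0\<close>, so centring at the exact mean instead of at
      \<open>\<mu> * real n\<close> makes no difference.\<close>
    have part3: "(\<lambda>n. s n * complex_of_real (E n - (\<mu> * real n + \<mu>') + \<mu>')) \<longlonglongrightarrow> 0 * complex_of_real (0 + \<mu>')"
      by (intro tendsto_intros s0 \<mu>(2))
    \<comment> \<open>For large \<open>n\<close> this is a logarithm of the characteristic function
      at \<open>t\<close>, split into the error of the quasi-power, the Gaussian part and the
      centring error. In the middle term \<open>R (s n)\<close> tends to \<open>v / 2\<close> and
      \<open>of_nat n * (s n)\<^sup>2\<close> to \<open>- t\<^sup>2 / v\<close>.\<close>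
    define W where "W n = (\<epsilon> n (s n) - \<epsilon> n 0) + R (s n) * (of_nat n * (s n)\<^sup>2)
      - s n * complex_of_real (E n - (\<mu> * real n + \<mu>') + \<mu>')" for n
    have "W \<longlonglongrightarrow> (\<kappa> 0 - \<kappa> 0) + R 0 * complex_of_real (- t\<^sup>2 / v) - 0 * complex_of_real (0 + \<mu>')"
      unfolding W_def[abs_def] by (rule tendsto_diff[OF tendsto_add[OF part1 part2] part3])
    moreover have "(\<kappa> 0 - \<kappa> 0) + R 0 * complex_of_real (- t\<^sup>2 / v) - 0 * complex_of_real (0 + \<mu>') = complex_of_real (- t\<^sup>2 / 2)"
      using v0 by (simp add: R_def)
    ultimately have "W \<longlonglongrightarrow> complex_of_real (- t\<^sup>2 / 2)" by (rule tendsto_eq_rhs)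
    then have "(\<lambda>n. exp (W n)) \<longlonglongrightarrow> exp (complex_of_real (- t\<^sup>2 / 2))" by (rule tendsto_exp)
    then show "(\<lambda>n. char (distr (measure_pmf (pmf_of_set (A n))) borel (\<lambda>a. (real (X a) - E n) / sqrt (V n))) t)
       \<longlonglongrightarrow> char std_normal_distribution t"
      unfolding char_std_normal_distribution exp_of_real
    proof (rule Lim_transform_eventually)
      show "eventually (\<lambda>n. exp (W n)
        = char (distr (measure_pmf (pmf_of_set (A n))) borel (\<lambda>a. (real (X a) - E n) / sqrt (V n))) t) sequentially"
        using ev_ball evM
      proof eventually_elim
        case (elim n)
        have card: "complex_of_nat (card (A n)) = exp (\<psi> n 0)" using mgf[OF elim(2) 0] by simp
        have "char (distr (measure_pmf (pmf_of_set (A n))) borel (\<lambda>a. (real (X a) - E n) / sqrt (V n))) t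
          = exp (- s n * E n) * exp (\<psi> n (s n)) / exp (\<psi> n 0)"
          using char_standardized_uniform[OF conjunct1[OF A[OF elim(2)]] conjunct2[OF A[OF elim(2)]], of X "E n" "\<sigma> n" t] mgf[OF elim(2,1)]
          by (simp only: s_def \<sigma>_def card times_divide_eq_right)
        also have "\<dots> = exp (\<psi> n (s n) - \<psi> n 0 - s n * E n)" by (simp add: exp_diff exp_minus divide_inverse mult_ac)
        also have "\<psi> n (s n) - \<psi> n 0 - s n * E n = (\<epsilon> n (s n) - \<epsilon> n 0) + of_nat n * (\<l> (s n) - \<l> 0 - deriv \<l> 0 * s n)
            - s n * complex_of_real (E n - (\<mu> * real n + \<mu>') + \<mu>')"
          by (simp add: \<epsilon>_def \<mu>(1) algebra_simps)
        finally show ?case unfolding R_eq W_def by (simp add: mult_ac)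
      qed
    qed
  qed
  show ?thesis
  proof (rule that)
   show "deriv \<l> 0 = of_real \<mu>" by (rule \<mu>(1))
   show "(deriv ^^ 2) \<l> 0 = of_real v" by (rule v(1))
   show "0 \<le> \<mu>" by (rule \<mu>0)
   show "(\<lambda>n. E n - (\<mu> * real n + \<mu>')) \<longlonglongrightarrow> 0" by (rule \<mu>(2))
   show "(\<lambda>n. V n - (v * real n + v')) \<longlonglongrightarrow> 0" by (rule v(2))
   show "0 < v \<longrightarrow> weak_conv_m (\<lambda>n. distr (measure_pmf (pmf_of_set (A n))) borel (\<lambda>a. (real (X a) - E n) / sqrt (V n)))
         std_normal_distribution" using weak by (rule impI)
  qed
qed

subsection \<open>Positivity of the slopes\<close>

text \<open>At \<open>t = 0\<close> the equation says that \<open>p b l\<close> is a probability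
  distribution on pairs; in general it says that \<open>exp (u t b l)\<close> has expectation
  \<open>1\<close>. As \<open>exp u - 1 - u\<close> is non-negative, the expectation of
  \<open>- u\<close>, which is \<open>\<Delta> t\<close>, dominates the contribution of any single
  pair. Comparing orders in \<open>t\<close> gives the two slopes without differentiating an
  infinite sum.\<close>

lemma renewal_slopes_positive:
  fixes I :: "'b set" and \<sigma> :: "'b \<Rightarrow> nat" and X :: "'b \<Rightarrow> nat \<Rightarrow> nat" and h :: "real \<Rightarrow> real" and x\<^sub>0 \<mu> v :: real
  assumes I: "finite I" and x0: "0 < x\<^sub>0" "x\<^sub>0 < 1" and C: "\<And>b l. b \<in> I \<Longrightarrow> X b l \<le> C" and h0: "h 0 = 0"
    and eq: "eventually (\<lambda>t::real. (\<lambda>l. \<Sum>b\<in>I. exp (t * real (X b l)) * (x\<^sub>0 * exp (- h t))^(\<sigma> b + l)) sums 1) (nhds 0)"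
    and \<mu>: "((\<lambda>t. h t / t) \<longlongrightarrow> \<mu>) (at 0)"
    and v: "((\<lambda>t. (h t - \<mu> * t) / t\<^sup>2) \<longlongrightarrow> v / 2) (at 0)"
    and b\<^sub>0: "b\<^sub>0 \<in> I"
  shows "0 < X b\<^sub>0 l\<^sub>0 \<Longrightarrow> 0 < \<mu>"
    and "real (X b\<^sub>0 l\<^sub>0) \<noteq> \<mu> * real (\<sigma> b\<^sub>0 + l\<^sub>0) \<Longrightarrow> 0 < v"
proof -
  define p where "p b l = x\<^sub>0^(\<sigma> b + l)" for b l
  define u where "u t b l = t * real (X b l) - real (\<sigma> b + l) * h t" for t b l
  have p0: "0 < p b l" for b l using x0 by (simp add: p_def)
  have pu: "exp (t * real (X b l)) * (x\<^sub>0 * exp (- h t))^(\<sigma> b + l) = p b l * exp (u t b l)" for t b l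
  proof -
    have "exp (u t b l) = exp (t * real (X b l)) * exp (real (\<sigma> b + l) * - h t)"
      unfolding u_def by (simp flip: exp_add)
    also have "exp (real (\<sigma> b + l) * - h t) = exp (- h t)^(\<sigma> b + l)" by (rule exp_of_nat_mult)
    finally show ?thesis by (simp only: p_def power_mult_distrib mult_ac)
  qed
  have "(\<lambda>l. \<Sum>b\<in>I. exp (0 * real (X b l)) * (x\<^sub>0 * exp (- h 0))^(\<sigma> b + l)) sums 1"
    using eventually_nhds_x_imp_x[OF eq] .
  then have p1: "(\<lambda>l. \<Sum>b\<in>I. p b l) sums 1" by (simp add: p_def h0)
  have "summable (\<lambda>l. real (\<sigma> b + l) * p b l)" for b
  proof -
    have "(\<lambda>n. real (Suc n) * x\<^sub>0^n) sums (1 / (1 - x\<^sub>0)\<^sup>2)" using geometric_deriv_sums[of x\<^sub>0] x0 by simp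
    then have "summable (\<lambda>n. real (Suc n) * x\<^sub>0^n)" by (rule sums_summable)
    then have "summable (\<lambda>n. real n * x\<^sub>0^n)"
      by (rule summable_comparison_test'[of _ 0]) (use x0 in \<open>auto intro!: mult_right_mono\<close>)
    then show ?thesis
      using summable_iff_shift[of "\<lambda>n. real n * x\<^sub>0^n" "\<sigma> b"] by (simp add: p_def add.commute)
  qed
  then have s\<tau>: "summable (\<lambda>l. \<Sum>b\<in>I. real (\<sigma> b + l) * p b l)" by (rule summable_sum)
  have sX: "summable (\<lambda>l. \<Sum>b\<in>I. real (X b l) * p b l)"
  proof (rule summable_comparison_test'[of "\<lambda>l. real C * (\<Sum>b\<in>I. p b l)" 0])
    show "summable (\<lambda>l. real C * (\<Sum>b\<in>I. p b l))" by (intro summable_mult sums_summable[OF p1])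
    show "norm (\<Sum>b\<in>I. real (X b n) * p b n) \<le> real C * (\<Sum>b\<in>I. p b n)" for n
      using p0 C unfolding sum_distrib_left real_norm_def
      by (subst abs_of_nonneg) (auto intro!: sum_mono sum_nonneg mult_right_mono mult_nonneg_nonneg less_imp_le[OF p0])
  qed
  define T where "T = (\<Sum>l. \<Sum>b\<in>I. real (\<sigma> b + l) * p b l)"
  define m where "m = (\<Sum>l. \<Sum>b\<in>I. real (X b l) * p b l)"
  have term_le: "f b\<^sub>0 l \<le> (\<Sum>l. \<Sum>b\<in>I. f b l)"
    if "summable (\<lambda>l. \<Sum>b\<in>I. f b l)" "\<And>b l. b \<in> I \<Longrightarrow> 0 \<le> f b l" for f :: "'b \<Rightarrow> nat \<Rightarrow> real" and l
  proof -
    have "f b\<^sub>0 l \<le> (\<Sum>b\<in>I. f b l)" using that I b\<^sub>0 by (intro member_le_sum) auto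
    also have "\<dots> \<le> (\<Sum>l. \<Sum>b\<in>I. f b l)" using sum_le_suminf[OF that(1), of "{l}"] that(2) by (auto intro: sum_nonneg)
    finally show ?thesis .
  qed
  have T: "0 < T"
  proof -
    \<comment> \<open>Evaluated at \<open>l = 1\<close>, since \<open>\<sigma> b\<^sub>0\<close> may
      be \<open>0\<close>.\<close>
    have "0 < real (\<sigma> b\<^sub>0 + 1) * p b\<^sub>0 1" using p0 by simp
    also have "\<dots> \<le> T" unfolding T_def by (rule term_le[where f = "\<lambda>b l. real (\<sigma> b + l) * p b l", OF s\<tau>]) (simp add: less_imp_le[OF p0])
    finally show ?thesis .
  qed
  have m: "real (X b\<^sub>0 l\<^sub>0) * p b\<^sub>0 l\<^sub>0 \<le> m"
    unfolding m_def by (rule term_le[where f = "\<lambda>b l. real (X b l) * p b l", OF sX]) (simp add: less_imp_le[OF p0])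
  define \<Delta> where "\<Delta> t = T * h t - t * m" for t
  have key: "eventually (\<lambda>t. p b\<^sub>0 l\<^sub>0 * (exp (u t b\<^sub>0 l\<^sub>0) - 1 - u t b\<^sub>0 l\<^sub>0) \<le> \<Delta> t) (nhds 0)"
    using eq
  proof eventually_elim
    case (elim t)
    have "(\<lambda>l. (\<Sum>b\<in>I. p b l * exp (u t b l)) - (\<Sum>b\<in>I. p b l) - (t * (\<Sum>b\<in>I. real (X b l) * p b l) - h t * (\<Sum>b\<in>I. real (\<sigma> b + l) * p b l)))
       sums (1 - 1 - (t * m - h t * T))"
      unfolding m_def T_def using elim[unfolded pu] p1 sX s\<tau> by (intro sums_diff sums_mult; simp add: summable_sums)
    moreover have "(\<Sum>b\<in>I. p b l * exp (u t b l)) - (\<Sum>b\<in>I. p b l) - (t * (\<Sum>b\<in>I. real (X b l) * p b l) - h t * (\<Sum>b\<in>I. real (\<sigma> b + l) * p b l))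
      = (\<Sum>b\<in>I. p b l * (exp (u t b l) - 1 - u t b l))" for l
      unfolding sum_distrib_left sum_subtractf[symmetric] by (intro sum.cong) (auto simp: u_def algebra_simps)
    ultimately have s: "(\<lambda>l. \<Sum>b\<in>I. p b l * (exp (u t b l) - 1 - u t b l)) sums \<Delta> t" by (simp add: \<Delta>_def mult_ac)
    have "p b\<^sub>0 l\<^sub>0 * (exp (u t b\<^sub>0 l\<^sub>0) - 1 - u t b\<^sub>0 l\<^sub>0) \<le> (\<Sum>l. \<Sum>b\<in>I. p b l * (exp (u t b l) - 1 - u t b l))"
    proof (rule term_le[where f = "\<lambda>b l. p b l * (exp (u t b l) - 1 - u t b l)"])
      show "0 \<le> p b l * (exp (u t b l) - 1 - u t b l)" for b l
        using p0[of b l] exp_ge_add_one_self[of "u t b l"] by (intro mult_nonneg_nonneg) (auto simp: algebra_simps)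
    qed (use s in \<open>rule sums_summable\<close>)
    then show ?case using sums_unique[OF s] by simp
  qed
  have \<Delta>0: "eventually (\<lambda>t. 0 \<le> \<Delta> t) (nhds 0)"
    using key
  proof eventually_elim
    case (elim t)
    have "0 \<le> p b\<^sub>0 l\<^sub>0 * (exp (u t b\<^sub>0 l\<^sub>0) - 1 - u t b\<^sub>0 l\<^sub>0)"
      using p0[of b\<^sub>0 l\<^sub>0] exp_ge_add_one_self[of "u t b\<^sub>0 l\<^sub>0"] by (intro mult_nonneg_nonneg) (auto simp: algebra_simps)
    then show ?case using elim by simp
  qed
  have sides: "at_right (0::real) \<le> at 0" "at_left (0::real) \<le> at 0" by (auto simp: at_le)
  have at_nhds: "at_right (0::real) \<le> nhds 0" "at_left (0::real) \<le> nhds 0" by (auto simp: at_within_def)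
  have "((\<lambda>t. T * (h t / t) - m) \<longlongrightarrow> T * \<mu> - m) (at 0)" by (intro tendsto_intros \<mu>)
  moreover have "eventually (\<lambda>t. T * (h t / t) - m = \<Delta> t / t) (at 0)"
    by (auto simp: eventually_at_filter \<Delta>_def field_simps)
  ultimately have \<Delta>1: "((\<lambda>t. \<Delta> t / t) \<longlongrightarrow> T * \<mu> - m) (at 0)" by (rule Lim_transform_eventually)
  \<comment> \<open>\<open>\<Delta>\<close> is non-negative on both sides of \<open>0\<close>, so
    \<open>\<Delta> t / t\<close> changes sign there and its limit vanishes: \<open>\<mu>\<close> is
    the quotient of the means \<open>m\<close> and \<open>T\<close>.\<close>
  have "0 \<le> T * \<mu> - m"
    by (rule tendsto_lowerbound[OF tendsto_mono[OF sides(1) \<Delta>1]])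
      (use eventually_at_right_less[of "0::real"] filter_leD[OF at_nhds(1) \<Delta>0] in \<open>auto elim: eventually_elim2\<close>)
  moreover have "T * \<mu> - m \<le> 0"
  proof (rule tendsto_upperbound[OF tendsto_mono[OF sides(2) \<Delta>1]])
    have "eventually (\<lambda>t::real. t < 0) (at_left 0)" by (simp add: eventually_at_filter)
    then show "eventually (\<lambda>t. \<Delta> t / t \<le> 0) (at_left 0)"
      using filter_leD[OF at_nhds(2) \<Delta>0] by eventually_elim (simp add: divide_nonneg_neg)
  qed simp
  ultimately have T\<mu>: "T * \<mu> = m" by simp
  show "0 < \<mu>" if "0 < X b\<^sub>0 l\<^sub>0"
  proof -
    have "0 < real (X b\<^sub>0 l\<^sub>0) * p b\<^sub>0 l\<^sub>0" using that p0 by simp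
    then have "0 < T * \<mu>" using m T\<mu> by simp
    then show ?thesis using T by (simp add: zero_less_mult_iff)
  qed
  define \<alpha> where "\<alpha> = real (X b\<^sub>0 l\<^sub>0) - \<mu> * real (\<sigma> b\<^sub>0 + l\<^sub>0)"
  have "((\<lambda>t. real (X b\<^sub>0 l\<^sub>0) - real (\<sigma> b\<^sub>0 + l\<^sub>0) * (h t / t)) \<longlongrightarrow> real (X b\<^sub>0 l\<^sub>0) - real (\<sigma> b\<^sub>0 + l\<^sub>0) * \<mu>) (at 0)"
    by (intro tendsto_intros \<mu>)
  moreover have "eventually (\<lambda>t. real (X b\<^sub>0 l\<^sub>0) - real (\<sigma> b\<^sub>0 + l\<^sub>0) * (h t / t) = u t b\<^sub>0 l\<^sub>0 / t) (at 0)"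
    by (auto simp: eventually_at_filter u_def field_simps)
  ultimately have u1: "((\<lambda>t. u t b\<^sub>0 l\<^sub>0 / t) \<longlongrightarrow> \<alpha>) (at 0)"
    unfolding \<alpha>_def mult.commute[of \<mu>] by (rule Lim_transform_eventually)
  have "((\<lambda>t. T * ((h t - \<mu> * t) / t\<^sup>2)) \<longlongrightarrow> T * (v / 2)) (at 0)" by (intro tendsto_intros v)
  moreover have "eventually (\<lambda>t. T * ((h t - \<mu> * t) / t\<^sup>2) = \<Delta> t / t\<^sup>2) (at 0)"
    using T\<mu> by (auto simp: eventually_at_filter \<Delta>_def algebra_simps intro!: always_eventually)
  ultimately have \<Delta>2: "((\<lambda>t. \<Delta> t / t\<^sup>2) \<longlongrightarrow> T * (v / 2)) (at 0)" by (rule Lim_transform_eventually)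
  \<comment> \<open>The quadratic lower bound for \<open>exp\<close> holds for non-negative
    arguments only. Therefore \<open>t\<close> approaches \<open>0\<close> from the side on which
    \<open>u\<close> is positive, and that side depends on the sign of
    \<open>\<alpha>\<close>.\<close>
  have final: "0 < v" if F: "F \<le> at (0::real)" "F \<noteq> bot" and pos: "eventually (\<lambda>t. 0 < u t b\<^sub>0 l\<^sub>0) F" and "\<alpha> \<noteq> 0" for F
  proof -
    have Fn: "F \<le> nhds 0" using F(1) by (meson at_within_le_nhds order.trans)
    have "eventually (\<lambda>t. p b\<^sub>0 l\<^sub>0 * (u t b\<^sub>0 l\<^sub>0 / t)\<^sup>2 / 2 \<le> \<Delta> t / t\<^sup>2) F"
      using pos filter_leD[OF Fn key]
    proof eventually_elim
      case (elim t)
      have "(u t b\<^sub>0 l\<^sub>0)\<^sup>2 / 2 \<le> exp (u t b\<^sub>0 l\<^sub>0) - 1 - u t b\<^sub>0 l\<^sub>0"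
        using exp_lower_Taylor_quadratic[of "u t b\<^sub>0 l\<^sub>0"] elim by simp
      then have "p b\<^sub>0 l\<^sub>0 * ((u t b\<^sub>0 l\<^sub>0)\<^sup>2 / 2) \<le> \<Delta> t" using mult_left_mono[OF _ less_imp_le[OF p0], of "(u t b\<^sub>0 l\<^sub>0)\<^sup>2 / 2" _ b\<^sub>0 l\<^sub>0] elim(2) order.trans by blast
      then have "p b\<^sub>0 l\<^sub>0 * ((u t b\<^sub>0 l\<^sub>0)\<^sup>2 / 2) / t\<^sup>2 \<le> \<Delta> t / t\<^sup>2" by (rule divide_right_mono) simp
      then show ?case by (simp add: power_divide)
    qed
    then have "p b\<^sub>0 l\<^sub>0 * \<alpha>\<^sup>2 / 2 \<le> T * (v / 2)"
      by (rule tendsto_le[OF F(2) tendsto_mono[OF F(1) \<Delta>2], rotated])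
         (intro tendsto_intros tendsto_mono[OF F(1) u1]; simp)
    moreover have "0 < p b\<^sub>0 l\<^sub>0 * \<alpha>\<^sup>2 / 2" using p0 \<open>\<alpha> \<noteq> 0\<close> by simp
    ultimately have "0 < T * (v / 2)" by linarith
    then show ?thesis using T by (simp add: zero_less_mult_iff)
  qed
  show "0 < v" if "real (X b\<^sub>0 l\<^sub>0) \<noteq> \<mu> * real (\<sigma> b\<^sub>0 + l\<^sub>0)"
  proof -
    have "\<alpha> \<noteq> 0" using that by (simp add: \<alpha>_def)
    then consider "0 < \<alpha>" | "\<alpha> < 0" by linarith
    then show ?thesis
    proof cases
      case 1
      then have "eventually (\<lambda>t. 0 < u t b\<^sub>0 l\<^sub>0 / t) (at_right 0)" using tendsto_mono[OF sides(1) u1] by (intro order_tendstoD)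
      then have "eventually (\<lambda>t. 0 < u t b\<^sub>0 l\<^sub>0) (at_right 0)"
        using eventually_at_right_less[of "0::real"] by eventually_elim (simp add: zero_less_divide_iff)
      then show ?thesis using final[OF sides(1)] \<open>\<alpha> \<noteq> 0\<close> by simp
    next
      case 2
      have neg: "eventually (\<lambda>t::real. t < 0) (at_left 0)" by (simp add: eventually_at_filter)
      have "eventually (\<lambda>t. u t b\<^sub>0 l\<^sub>0 / t < 0) (at_left 0)" using 2 tendsto_mono[OF sides(2) u1] by (intro order_tendstoD)
      then have "eventually (\<lambda>t. 0 < u t b\<^sub>0 l\<^sub>0) (at_left 0)"
        using neg by eventually_elim (simp add: divide_less_0_iff)
      then show ?thesis using final[OF sides(2)] \<open>\<alpha> \<noteq> 0\<close> by simp
    qed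
  qed
qed

subsection \<open>Legal decompositions as words in blocks\<close>

definition block_digits :: "(nat \<Rightarrow> nat) \<Rightarrow> nat \<times> nat \<Rightarrow> nat list" where
  "block_digits c b = map c [1..<fst b] @ [snd b]"

text \<open>The pair \<open>(1, 0)\<close> would be a single digit \<open>0\<close>. It is left out
  and counted among the zeros behind the preceding block, so that blocks mark where non-zero pieces
  begin.\<close>

definition blocks :: "nat \<Rightarrow> (nat \<Rightarrow> nat) \<Rightarrow> (nat \<times> nat) set" where
  "blocks L c = {(s, a). s \<in> {1..L} \<and> a < c s \<and> (s = 1 \<longrightarrow> 0 < a)}"

definition legals :: "nat \<Rightarrow> (nat \<Rightarrow> nat) \<Rightarrow> nat \<Rightarrow> nat list set" where
  "legals L c n = {a. legal L c a \<and> length a = n}"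

text \<open>The possible continuations of a block: zeros, then nothing or a legal word. Peeling off
  one zero at a time mirrors the splitting of the integers below \<open>G (k + 2)\<close> at
  \<open>G (k + 1)\<close>.\<close>

primrec tails :: "nat \<Rightarrow> (nat \<Rightarrow> nat) \<Rightarrow> nat \<Rightarrow> nat list set" where
  "tails L c 0 = {[]}"
| "tails L c (Suc k) = (#) 0 ` tails L c k \<union> legals L c (Suc k)"

lemma finite_blocks: "finite (blocks L c)"
proof (rule finite_subset)
  show "blocks L c \<subseteq> (SIGMA s:{1..L}. {..<c s})" by (auto simp: blocks_def)
qed auto

lemma length_block_digits [simp]: "1 \<le> fst b \<Longrightarrow> length (block_digits c b) = fst b"
  by (simp add: block_digits_def)

lemma legals_length: "a \<in> legals L c n \<Longrightarrow> length a = n"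
  by (simp add: legals_def)

lemma tails_length: "t \<in> tails L c k \<Longrightarrow> length t = k"
  by (induction k arbitrary: t) (auto dest: legals_length)

lemma legal_nonempty: "legal L c a \<Longrightarrow> a \<noteq> [] \<and> 0 < a ! 0"
  by (induction rule: legal.induct) auto

lemma legals_0 [simp]: "legals L c 0 = {}"
  using legal_nonempty by (auto simp: legals_def)

lemma tails_iff:
  "t \<in> tails L c k \<longleftrightarrow> (\<exists>l t'. t = replicate l 0 @ t' \<and> length t = k \<and> (t' = [] \<or> legal L c t'))"
proof (induction k arbitrary: t)
  case 0
  then show ?case by (auto intro: exI[of _ 0])
next
  case (Suc k)
  show ?case
  proof
    assume "t \<in> tails L c (Suc k)"
    then consider u where "t = 0 # u" "u \<in> tails L c k" | "t \<in> legals L c (Suc k)" by auto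
    then show "\<exists>l t'. t = replicate l 0 @ t' \<and> length t = Suc k \<and> (t' = [] \<or> legal L c t')"
    proof cases
      case 1
      then obtain l t' where "u = replicate l 0 @ t'" "length u = k" "t' = [] \<or> legal L c t'" using Suc by blast
      then show ?thesis using 1 by (intro exI[of _ "Suc l"] exI[of _ t']) auto
    qed (auto simp: legals_def intro!: exI[of _ 0])
  next
    assume "\<exists>l t'. t = replicate l 0 @ t' \<and> length t = Suc k \<and> (t' = [] \<or> legal L c t')"
    then obtain l t' where *: "t = replicate l 0 @ t'" "length t = Suc k" "t' = [] \<or> legal L c t'" by blast
    show "t \<in> tails L c (Suc k)"
    proof (cases l)
      case 0 then show ?thesis using * by (auto simp: legals_def)
    next
      case (Suc l')
      then have "replicate l' 0 @ t' \<in> tails L c k" unfolding Suc.IH using * by auto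
      then show ?thesis using * Suc by auto
    qed
  qed
qed

text \<open>Positivity of the coefficients replaces the condition on the leading digit: a block with
  \<open>s > 1\<close> starts with \<open>c 1\<close>, and for \<open>s = 1\<close> the condition is
  built into \<open>blocks\<close>.\<close>

lemma legal_unfold:
  assumes c: "\<forall>i\<in>{1..L}. 0 < c i" and L: "1 \<le> L"
  shows "legal L c a \<longleftrightarrow>
    (\<exists>b\<in>blocks L c. \<exists>t. a = block_digits c b @ t \<and> t \<in> tails L c (length t)) \<or>
    (a = map c [1..<length a + 1] \<and> a \<noteq> [] \<and> length a < L)" (is "_ \<longleftrightarrow> ?B \<or> ?S")
proof
  assume "legal L c a"
  then show "?B \<or> ?S"
  proof cases
    case short
    have "a ! i = c (i + 1)" if "i < length a" for i using short(4)[rule_format, of "i + 1"] that by auto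
    then have "a = map c [1..<length a + 1]" by (intro nth_equalityI) (auto simp del: upt_Suc)
    then show ?thesis using short by blast
  next
    case (block s l)
    define b where "b = (s, a ! (s - 1))"
    have s: "1 \<le> s" "s \<le> length a" using block by auto
    have "take s a = block_digits c b"
    proof (rule nth_equalityI)
      show "length (take s a) = length (block_digits c b)" using s by (simp add: b_def)
      fix i assume "i < length (take s a)"
      then have i: "i < s" using s by simp
      show "take s a ! i = block_digits c b ! i"
      proof (cases "i = s - 1")
        case False
        then have "a ! i = c (i + 1)" using block(5)[rule_format, of "i+1"] i by auto
        moreover have "i < s - 1" using False i by simp
        ultimately show ?thesis using i s by (simp add: block_digits_def b_def nth_append)
      qed (use i s in \<open>simp add: block_digits_def b_def nth_append\<close>)
    qed
    moreover have "take l (drop s a) = replicate l 0"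
    proof (rule nth_equalityI)
      fix i assume "i < length (take l (drop s a))"
      then have i: "i < l" by simp
      have "a ! (s + i) = 0" using block(7)[rule_format, of "s + i + 1"] i by auto
      then show "take l (drop s a) ! i = replicate l 0 ! i" using i block(4) by simp
    qed (use block in simp)
    moreover have "a = take s a @ take l (drop s a) @ drop (s + l) a"
      by (metis append_take_drop_id drop_drop add.commute)
    ultimately have a: "a = block_digits c b @ (replicate l 0 @ drop (s + l) a)" by simp
    have "b \<in> blocks L c" using block by (auto simp: blocks_def b_def)
    moreover have "replicate l 0 @ drop (s + l) a \<in> tails L c (length (replicate l 0 @ drop (s + l) a))"
      unfolding tails_iff using block(8) by blast
    ultimately show ?thesis using a by blast
  qed
next
  assume "?B \<or> ?S"
  then show "legal L c a"
  proof
    assume ?S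
    then have e: "a = map c [1..<length a + 1]" "a \<noteq> []" "length a < L" by auto
    have nth: "a ! i = c (i + 1)" if "i < length a" for i
      using arg_cong[OF e(1), of "\<lambda>x. x ! i"] that by (simp del: upt_Suc)
    show ?thesis using e(2,3) c nth by (intro legal.short) auto
  next
    assume ?B
    then obtain b t where b: "b \<in> blocks L c" "a = block_digits c b @ t" "t \<in> tails L c (length t)" by blast
    then obtain l t' where t: "t = replicate l 0 @ t'" "t' = [] \<or> legal L c t'" unfolding tails_iff by blast
    obtain s d where sd: "b = (s, d)" by fastforce
    have s: "s \<in> {1..L}" "d < c s" "s = 1 \<Longrightarrow> 0 < d" using b(1) by (auto simp: blocks_def sd)
    define x where "x = map c [1..<s] @ [d]"
    have a: "a = x @ replicate l 0 @ t'" using b(2) t by (simp add: block_digits_def sd x_def)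
    have len: "length x = s" using s by (simp add: x_def)
    have low: "a ! i = c (i + 1)" if "i < s - 1" for i using that by (simp add: a x_def nth_append)
    have mid: "a ! (s - 1) = d" by (simp add: a x_def nth_append)
    show ?thesis
    proof (rule legal.block)
      show "a \<noteq> []" by (simp add: a x_def)
      show "0 < a ! 0"
      proof (cases "s = 1")
        case True then show ?thesis using mid s(3) by simp
      next
        case False then show ?thesis using low[of 0] c[rule_format, of 1] s(1) by auto
      qed
      show "s \<in> {1..L}" by (rule s)
      show "s + l \<le> length a" using len by (simp add: a)
      show "\<forall>i\<in>{1..<s}. a ! (i - 1) = c i" using low by auto
      show "a ! (s - 1) < c s" using mid s by simp
      show "\<forall>i\<in>{s + 1..s + l}. a ! (i - 1) = 0"
      proof
        fix i assume i: "i \<in> {s + 1..s + l}"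
        then have "a ! (i - 1) = (replicate l 0 @ t') ! (i - 1 - s)"
          unfolding a nth_append len by auto
        then show "a ! (i - 1) = 0" using i by (auto simp: nth_append)
      qed
      have "drop (s + l) a = t'" using len by (simp add: a)
      then show "drop (s + l) a = [] \<or> legal L c (drop (s + l) a)" using t by simp
    qed
  qed
qed

lemma legals_unfold:
  assumes c: "\<forall>i\<in>{1..L}. 0 < c i" and L: "1 \<le> L" and n: "1 \<le> n"
  shows "legals L c n = (\<lambda>(b, t). block_digits c b @ t) ` (SIGMA b:{b \<in> blocks L c. fst b \<le> n}. tails L c (n - fst b))
    \<union> (if n < L then {map c [1..<n+1]} else {})"
proof (intro equalityI subsetI)
  have s1: "1 \<le> fst b" if "b \<in> blocks L c" for b using that by (auto simp: blocks_def)
  fix a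
  {
    assume "a \<in> legals L c n"
    then have "legal L c a" "length a = n" by (auto simp: legals_def)
    then consider b t where "b \<in> blocks L c" "a = block_digits c b @ t" "t \<in> tails L c (length t)"
      | "a = map c [1..<n + 1]" "n < L" using iffD1[OF legal_unfold[OF c L, where a = a]] by (auto simp del: upt_Suc)
    then show "a \<in> (\<lambda>(b, t). block_digits c b @ t) ` (SIGMA b:{b \<in> blocks L c. fst b \<le> n}. tails L c (n - fst b))
      \<union> (if n < L then {map c [1..<n+1]} else {})"
    proof cases
      case 1
      then have *: "length t = n - fst b" "fst b \<le> n" using \<open>length a = n\<close> s1[of b] by auto
      then have "(b, t) \<in> (SIGMA b:{b \<in> blocks L c. fst b \<le> n}. tails L c (n - fst b))" using 1 by auto
      then have "(\<lambda>(b, t). block_digits c b @ t) (b, t) \<in> (\<lambda>(b, t). block_digits c b @ t) ` (SIGMA b:{b \<in> blocks L c. fst b \<le> n}. tails L c (n - fst b))"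
        by (rule imageI)
      then show ?thesis using 1(2) by simp
    qed auto
  }
  assume "a \<in> (\<lambda>(b, t). block_digits c b @ t) ` (SIGMA b:{b \<in> blocks L c. fst b \<le> n}. tails L c (n - fst b))
      \<union> (if n < L then {map c [1..<n+1]} else {})"
  then consider b t where "b \<in> blocks L c" "fst b \<le> n" "t \<in> tails L c (n - fst b)" "a = block_digits c b @ t"
    | "a = map c [1..<n+1]" "n < L" by (auto split: if_splits)
  then show "a \<in> legals L c n"
  proof cases
    case 1
    then have t: "length t = n - fst b" by (auto dest: tails_length)
    then have "t \<in> tails L c (length t)" using 1 by simp
    then have "legal L c a" using 1 iffD2[OF legal_unfold[OF c L, where a = a]] by blast
    then show ?thesis using 1 t s1[of b] by (simp add: legals_def)
  next
    case 2
    then have "length a = n" by simp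
    moreover have "legal L c a" using iffD2[OF legal_unfold[OF c L, where a = a]] 2 n \<open>length a = n\<close> by (auto simp del: upt_Suc)
    ultimately show ?thesis by (simp add: legals_def)
  qed
qed

section \<open>Values of legal words and the generalized Zeckendorf theorem\<close>

lemma decomp_value_Nil [simp]: "decomp_value G [] = 0"
  by (simp add: decomp_value_def)

lemma decomp_value_Cons: "decomp_value G (x # a) = x * G (length a + 1) + decomp_value G a"
proof -
  have "{1..length (x # a)} = insert 1 (Suc ` {1..length a})"
    by (auto simp: image_Suc_atLeastAtMost)
  then have "decomp_value G (x # a) = (\<Sum>i\<in>insert 1 (Suc ` {1..length a}). (x # a) ! (i - 1) * G (length (x # a) + 1 - i))"
    by (simp only: decomp_value_def)
  also have "\<dots> = x * G (length a + 1) + (\<Sum>i\<in>Suc ` {1..length a}. (x # a) ! (i - 1) * G (length (x # a) + 1 - i))"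
    by (subst sum.insert) auto
  also have "(\<Sum>i\<in>Suc ` {1..length a}. (x # a) ! (i - 1) * G (length (x # a) + 1 - i)) = decomp_value G a"
    unfolding decomp_value_def by (subst sum.reindex) (auto intro!: sum.cong simp: nth_Cons')
  finally show ?thesis .
qed

text \<open>Value of the digits \<open>c 1, ..., c (s - 1)\<close> at the top of a word of length
  \<open>n\<close>. These are the thresholds of the greedy algorithm.\<close>

definition partial_value :: "(nat \<Rightarrow> nat) \<Rightarrow> (nat \<Rightarrow> nat) \<Rightarrow> nat \<Rightarrow> nat \<Rightarrow> nat" where
  "partial_value c G n s = (\<Sum>i=1..<s. c i * G (n + 1 - i))"

lemma partial_value_Suc:
  "1 \<le> s \<Longrightarrow> partial_value c G n (Suc s) = partial_value c G n s + c s * G (n + 1 - s)"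
  by (simp add: partial_value_def)

lemma partial_value_mono: "s \<le> s' \<Longrightarrow> partial_value c G n s \<le> partial_value c G n s'"
  unfolding partial_value_def by (intro sum_mono2) auto

lemma decomp_value_map_append:
  "1 \<le> s \<Longrightarrow> decomp_value G (map c [1..<s] @ t) = partial_value c G (s - 1 + length t) s + decomp_value G t"
proof (induction s arbitrary: t rule: nat_induct_at_least)
  case base
  then show ?case by (simp add: partial_value_def)
next
  case (Suc s)
  have "decomp_value G (map c [1..<Suc s] @ t) = decomp_value G (map c [1..<s] @ (c s # t))"
    using Suc.hyps by simp
  also have "\<dots> = partial_value c G (s - 1 + length (c s # t)) s + (c s * G (length t + 1) + decomp_value G t)"
    by (simp only: Suc.IH decomp_value_Cons)
  also have "s - 1 + length (c s # t) = s + length t" using Suc.hyps by simp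
  finally show ?case using partial_value_Suc[OF Suc.hyps, of c G "s + length t"] by simp
qed

lemma decomp_value_block:
  assumes "1 \<le> fst b"
  shows "decomp_value G (block_digits c b @ t) =
    partial_value c G (fst b + length t) (fst b) + snd b * G (length t + 1) + decomp_value G t"
  using decomp_value_map_append[OF assms, of G c "snd b # t"] assms
  by (simp add: block_digits_def decomp_value_Cons)

text \<open>Left end of the interval of values taken by the words of length \<open>n\<close> that
  begin with block \<open>b\<close>; its length is \<open>G (n + 1 - fst b)\<close>, the number of
  values of the tail.\<close>

definition block_low :: "(nat \<Rightarrow> nat) \<Rightarrow> (nat \<Rightarrow> nat) \<Rightarrow> nat \<Rightarrow> nat \<times> nat \<Rightarrow> nat" where
  "block_low c G n b = partial_value c G n (fst b) + snd b * G (n + 1 - fst b)"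

context
  fixes L :: nat and c G :: "nat \<Rightarrow> nat"
  assumes plrs: "plrs L c G" and cpos: "\<forall>i\<in>{1..L}. 0 < c i"
begin

lemma plrs_order_pos: "1 \<le> L" and plrs_first: "G 1 = 1"
  using plrs by (auto simp: plrs_def)

text \<open>For \<open>n < L\<close> the \<open>+ 1\<close> of the initial conditions makes the
  truncated block the word of value \<open>G (n + 1) - 1\<close>, the largest in its range.\<close>

lemma partial_value_full:
  assumes "1 \<le> n"
  shows "L \<le> n \<Longrightarrow> partial_value c G n (L + 1) = G (n + 1)"
    and "n < L \<Longrightarrow> partial_value c G n (n + 1) + 1 = G (n + 1)"
proof -
  show "partial_value c G n (L + 1) = G (n + 1)" if "L \<le> n"
    using plrs that unfolding plrs_def partial_value_def by (simp add: atLeastLessThanSuc_atLeastAtMost)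
  show "partial_value c G n (n + 1) + 1 = G (n + 1)" if "n < L"
  proof -
    have "G (n + 1) = (\<Sum>i=1..(n+1)-1. c i * G (n + 1 - i)) + 1"
      using plrs that unfolding plrs_def by (metis Suc_eq_plus1 Suc_leI atLeastAtMost_iff le_add2)
    then show ?thesis by (simp add: partial_value_def atLeastLessThanSuc_atLeastAtMost)
  qed
qed

lemma partial_value_le_G:
  assumes "1 \<le> n" "s \<le> L" "s \<le> n" shows "partial_value c G n (s + 1) \<le> G (n + 1)"
proof (cases "L \<le> n")
  case True
  then show ?thesis using partial_value_full(1)[OF assms(1) True] partial_value_mono[of "s+1" "L+1" c G n] assms by simp
next
  case False
  then show ?thesis using partial_value_full(2)[OF assms(1)] partial_value_mono[of "s+1" "n+1" c G n] assms by simp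
qed

lemma G_le_partial_value:
  assumes "2 \<le> s" shows "G n \<le> partial_value c G n s"
proof -
  have "1 \<le> c 1" using cpos plrs_order_pos by (simp add: Suc_le_eq)
  then have "1 * G n \<le> c 1 * G n" by (rule mult_right_mono) simp
  then have "G n \<le> c 1 * G n" by simp
  also have "\<dots> = partial_value c G n 2" by (simp add: partial_value_def numeral_2_eq_2)
  finally show ?thesis using partial_value_mono[OF assms, of c G n] by simp
qed

lemma G_mono: assumes "1 \<le> m" "m \<le> n" shows "G m \<le> G n"
  using assms(2)
proof (induction n rule: dec_induct)
  case (step k)
  have "G k \<le> partial_value c G k 2" by (rule G_le_partial_value) simp
  also have "\<dots> \<le> G (k + 1)" using partial_value_le_G[of k 1] step assms plrs_order_pos by (simp add: numeral_2_eq_2)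
  finally show ?case using step by simp
qed simp

lemma G_pos: "1 \<le> n \<Longrightarrow> 0 < G n"
  using G_mono[of 1 n] plrs_first by simp

lemma blocks_fst: "b \<in> blocks L c \<Longrightarrow> 1 \<le> fst b \<and> fst b \<le> L"
  by (auto simp: blocks_def)

lemma block_high_le:
  assumes "b \<in> blocks L c"
  shows "block_low c G n b + G (n + 1 - fst b) \<le> partial_value c G n (fst b + 1)"
proof -
  have "snd b + 1 \<le> c (fst b)" using assms by (auto simp: blocks_def)
  then have "(snd b + 1) * G (n + 1 - fst b) \<le> c (fst b) * G (n + 1 - fst b)" by (rule mult_right_mono) simp
  then show ?thesis using partial_value_Suc[of "fst b" c G n] blocks_fst[OF assms] by (simp add: block_low_def)
qed

text \<open>The intervals of the blocks are disjoint and ordered like the pairs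
  \<open>(s, a)\<close> lexicographically.\<close>

lemma block_low_strict:
  assumes "b \<in> blocks L c" "b' \<in> blocks L c"
    and "fst b < fst b' \<or> fst b = fst b' \<and> snd b < snd b'"
  shows "block_low c G n b + G (n + 1 - fst b) \<le> block_low c G n b'"
  using assms(3)
proof
  assume "fst b < fst b'"
  then have "partial_value c G n (fst b + 1) \<le> partial_value c G n (fst b')" by (intro partial_value_mono) simp
  then show ?thesis using block_high_le[OF assms(1), of n] by (simp add: block_low_def)
next
  assume *: "fst b = fst b' \<and> snd b < snd b'"
  then have "(snd b + 1) * G (n + 1 - fst b) \<le> snd b' * G (n + 1 - fst b)" by (intro mult_right_mono) auto
  then show ?thesis using * by (simp add: block_low_def)
qed

lemma G_le_block_low:
  assumes "b \<in> blocks L c" shows "G n \<le> block_low c G n b"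
proof (cases "fst b = 1")
  case True
  then have "1 \<le> snd b" using assms by (auto simp: blocks_def)
  then have "1 * G n \<le> snd b * G n" by (rule mult_right_mono) simp
  then have "G n \<le> snd b * G (n + 1 - fst b)" using True by (simp only: mult_1 add_diff_cancel_right')
  then show ?thesis unfolding block_low_def by (rule trans_le_add2)
next
  case False
  then have "G n \<le> partial_value c G n (fst b)" using blocks_fst[OF assms] by (intro G_le_partial_value) simp
  then show ?thesis by (simp add: block_low_def)
qed

lemma unique_block:
  assumes b: "b \<in> blocks L c" "b' \<in> blocks L c"
    and "block_low c G n b + v = block_low c G n b' + v'" "v < G (n + 1 - fst b)" "v' < G (n + 1 - fst b')"
  shows "b = b' \<and> v = v'"
proof -
  consider "fst b < fst b' \<or> fst b = fst b' \<and> snd b < snd b'" | "fst b' < fst b \<or> fst b' = fst b \<and> snd b' < snd b" | "b = b'"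
    by (metis linorder_less_linear prod.expand)
  then show ?thesis
  proof cases
    case 1 then show ?thesis using block_low_strict[OF b 1, of n] assms by simp
  next
    case 2 then show ?thesis using block_low_strict[OF b(2,1) 2, of n] assms by simp
  qed (use assms in auto)
qed

text \<open>Greedy choice: \<open>s\<close> is the first threshold exceeded by none of the longer
  prefixes, that is, the least \<open>s\<close> with \<open>M\<close> below
  \<open>partial_value c G n (s + 1)\<close>, and the last digit is a quotient by
  \<open>G (n + 1 - s)\<close>. If no such \<open>s\<close> exists, \<open>M\<close> is the single
  value of the truncated block.\<close>

lemma exists_block:
  assumes n: "1 \<le> n" and M: "G n \<le> M" "M < G (n + 1)"
  shows "(\<exists>b\<in>blocks L c. fst b \<le> n \<and> (\<exists>v<G (n + 1 - fst b). M = block_low c G n b + v)) \<or>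
    (n < L \<and> M = partial_value c G n (n + 1))"
proof (cases "\<exists>s. 1 \<le> s \<and> s \<le> L \<and> s \<le> n \<and> M < partial_value c G n (s + 1)")
  case True
  define s where "s = (LEAST s. 1 \<le> s \<and> s \<le> L \<and> s \<le> n \<and> M < partial_value c G n (s + 1))"
  have s: "1 \<le> s" "s \<le> L" "s \<le> n" "M < partial_value c G n (s + 1)" using LeastI_ex[OF True] by (auto simp: s_def)
  have low: "partial_value c G n s \<le> M"
  proof (cases "s = 1")
    case False
    then have "\<not> M < partial_value c G n (s - 1 + 1)"
      using not_less_Least[of "s - 1" "\<lambda>s. 1 \<le> s \<and> s \<le> L \<and> s \<le> n \<and> M < partial_value c G n (s + 1)", folded s_def] s by auto
    then show ?thesis using s by simp
  qed (simp add: partial_value_def)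
  define g where "g = G (n + 1 - s)"
  have g: "0 < g" unfolding g_def using s by (intro G_pos) simp
  define a where "a = (M - partial_value c G n s) div g"
  define v where "v = (M - partial_value c G n s) mod g"
  have Mv: "M = partial_value c G n s + a * g + v" using low by (simp add: a_def v_def)
  have "v < g" using g by (simp add: v_def)
  have "M < partial_value c G n s + c s * g" using s partial_value_Suc[of s c G n] by (simp add: g_def)
  then have "a * g < c s * g" using Mv by linarith
  then have a: "a < c s" by simp
  have "0 < a" if "s = 1"
  proof (rule ccontr)
    assume "\<not> 0 < a"
    then show False using Mv \<open>v < g\<close> that M(1) by (simp add: g_def partial_value_def)
  qed
  then have "(s, a) \<in> blocks L c" using s a by (auto simp: blocks_def)
  moreover have "M = block_low c G n (s, a) + v" using Mv by (simp add: block_low_def g_def)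
  ultimately show ?thesis using s \<open>v < g\<close> by (auto simp: g_def intro!: bexI[of _ "(s, a)"])
next
  case False
  then have F: "partial_value c G n (s + 1) \<le> M" if "1 \<le> s" "s \<le> L" "s \<le> n" for s
    using that by (meson not_le)
  have "n < L" using F[of L] M partial_value_full(1)[OF n] plrs_order_pos by (cases "L \<le> n") auto
  moreover have "M = partial_value c G n (n + 1)"
    using F[of n] M partial_value_full(2)[OF n] n \<open>n < L\<close> by simp
  ultimately show ?thesis by blast
qed

lemma decomp_value_block_tail:
  assumes "b \<in> blocks L c" "fst b \<le> n" "t \<in> tails L c (n - fst b)"
  shows "decomp_value G (block_digits c b @ t) = block_low c G n b + decomp_value G t"
  using decomp_value_block[of b G c t] assms blocks_fst[OF assms(1)] tails_length[OF assms(3)]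
  by (simp add: block_low_def Suc_diff_le)

lemma decomp_value_short:
  "decomp_value G (map c [1..<n+1]) = partial_value c G n (n + 1)"
  using decomp_value_map_append[of "n+1" G c "[]"] by simp

text \<open>The bijection for legal words is a hypothesis so that the lemma can serve inside the
  induction that proves it.\<close>

lemma bij_betw_tails_if:
  assumes "\<And>m. 1 \<le> m \<Longrightarrow> m \<le> k \<Longrightarrow> bij_betw (decomp_value G) (legals L c m) {G m..<G (m + 1)}"
  shows "bij_betw (decomp_value G) (tails L c k) {0..<G (k + 1)}"
  using assms
proof (induction k)
  case 0
  then show ?case using plrs_first by (simp add: bij_betw_def)
next
  case (Suc k)
  have "bij_betw (decomp_value G \<circ> (#) 0) (tails L c k) {0..<G (k + 1)}"
    using Suc by (simp add: comp_def decomp_value_Cons)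
  then have "bij_betw (decomp_value G) ((#) 0 ` tails L c k) {0..<G (k + 1)}"
    by (simp add: bij_betw_comp_iff2 bij_betw_def inj_on_imageI image_comp)
  moreover have "bij_betw (decomp_value G) (legals L c (Suc k)) {G (k+1)..<G (k+2)}" using Suc.prems[of "Suc k"] by simp
  ultimately have "bij_betw (decomp_value G) (tails L c (Suc k)) ({0..<G (k + 1)} \<union> {G (k+1)..<G (k+2)})"
    unfolding tails.simps by (rule bij_betw_combine) auto
  moreover have "{0..<G (k + 1)} \<union> {G (k+1)..<G (k+2)} = {0..<G (k+2)}" using G_mono[of "k+1" "k+2"] by auto
  ultimately show ?case by simp
qed

text \<open>By strong induction on the length: the block intervals, with the value of the truncated
  block if \<open>n < L\<close>, tile the range, and inside each interval the tails are in bijection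
  with the offsets.\<close>

lemma bij_betw_legals:
  assumes "1 \<le> n" shows "bij_betw (decomp_value G) (legals L c n) {G n..<G (n + 1)}"
  using assms
proof (induction n rule: less_induct)
  case (less n)
  have tails: "bij_betw (decomp_value G) (tails L c k) {0..<G (k + 1)}" if "k < n" for k
    using less.IH that by (intro bij_betw_tails_if) auto
  note unfold = legals_unfold[OF cpos plrs_order_pos less.prems]
  have tail_lt: "decomp_value G t < G (n + 1 - fst b)" if "b \<in> blocks L c" "fst b \<le> n" "t \<in> tails L c (n - fst b)" for b t
    using bij_betwE[OF tails, of "n - fst b"] that blocks_fst[OF that(1)] less.prems by (auto simp: Suc_diff_le)
  have range: "block_low c G n b + v < partial_value c G n (fst b + 1)" if "b \<in> blocks L c" "v < G (n + 1 - fst b)" for b v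
    using block_high_le[OF that(1), of n] that by simp
  have inj: "inj_on (decomp_value G) (legals L c n)"
  proof (rule inj_onI)
    fix x y assume x: "x \<in> legals L c n" and y: "y \<in> legals L c n" and eq: "decomp_value G x = decomp_value G y"
    \<comment> \<open>The truncated word has a larger value than every word of the same length that
      begins with a complete block, which rules out the mixed cases.\<close>
    have ne: "decomp_value G (block_digits c b @ t) \<noteq> decomp_value G (map c [1..<n+1])"
      if "b \<in> blocks L c" "fst b \<le> n" "t \<in> tails L c (n - fst b)" for b t
      using range[OF that(1) tail_lt[OF that]] partial_value_mono[of "fst b + 1" "n + 1" c G n] that
      unfolding decomp_value_block_tail[OF that] decomp_value_short by simp
    consider b t b' t' where "b \<in> blocks L c" "fst b \<le> n" "t \<in> tails L c (n - fst b)" "x = block_digits c b @ t"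
        "b' \<in> blocks L c" "fst b' \<le> n" "t' \<in> tails L c (n - fst b')" "y = block_digits c b' @ t'"
      | "x = map c [1..<n+1]" "y = map c [1..<n+1]"
      using x y eq ne unfolding unfold by (fastforce split: if_splits simp del: upt_Suc)
    then show "x = y"
    proof cases
      case 1
      then have "b = b' \<and> decomp_value G t = decomp_value G t'"
        using eq unique_block[OF 1(1,5), of n] tail_lt by (simp add: decomp_value_block_tail)
      moreover have "inj_on (decomp_value G) (tails L c (n - fst b))"
        using tails[of "n - fst b"] blocks_fst[OF 1(1)] less.prems by (simp add: bij_betw_def)
      ultimately show ?thesis using 1 by (auto dest: inj_onD)
    qed simp
  qed
  have "decomp_value G ` legals L c n = {G n..<G (n + 1)}"
  proof (intro equalityI subsetI)
    fix M assume "M \<in> decomp_value G ` legals L c n"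
    then consider b t where "b \<in> blocks L c" "fst b \<le> n" "t \<in> tails L c (n - fst b)" "M = block_low c G n b + decomp_value G t"
      | "n < L" "M = partial_value c G n (n + 1)"
      unfolding unfold by (auto split: if_splits simp: decomp_value_block_tail decomp_value_short[simplified])
    then show "M \<in> {G n..<G (n + 1)}"
    proof cases
      case 1
      then show ?thesis using range[OF 1(1) tail_lt[OF 1(1-3)]] partial_value_le_G[OF less.prems, of "fst b"]
          blocks_fst[OF 1(1)] G_le_block_low[OF 1(1), of n] by auto
    next
      case 2
      then show ?thesis using partial_value_full(2)[OF less.prems] G_le_partial_value[of "n+1" n] less.prems by auto
    qed
  next
    fix M assume M: "M \<in> {G n..<G (n + 1)}"
    then consider b v where "b \<in> blocks L c" "fst b \<le> n" "v < G (n + 1 - fst b)" "M = block_low c G n b + v"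
      | "n < L" "M = partial_value c G n (n + 1)" using exists_block[OF less.prems, of M] by auto
    then show "M \<in> decomp_value G ` legals L c n"
    proof cases
      case 1
      have "v \<in> decomp_value G ` tails L c (n - fst b)"
        using tails[of "n - fst b"] 1 blocks_fst[OF 1(1)] less.prems by (simp add: bij_betw_def Suc_diff_le)
      then obtain t where t: "t \<in> tails L c (n - fst b)" "v = decomp_value G t" by blast
      then have "block_digits c b @ t \<in> legals L c n" unfolding unfold using 1 by force
      moreover have "M = decomp_value G (block_digits c b @ t)" using 1 t by (simp add: decomp_value_block_tail)
      ultimately show ?thesis by blast
    next
      case 2
      then have "map c [1..<n+1] \<in> legals L c n" unfolding unfold by simp
      then show ?thesis using 2 decomp_value_short[of n] by (metis imageI)
    qed
  qed
  then show ?case using inj by (simp add: bij_betw_def)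
qed

text \<open>Words of different lengths have values in disjoint ranges, so uniqueness at fixed length
  gives uniqueness altogether and the definite description is meaningful.\<close>

lemma legal_decomp_decomp_value:
  assumes "legal L c a" shows "legal_decomp L c G (decomp_value G a) = a"
  unfolding legal_decomp_def
proof (rule the_equality)
  fix a' assume a': "legal L c a' \<and> decomp_value G a' = decomp_value G a"
  have len: "1 \<le> length x" "x \<in> legals L c (length x)" if "legal L c x" for x
    using legal_nonempty[OF that] that by (auto simp: legals_def Suc_le_eq)
  have rng: "G (length x) \<le> decomp_value G x" "decomp_value G x < G (length x + 1)" if "legal L c x" for x
    using bij_betwE[OF bij_betw_legals[OF len(1)[OF that]]] len(2)[OF that] by auto
  have "\<not> length x < length y" if "legal L c x" "legal L c y" "decomp_value G x = decomp_value G y" for x y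
  proof
    assume "length x < length y"
    then have "G (length x + 1) \<le> G (length y)" by (intro G_mono) auto
    then show False using rng[OF that(1)] rng[OF that(2)] that(3) by simp
  qed
  then have "length a' = length a" using a' assms by (metis linorder_neqE_nat)
  then have "a' \<in> legals L c (length a)" using len(2) a' by metis
  then show "a' = a"
    using bij_betw_legals[OF len(1)[OF assms]] len(2)[OF assms] a' by (auto simp: bij_betw_def dest: inj_onD)
qed (use assms in simp)

end

subsection \<open>Counting gaps\<close>

definition gap_count :: "nat \<Rightarrow> nat list \<Rightarrow> nat" where
  "gap_count g a = count_list (gaps (summand_indices a)) g"

lemma summand_indices_Nil [simp]: "summand_indices [] = []"
  by (simp add: summand_indices_def)

lemma summand_indices_Cons:
  "summand_indices (x # a) = replicate x (length a + 1) @ summand_indices a"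
proof -
  have "[1..<length (x # a) + 1] = 1 # map Suc [1..<length a + 1]"
    by (simp add: upt_conv_Cons map_Suc_upt del: upt_Suc)
  then show ?thesis unfolding summand_indices_def by (simp add: comp_def del: upt_Suc cong: map_cong) (auto intro!: arg_cong[of _ _ concat] simp del: upt_Suc)
qed

lemma summand_indices_append:
  "summand_indices (a @ b) = map (\<lambda>i. i + length b) (summand_indices a) @ summand_indices b"
  by (induction a) (simp_all add: summand_indices_Cons)

lemma summand_indices_replicate_0 [simp]: "summand_indices (replicate k 0) = []"
  by (induction k) (simp_all add: summand_indices_Cons)

lemma hd_summand_indices:
  assumes "a \<noteq> []" "0 < a ! 0"
  shows "summand_indices a \<noteq> []" "hd (summand_indices a) = length a"
  using assms by (cases a; simp add: summand_indices_Cons hd_append)+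

lemma gaps_Nil [simp]: "gaps [] = []" and gaps_single [simp]: "gaps [x] = []"
  and gaps_Cons2 [simp]: "gaps (x # y # zs) = (x - y) # gaps (y # zs)"
  by (simp_all add: gaps_def)

lemma gaps_append:
  "xs \<noteq> [] \<Longrightarrow> ys \<noteq> [] \<Longrightarrow> gaps (xs @ ys) = gaps xs @ (last xs - hd ys) # gaps ys"
proof (induction xs rule: induct_list012)
  case (2 x)
  then show ?case by (cases ys) auto
qed auto

lemma gaps_shift: "gaps (map (\<lambda>i. i + k) xs) = gaps xs"
  by (induction xs rule: induct_list012) auto

lemma gap_count_append_0: "gap_count g (a @ replicate k 0) = gap_count g a"
  by (simp add: gap_count_def summand_indices_append gaps_shift)

text \<open>Appending moves the last summand of \<open>a\<close> up by \<open>k + length t\<close>,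
  and the first summand of a legal \<open>t\<close> sits at \<open>length t\<close>. The gap at the
  junction is therefore independent of \<open>t\<close>.\<close>

lemma gap_count_append:
  assumes "summand_indices a \<noteq> []" "legal L c t"
  shows "gap_count g (a @ replicate k 0 @ t) =
    gap_count g a + (if last (summand_indices a) + k = g then 1 else 0) + gap_count g t"
proof -
  note t = hd_summand_indices[of t] legal_nonempty[OF assms(2)]
  have "gaps (summand_indices (a @ replicate k 0 @ t)) =
     gaps (summand_indices a) @ (last (summand_indices a) + k) # gaps (summand_indices t)"
    using t assms(1) by (simp add: summand_indices_append gaps_append gaps_shift last_map comp_def)
  then show ?thesis by (simp add: gap_count_def)
qed

text \<open>Index of the last summand of a block, counted from its right end. If the final digit is
  \<open>0\<close>, the digit before it is some \<open>c i\<close> and hence positive; so the value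
  is never larger than \<open>2\<close>.\<close>

definition block_end :: "nat \<times> nat \<Rightarrow> nat" where
  "block_end b = (if snd b = 0 then 2 else 1)"

lemma summand_indices_block:
  assumes c: "\<forall>i\<in>{1..L}. 0 < c i" and b: "b \<in> blocks L c"
  shows "summand_indices (block_digits c b) \<noteq> []" "last (summand_indices (block_digits c b)) = block_end b"
proof -
  obtain s a where sa: "b = (s, a)" by fastforce
  have s: "1 \<le> s" "s \<le> L" "s = 1 \<Longrightarrow> 0 < a" using b by (auto simp: blocks_def sa)
  have "summand_indices (block_digits c b) \<noteq> [] \<and> last (summand_indices (block_digits c b)) = block_end b"
  proof (cases "a = 0")
    case False
    then show ?thesis
      by (simp add: sa block_digits_def summand_indices_append summand_indices_Cons block_end_def last_append)
  next
    case True
    then obtain s' where s': "s = Suc (Suc s')" using s by (metis One_nat_def Suc_le_D less_numeral_extra(3) not0_implies_Suc)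
    then have "0 < c (Suc s')" using c s by auto
    then show ?thesis
      using s' True
      by (simp add: sa block_digits_def summand_indices_append summand_indices_Cons block_end_def last_append last_map)
  qed
  then show "summand_indices (block_digits c b) \<noteq> []" "last (summand_indices (block_digits c b)) = block_end b" by auto
qed

section \<open>Generating polynomials and their recurrence\<close>

definition gap_poly :: "nat \<Rightarrow> (nat \<Rightarrow> nat) \<Rightarrow> nat \<Rightarrow> nat \<Rightarrow> complex \<Rightarrow> complex" where
  "gap_poly L c g n z = (\<Sum>a\<in>legals L c n. z ^ gap_count g a)"

definition block_weight :: "(nat \<Rightarrow> nat) \<Rightarrow> nat \<Rightarrow> nat \<times> nat \<Rightarrow> nat" where
  "block_weight c g b = gap_count g (block_digits c b)"

text \<open>Sum over the tails of length \<open>k\<close> behind \<open>b\<close>: the summand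
  \<open>1\<close> is the tail of zeros, \<open>m\<close> is the length of the legal part, and the
  conditional exponent is the gap at the junction.\<close>

definition tail_poly :: "nat \<Rightarrow> (nat \<Rightarrow> nat) \<Rightarrow> nat \<Rightarrow> nat \<times> nat \<Rightarrow> nat \<Rightarrow> complex \<Rightarrow> complex" where
  "tail_poly L c g b k z = 1 + (\<Sum>m=1..k. z ^ (if block_end b + (k - m) = g then 1 else 0) * gap_poly L c g m z)"

text \<open>The first term comes from differencing in \<open>n\<close>, the others from the change
  of \<open>tail_poly\<close> when the tail grows by one. If \<open>g < block_end b\<close>, the
  subtraction truncates but its factor is \<open>0\<close>; all lags, including those, lie in the
  range up to \<open>L + g + 1\<close>.\<close>

definition rec_coeff :: "nat \<Rightarrow> (nat \<Rightarrow> nat) \<Rightarrow> nat \<Rightarrow> nat \<Rightarrow> complex \<Rightarrow> complex" where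
  "rec_coeff L c g j z = of_bool (1 = j) + (\<Sum>b\<in>blocks L c. z ^ block_weight c g b *
     (of_bool (fst b = j) + (if block_end b \<le> g then z - 1 else 0) *
       (of_bool (fst b + (g - block_end b) = j) - of_bool (fst b + (g - block_end b) + 1 = j))))"

text \<open>For an arbitrary \<open>u\<close>, so that it serves both the recurrence and its characteristic equation.\<close>

lemma sum_rec_coeff:
  fixes u :: "nat \<Rightarrow> complex"
  shows "(\<Sum>j=1..L+g+1. rec_coeff L c g j z * u j) = u 1 + (\<Sum>b\<in>blocks L c. z ^ block_weight c g b *
     (u (fst b) + (if block_end b \<le> g then z - 1 else 0) *
       (u (fst b + (g - block_end b)) - u (fst b + (g - block_end b) + 1))))"
proof -
  let ?J = "{1..L+g+1}" and ?z = "\<lambda>b. if block_end b \<le> g then z - 1 else 0"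
  have delta: "(\<Sum>j\<in>?J. of_bool (i = j) * u j) = u i" if "i \<in> ?J" for i
    using that by (simp add: of_bool_def if_distrib[of "\<lambda>x. x * _"] cong: if_cong)
  have lin: "(\<Sum>j\<in>?J. w * (p j + y * (q j - r j)) * u j) =
      w * ((\<Sum>j\<in>?J. p j * u j) + y * ((\<Sum>j\<in>?J. q j * u j) - (\<Sum>j\<in>?J. r j * u j)))"
    for w y :: complex and p q r :: "nat \<Rightarrow> complex"
    by (simp add: sum_distrib_left sum.distrib sum_subtractf algebra_simps del: sum.cl_ivl_Suc)
  have "(\<Sum>j\<in>?J. rec_coeff L c g j z * u j) = (\<Sum>j\<in>?J. of_bool (1 = j) * u j) +
    (\<Sum>b\<in>blocks L c. \<Sum>j\<in>?J. z ^ block_weight c g b * (of_bool (fst b = j) + ?z b *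
       (of_bool (fst b + (g - block_end b) = j) - of_bool (fst b + (g - block_end b) + 1 = j))) * u j)"
    unfolding rec_coeff_def distrib_right[of "of_bool _"] sum.distrib sum_distrib_right
    by (subst sum.swap) (rule refl)
  also have "\<dots> = u 1 + (\<Sum>b\<in>blocks L c. z ^ block_weight c g b *
     (u (fst b) + ?z b * (u (fst b + (g - block_end b)) - u (fst b + (g - block_end b) + 1))))"
    unfolding lin
  proof (intro arg_cong2[of _ _ _ _ "(+)"] sum.cong refl arg_cong2[of _ _ _ _ "(*)"] arg_cong2[of _ _ _ _ "(-)"])
    fix b assume "b \<in> blocks L c"
    then have r: "1 \<le> fst b" "fst b \<le> L" by (auto simp: blocks_def)
    then show "(\<Sum>j\<in>?J. of_bool (fst b = j) * u j) = u (fst b)"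
      "(\<Sum>j\<in>?J. of_bool (fst b + (g - block_end b) = j) * u j) = u (fst b + (g - block_end b))"
      "(\<Sum>j\<in>?J. of_bool (fst b + (g - block_end b) + 1 = j) * u j) = u (fst b + (g - block_end b) + 1)"
      by (intro delta; simp)+
  qed (rule delta, simp)
  finally show ?thesis .
qed

context
  fixes L :: nat and c G :: "nat \<Rightarrow> nat"
  assumes plrs: "plrs L c G" and cpos: "\<forall>i\<in>{1..L}. 0 < c i"
begin

lemma finite_legals: "finite (legals L c n)"
proof (cases "n = 0")
  case False
  then show ?thesis using bij_betw_finite[OF bij_betw_legals[OF plrs cpos, of n]] by simp
qed simp

lemma finite_tails: "finite (tails L c n)"
  by (induction n) (auto simp: finite_legals)

text \<open>The \<open>j\<close> zeros between block and tail make the induction work: a leading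
  zero of the tail is handed over to them.\<close>

lemma sum_over_tails:
  assumes b: "b \<in> blocks L c"
  shows "(\<Sum>t\<in>tails L c k. z ^ gap_count g (block_digits c b @ replicate j 0 @ t)) =
    z ^ block_weight c g b * (1 + (\<Sum>m=1..k. z ^ (if block_end b + j + (k - m) = g then 1 else 0) * gap_poly L c g m z))"
proof (induction k arbitrary: j)
  case 0
  then show ?case by (simp add: gap_count_append_0 block_weight_def)
next
  case (Suc k)
  have disj: "(#) 0 ` tails L c k \<inter> legals L c (Suc k) = {}"
    using legal_nonempty by (fastforce simp: legals_def)
  have "(\<Sum>t\<in>legals L c (Suc k). z ^ gap_count g (block_digits c b @ replicate j 0 @ t)) =
     (\<Sum>t\<in>legals L c (Suc k). z ^ block_weight c g b * (z ^ (if block_end b + j = g then 1 else 0) * z ^ gap_count g t))"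
  proof (rule sum.cong)
    fix t assume "t \<in> legals L c (Suc k)"
    then have "legal L c t" by (simp add: legals_def)
    from gap_count_append[OF summand_indices_block(1)[OF cpos b] this, of g j]
    show "z ^ gap_count g (block_digits c b @ replicate j 0 @ t) = z ^ block_weight c g b * (z ^ (if block_end b + j = g then 1 else 0) * z ^ gap_count g t)"
      by (simp add: summand_indices_block(2)[OF cpos b] block_weight_def power_add)
  qed simp
  also have "\<dots> = z ^ block_weight c g b * (z ^ (if block_end b + j = g then 1 else 0) * gap_poly L c g (Suc k) z)"
    by (simp only: gap_poly_def sum_distrib_left)
  finally have leg: "(\<Sum>t\<in>legals L c (Suc k). z ^ gap_count g (block_digits c b @ replicate j 0 @ t)) =
    z ^ block_weight c g b * (z ^ (if block_end b + j = g then 1 else 0) * gap_poly L c g (Suc k) z)" .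
  have "(\<Sum>t\<in>(#) 0 ` tails L c k. z ^ gap_count g (block_digits c b @ replicate j 0 @ t)) =
    (\<Sum>t\<in>tails L c k. z ^ gap_count g (block_digits c b @ replicate (Suc j) 0 @ t))"
    by (subst sum.reindex) (auto simp: replicate_app_Cons_same)
  also have "\<dots> = z ^ block_weight c g b * (1 + (\<Sum>m=1..k. z ^ (if block_end b + Suc j + (k - m) = g then 1 else 0) * gap_poly L c g m z))"
    by (rule Suc.IH)
  also have "(\<Sum>m=1..k. z ^ (if block_end b + Suc j + (k - m) = g then 1 else 0) * gap_poly L c g m z)
    = (\<Sum>m=1..k. z ^ (if block_end b + j + (Suc k - m) = g then 1 else 0) * gap_poly L c g m z)"
    by (intro sum.cong) (auto simp: Suc_diff_le)
  finally have "(\<Sum>t\<in>(#) 0 ` tails L c k. z ^ gap_count g (block_digits c b @ replicate j 0 @ t)) =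
    z ^ block_weight c g b * (1 + (\<Sum>m=1..k. z ^ (if block_end b + j + (Suc k - m) = g then 1 else 0) * gap_poly L c g m z))" .
  then show ?case
    unfolding tails.simps by (subst sum.union_disjoint[OF _ _ disj]) (auto simp: finite_tails finite_legals leg distrib_left)
qed

lemma gap_poly_unfold:
  assumes n: "L \<le> n"
  shows "gap_poly L c g n z = (\<Sum>b\<in>blocks L c. z ^ block_weight c g b * tail_poly L c g b (n - fst b) z)"
proof -
  have "{b \<in> blocks L c. fst b \<le> n} = blocks L c" using n by (auto simp: blocks_def)
  then have eq: "legals L c n = (\<lambda>(b, t). block_digits c b @ t) ` (SIGMA b:blocks L c. tails L c (n - fst b))"
    using legals_unfold[OF cpos plrs_order_pos[OF plrs cpos], of n] n plrs_order_pos[OF plrs cpos] by simp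
  \<comment> \<open>Unique parsing is read off from the values: distinct blocks occupy disjoint
    intervals.\<close>
  have "inj_on (\<lambda>(b, t). block_digits c b @ t) (SIGMA b:blocks L c. tails L c (n - fst b))"
  proof (rule inj_onI, clarsimp simp del: split_paired_All)
    fix s a t s' a' t'
    assume *: "(s, a) \<in> blocks L c" "t \<in> tails L c (n - s)" "(s', a') \<in> blocks L c" "t' \<in> tails L c (n - s')"
      "block_digits c (s, a) @ t = block_digits c (s', a') @ t'"
    have s: "1 \<le> s" "s \<le> n" "1 \<le> s'" "s' \<le> n" using * n by (auto simp: blocks_def)
    have bt: "bij_betw (decomp_value G) (tails L c k) {0..<G (k + 1)}" for k
      by (rule bij_betw_tails_if[OF plrs cpos]) (rule bij_betw_legals[OF plrs cpos])
    have val: "decomp_value G u < G (n + 1 - r)" if "u \<in> tails L c (n - r)" "1 \<le> r" "r \<le> n" for u r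
      using bij_betwE[OF bt, of "n - r"] that by (auto simp: Suc_diff_le)
    have "(s, a) = (s', a')"
      using unique_block[OF plrs cpos *(1,3), of n "decomp_value G t" "decomp_value G t'"]
        decomp_value_block_tail[OF plrs cpos *(1), of n t] decomp_value_block_tail[OF plrs cpos *(3), of n t'] * val s by simp
    then show "s = s' \<and> a = a' \<and> t = t'" using *(5) by simp
  qed
  then have "gap_poly L c g n z = (\<Sum>(b, t)\<in>(SIGMA b:blocks L c. tails L c (n - fst b)). z ^ gap_count g (block_digits c b @ t))"
    unfolding gap_poly_def eq by (subst sum.reindex) (auto simp: case_prod_beta)
  also have "\<dots> = (\<Sum>b\<in>blocks L c. \<Sum>t\<in>tails L c (n - fst b). z ^ gap_count g (block_digits c b @ t))"
    by (subst sum.Sigma) (auto simp: finite_blocks finite_tails)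
  also have "\<dots> = (\<Sum>b\<in>blocks L c. z ^ block_weight c g b * tail_poly L c g b (n - fst b) z)"
  proof (rule sum.cong)
    fix b assume "b \<in> blocks L c"
    from sum_over_tails[OF this, where j = 0]
    show "(\<Sum>t\<in>tails L c (n - fst b). z ^ gap_count g (block_digits c b @ t)) = z ^ block_weight c g b * tail_poly L c g b (n - fst b) z"
      by (simp only: tail_poly_def replicate_0 append_Nil add_0_right)
  qed simp
  finally show ?thesis .
qed

text \<open>Write the junction factor as \<open>1\<close> plus \<open>z - 1\<close> times an
  indicator. At most one length \<open>m\<close> of the legal part produces the gap
  \<open>g\<close>, and \<open>g \<le> k\<close> keeps that length in range.\<close>

lemma tail_poly_eq:
  assumes "g \<le> k"
  shows "tail_poly L c g b k z = 1 + (\<Sum>m=1..k. gap_poly L c g m z) +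
    (if block_end b \<le> g then (z - 1) * gap_poly L c g (k - (g - block_end b)) z else 0)"
proof -
  have "(\<Sum>m=1..k. z ^ (if block_end b + (k - m) = g then 1 else 0) * gap_poly L c g m z) =
    (\<Sum>m=1..k. gap_poly L c g m z) + (\<Sum>m=1..k. if block_end b + (k - m) = g then (z - 1) * gap_poly L c g m z else 0)"
    unfolding sum.distrib[symmetric] by (intro sum.cong) (auto simp: algebra_simps)
  also have "(\<Sum>m=1..k. if block_end b + (k - m) = g then (z - 1) * gap_poly L c g m z else 0)
    = (\<Sum>m=1..k. if m = k - (g - block_end b) then (if block_end b \<le> g then (z - 1) * gap_poly L c g m z else 0) else 0)"
    using assms by (intro sum.cong) (auto simp: block_end_def)
  also have "\<dots> = (if block_end b \<le> g then (z - 1) * gap_poly L c g (k - (g - block_end b)) z else 0)"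
    using assms by (subst sum.delta) (auto simp: block_end_def)
  finally show ?thesis by (simp add: tail_poly_def add.assoc)
qed

text \<open>Differencing cancels the sum over all shorter lengths in \<open>tail_poly_eq\<close>.
  The bound on \<open>n\<close> ensures that both \<open>n\<close> and \<open>n - 1\<close> are at
  least \<open>L\<close>, where no truncated word exists, and that every tail has length at least
  \<open>g\<close>.\<close>

lemma gap_poly_recurrence:
  assumes n: "L + g + 1 \<le> n"
  shows "gap_poly L c g n z = (\<Sum>j=1..L+g+1. rec_coeff L c g j z * gap_poly L c g (n - j) z)"
proof -
  have "gap_poly L c g n z - gap_poly L c g (n - 1) z = (\<Sum>b\<in>blocks L c. z ^ block_weight c g b *
     (tail_poly L c g b (n - fst b) z - tail_poly L c g b (n - 1 - fst b) z))"
    using n gap_poly_unfold[of n g z] gap_poly_unfold[of "n - 1" g z] by (simp add: sum_subtractf right_diff_distrib)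
  also have "\<dots> = (\<Sum>b\<in>blocks L c. z ^ block_weight c g b *
     (gap_poly L c g (n - fst b) z + (if block_end b \<le> g then z - 1 else 0) *
       (gap_poly L c g (n - (fst b + (g - block_end b))) z - gap_poly L c g (n - (fst b + (g - block_end b) + 1)) z)))"
  proof (intro sum.cong refl arg_cong2[of _ _ _ _ "(*)"])
    fix b assume "b \<in> blocks L c"
    then have r: "1 \<le> fst b" "fst b \<le> L" by (auto simp: blocks_def)
    define k where "k = n - 1 - fst b"
    have k: "n - fst b = Suc k" "g \<le> k" using r n by (auto simp: k_def)
    have d: "n - (fst b + (g - block_end b)) = Suc k - (g - block_end b)"
      "n - (fst b + (g - block_end b) + 1) = k - (g - block_end b)" unfolding k_def using r n by linarith+
    show "tail_poly L c g b (n - fst b) z - tail_poly L c g b (n - 1 - fst b) z =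
      gap_poly L c g (n - fst b) z + (if block_end b \<le> g then z - 1 else 0) *
       (gap_poly L c g (n - (fst b + (g - block_end b))) z - gap_poly L c g (n - (fst b + (g - block_end b) + 1)) z)"
      unfolding k(1) k_def[symmetric] d using k(2) tail_poly_eq[of g k b z] tail_poly_eq[of g "Suc k" b z]
      by (simp add: algebra_simps)
  qed
  finally show ?thesis unfolding sum_rec_coeff by (simp add: algebra_simps)
qed

end

text \<open>Gaps charged to one piece, the block \<open>b\<close> with \<open>l\<close> zeros behind
  it: those inside the block and the one to the next piece.\<close>

definition run_gaps :: "(nat \<Rightarrow> nat) \<Rightarrow> nat \<Rightarrow> nat \<times> nat \<Rightarrow> nat \<Rightarrow> nat" where
  "run_gaps c g b l = block_weight c g b + (if block_end b + l = g then 1 else 0)"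

text \<open>A geometric series in the number of zeros, corrected at the single \<open>l\<close> for
  which the gap to the next piece is \<open>g\<close>. It translates the characteristic equation
  into the renewal equation.\<close>

lemma run_gaps_sums:
  fixes x t :: real
  assumes x: "0 < x" "x < 1"
  shows "(\<lambda>l. exp (t * real (run_gaps c g b l)) * x ^ (fst b + l)) sums
    (exp t ^ block_weight c g b * (x ^ fst b / (1 - x) + (if block_end b \<le> g then exp t - 1 else 0) * x ^ (fst b + (g - block_end b))))"
proof -
  let ?w = "exp t ^ block_weight c g b"
  have "(\<lambda>l. ?w * x ^ fst b * x ^ l) sums (?w * x ^ fst b * (1 / (1 - x)))"
    using x by (intro sums_mult geometric_sums) simp
  moreover have "(\<lambda>l. if l = g - block_end b then ?w * (if block_end b \<le> g then exp t - 1 else 0) * x ^ (fst b + l) else 0) sums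
      (?w * (if block_end b \<le> g then exp t - 1 else 0) * x ^ (fst b + (g - block_end b)))"
    by (rule sums_single)
  ultimately have "(\<lambda>l. ?w * x ^ fst b * x ^ l + (if l = g - block_end b then ?w * (if block_end b \<le> g then exp t - 1 else 0) * x ^ (fst b + l) else 0))
    sums (?w * x ^ fst b * (1 / (1 - x)) + ?w * (if block_end b \<le> g then exp t - 1 else 0) * x ^ (fst b + (g - block_end b)))"
    by (rule sums_add)
  moreover have "exp (t * real (run_gaps c g b l)) * x ^ (fst b + l) =
    ?w * x ^ fst b * x ^ l + (if l = g - block_end b then ?w * (if block_end b \<le> g then exp t - 1 else 0) * x ^ (fst b + l) else 0)" for l
  proof -
    have "exp (t * real (run_gaps c g b l)) = exp t ^ run_gaps c g b l"
      by (metis exp_of_nat_mult mult.commute)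
    then show ?thesis by (auto simp: run_gaps_def power_add algebra_simps)
  qed
  ultimately show ?thesis by (simp add: algebra_simps)
qed

lemma gap_poly_real:
  "gap_poly L c g n (exp (complex_of_real t)) = complex_of_real (\<Sum>a\<in>legals L c n. exp t ^ gap_count g a)"
  by (simp add: gap_poly_def exp_of_real)

text \<open>For \<open>l \<ge> g\<close> the gap to the next piece exceeds \<open>g\<close>, so
  another zero changes the length but not the count. Proportionality would force
  \<open>\<mu> = 0\<close>, against the existence of a piece with a gap.\<close>

lemma run_gaps_not_proportional:
  assumes "\<exists>b\<in>blocks L c. \<exists>l. 0 < run_gaps c g b l"
  shows "\<exists>b\<in>blocks L c. \<exists>l. real (run_gaps c g b l) \<noteq> \<mu> * real (fst b + l)"
proof (rule ccontr)
  assume "\<not> (\<exists>b\<in>blocks L c. \<exists>l. real (run_gaps c g b l) \<noteq> \<mu> * real (fst b + l))"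
  then have eq: "real (run_gaps c g b l) = \<mu> * real (fst b + l)" if "b \<in> blocks L c" for b l using that by blast
  obtain b l where b: "b \<in> blocks L c" "0 < run_gaps c g b l" using assms by blast
  have "run_gaps c g b (Suc g) = run_gaps c g b g" by (simp add: run_gaps_def block_end_def)
  then have "\<mu> * real (fst b + Suc g) = \<mu> * real (fst b + g)" using eq[OF b(1)] by metis
  then have "\<mu> = 0" by (simp add: algebra_simps)
  then show False using eq[OF b(1), of l] b(2) by simp
qed

context
  fixes L :: nat and c G :: "nat \<Rightarrow> nat"
  assumes plrs: "plrs L c G" and cpos: "\<forall>i\<in>{1..L}. 0 < c i"
begin

lemma sum_num_gaps:
  assumes "1 \<le> n"
  shows "(\<Sum>M\<in>{G n..<G (n + 1)}. h (num_gaps L c G g M)) = (\<Sum>a\<in>legals L c n. h (gap_count g a))"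
proof -
  have "(\<Sum>a\<in>legals L c n. h (num_gaps L c G g (decomp_value G a))) = (\<Sum>M\<in>{G n..<G (n + 1)}. h (num_gaps L c G g M))"
    by (rule sum.reindex_bij_betw[OF bij_betw_legals[OF plrs cpos assms]])
  moreover have "num_gaps L c G g (decomp_value G a) = gap_count g a" if "a \<in> legals L c n" for a
    using that legal_decomp_decomp_value[OF plrs cpos, of a] by (simp add: num_gaps_def gap_count_def legals_def)
  ultimately show ?thesis by simp
qed

lemma num_gaps_eq_0:
  assumes X: "\<And>b l. b \<in> blocks L c \<Longrightarrow> run_gaps c g b l = 0" and M: "1 \<le> n" "M \<in> {G n..<G (n + 1)}"
  shows "num_gaps L c G g M = 0"
proof -
  have "gap_count g a = 0" if "legal L c a" for a
    using that
  proof (induction "length a" arbitrary: a rule: less_induct)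
    case less
    from less.prems consider b t where "b \<in> blocks L c" "a = block_digits c b @ t" "t \<in> tails L c (length t)"
      | "a = map c [1..<length a + 1]" "a \<noteq> []" "length a < L"
      using iffD1[OF legal_unfold[OF cpos plrs_order_pos[OF plrs cpos], where a = a]] by (auto simp del: upt_Suc)
    then show ?case
    proof cases
      case 1
      obtain l t' where t: "t = replicate l 0 @ t'" "t' = [] \<or> legal L c t'" using 1(3) unfolding tails_iff by blast
      have w: "gap_count g (block_digits c b) = 0" "block_end b + l \<noteq> g"
        using X[OF 1(1), of l] by (auto simp: run_gaps_def block_weight_def split: if_splits)
      show ?thesis
      proof (cases "t' = []")
        case True
        then show ?thesis using 1 t w by (simp add: gap_count_append_0)
      next
        case False
        then have t': "legal L c t'" using t by blast
        have "length t' < length a" using 1 t by (simp add: block_digits_def)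
        then have "gap_count g t' = 0" using less.hyps t' by blast
        then show ?thesis
          using gap_count_append[OF summand_indices_block(1)[OF cpos 1(1)] t', of g l] w 1(2) t(1)
          by (simp add: summand_indices_block(2)[OF cpos 1(1)])
      qed
    next
      case 2
      \<comment> \<open>A truncated block becomes a complete one when the digit \<open>0\<close> is
        appended, and this leaves the gaps unchanged.\<close>
      define b where "b = (length a + 1, 0::nat)"
      have "b \<in> blocks L c" using 2 cpos by (auto simp: blocks_def b_def)
      then have "gap_count g (block_digits c b) = 0" using X[of b 0] by (simp add: run_gaps_def block_weight_def)
      moreover have "block_digits c b = a @ replicate 1 0"
        using arg_cong[OF 2(1), of "\<lambda>x. x @ [0]"] by (simp add: block_digits_def b_def del: upt_Suc)
      ultimately show ?thesis using gap_count_append_0[of g a 1] by simp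
    qed
  qed
  moreover have "M \<in> decomp_value G ` legals L c n"
    using bij_betw_imp_surj_on[OF bij_betw_legals[OF plrs cpos M(1)]] M(2) by simp
  then obtain a where "a \<in> legals L c n" "M = decomp_value G a" by blast
  ultimately show ?thesis
    using legal_decomp_decomp_value[OF plrs cpos, of a] by (simp add: num_gaps_def gap_count_def legals_def)
qed

lemma exists_positive_run:
  assumes "1 \<le> n" "\<exists>M\<in>{G n..<G (n + 1)}. num_gaps L c G g M \<noteq> 0"
  shows "\<exists>b\<in>blocks L c. \<exists>l. 0 < run_gaps c g b l"
  using num_gaps_eq_0[of g n] assms by (metis gr_zeroI)

end

theorem theorem1p8:
  fixes L g n\<^sub>0 :: nat and c G :: "nat \<Rightarrow> nat"
  assumes "plrs L c G"
    and "\<forall>i\<in>{1..L}. c i > 0"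
    and "n\<^sub>0 \<ge> 1"
    and "\<forall>n\<ge>n\<^sub>0. \<exists>M\<in>{G n..<G (n + 1)}. num_gaps L c G g M \<noteq> 0"
  shows "grows_linearly (gap_mean L c G g)
    \<and> grows_linearly (gap_variance L c G g)
    \<and> weak_conv_m
         (\<lambda>n. distr (measure_pmf (unif G n)) borel
                (\<lambda>M. (real (num_gaps L c G g M) - gap_mean L c G g n)
                      / sqrt (gap_variance L c G g n)))
         std_normal_distribution"
proof -
  note plrs = assms(1) and cpos = assms(2) and n0 = assms(3) and nontriv = assms(4)
  define D where "D = L + g + 1"
  define F where "F n s = gap_poly L c g n (exp s)" for n s
  define q where "q j s = rec_coeff L c g j (exp s)" for j s
  define f where "f n = real (card (legals L c n))" for n
  \<comment> \<open>The coefficients at \<open>z = 1\<close>. Lag \<open>1\<close> has positive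
    weight even if there are no blocks of length \<open>1\<close>, which happens for
    \<open>c 1 = 1\<close>.\<close>
  define r :: "nat \<Rightarrow> real" where "r j = of_bool (1 = j) + (\<Sum>b\<in>blocks L c. of_bool (fst b = j))" for j
  have F_hol: "F n holomorphic_on UNIV" for n unfolding F_def gap_poly_def by (intro holomorphic_intros)
  have "(\<lambda>s::complex. if P then exp s - 1 else 0) holomorphic_on UNIV" for P
    by (cases P) (auto intro!: holomorphic_intros)
  then have q_hol: "q j holomorphic_on UNIV" for j unfolding q_def rec_coeff_def
    by (intro holomorphic_intros)
  have F_rec: "F n s = (\<Sum>j=1..D. q j s * F (n - j) s)" if "n\<^sub>0 + D \<le> n" for n s
    unfolding F_def q_def D_def by (rule gap_poly_recurrence[OF plrs cpos]) (use that D_def in simp)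
  have q0: "q j 0 = complex_of_real (r j)" for j
    by (simp add: q_def rec_coeff_def r_def of_bool_def if_distrib[of complex_of_real] cong: if_cong)
  have "0 \<le> (\<Sum>b\<in>blocks L c. of_bool (fst b = j) :: real)" for j by (intro sum_nonneg) simp
  then have r0: "0 \<le> r j" "0 < r 1" for j by (auto simp: r_def add_pos_nonneg)
  have D1: "1 \<le> D" by (simp add: D_def)
  have F0: "F n 0 = complex_of_real (f n)" for n by (simp add: F_def gap_poly_def f_def)
  have card: "card (legals L c n) = card {G n..<G (n + 1)}" if "n\<^sub>0 \<le> n" for n
    using bij_betw_same_card[OF bij_betw_legals[OF plrs cpos]] n0 that by simp
  \<comment> \<open>Non-triviality also provides that the interval is non-empty; for
    \<open>L = 1\<close> and \<open>c 1 = 1\<close> the sequence is constant and all intervals are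
    empty.\<close>
  have f0: "0 < f n" if "n\<^sub>0 \<le> n" for n
    using nontriv[rule_format, OF that] by (auto simp: f_def card[OF that])
  obtain \<delta> \<l> \<psi> M \<kappa> where \<delta>: "0 < \<delta>" and \<l>: "\<l> holomorphic_on ball 0 \<delta>" and \<psi>: "\<forall>n. \<psi> n holomorphic_on ball 0 \<delta>"
    and exp_\<psi>: "\<forall>n\<ge>M. \<forall>s\<in>ball 0 \<delta>. exp (\<psi> n s) = F n s"
    and ulim: "uniform_limit (ball 0 \<delta>) (\<lambda>n s. \<psi> n s - of_nat n * \<l> s) \<kappa> sequentially"
    and char: "\<forall>s\<in>ball 0 \<delta>. (\<Sum>j=1..D. q j s / exp (\<l> s)^j) = 1"
    and ratio: "\<forall>s\<in>ball 0 \<delta>. (\<lambda>n. F (n+1) s / F n s) \<longlonglongrightarrow> exp (\<l> s)"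
    by (rule quasi_power_recurrence[of D F q n\<^sub>0 r f, OF D1 F_hol q_hol F_rec q0 r0 F0 f0])
  define A where "A n = {G n..<G (n + 1)}" for n
  have A: "finite (A n) \<and> A n \<noteq> {}" if "max M n\<^sub>0 \<le> n" for n
    using nontriv[rule_format, of n] that by (auto simp: A_def)
  have mgf: "exp (\<psi> n s) = (\<Sum>a\<in>A n. exp (s * of_nat (num_gaps L c G g a)))" if "max M n\<^sub>0 \<le> n" "s \<in> ball 0 \<delta>" for n s
  proof -
    have "exp (\<psi> n s) = (\<Sum>a\<in>legals L c n. exp s ^ gap_count g a)" using exp_\<psi> that by (simp add: F_def gap_poly_def)
    also have "\<dots> = (\<Sum>a\<in>A n. exp s ^ num_gaps L c G g a)"
      using sum_num_gaps[OF plrs cpos, of n "\<lambda>k. exp s ^ k" g] n0 that by (simp add: A_def)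
    finally show ?thesis by (simp flip: exp_of_nat2_mult)
  qed
  obtain \<mu> \<mu>' v v' where \<mu>: "deriv \<l> 0 = of_real \<mu>" and v: "(deriv ^^ 2) \<l> 0 = of_real v" and "0 \<le> \<mu>"
    and mean: "(\<lambda>n. measure_pmf.expectation (pmf_of_set (A n)) (\<lambda>a. real (num_gaps L c G g a)) - (\<mu> * real n + \<mu>')) \<longlonglongrightarrow> 0"
    and variance: "(\<lambda>n. measure_pmf.variance (pmf_of_set (A n)) (\<lambda>a. real (num_gaps L c G g a)) - (v * real n + v')) \<longlonglongrightarrow> 0"
    and weak: "0 < v \<longrightarrow> weak_conv_m
         (\<lambda>n. distr (measure_pmf (pmf_of_set (A n))) borel (\<lambda>a. (real (num_gaps L c G g a)
             - measure_pmf.expectation (pmf_of_set (A n)) (\<lambda>a. real (num_gaps L c G g a)))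
            / sqrt (measure_pmf.variance (pmf_of_set (A n)) (\<lambda>a. real (num_gaps L c G g a)))))
         std_normal_distribution"
    by (rule quasi_power_CLT[OF A \<delta> \<l> \<psi>[rule_format] mgf ulim])
  \<comment> \<open>Reciprocal of the dominant characteristic root at
    \<open>z = exp t\<close>.\<close>
  define x where "x t = exp (- Re (\<l> (complex_of_real t)))" for t
  have x0: "0 < x t" for t by (simp add: x_def)
  have near: "eventually (\<lambda>t. complex_of_real t \<in> ball 0 \<delta>) (nhds 0)"
    unfolding eventually_nhds_metric using \<delta> by (intro exI[of _ \<delta>]) auto
  \<comment> \<open>For real \<open>t\<close> the root is a limit of ratios of non-negative sums,
    hence real and non-negative, so it equals its modulus and the real part of \<open>\<l>\<close>
    determines it.\<close>
  have exp_\<l>: "exp (\<l> (complex_of_real t)) = complex_of_real (inverse (x t))" if t: "complex_of_real t \<in> ball 0 \<delta>" for t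
  proof -
    define R where "R n = (\<Sum>a\<in>legals L c n. exp t ^ gap_count g a)" for n
    have R: "0 \<le> R n" for n by (auto simp: R_def intro!: sum_nonneg)
    have lim: "(\<lambda>n. complex_of_real (R (n+1) / R n)) \<longlonglongrightarrow> exp (\<l> (complex_of_real t))"
      using ratio[rule_format, OF t] by (simp add: F_def gap_poly_real R_def)
    have "Im (exp (\<l> (complex_of_real t))) = 0" using tendsto_Im[OF lim] by (simp add: LIMSEQ_const_iff)
    moreover have "0 \<le> Re (exp (\<l> (complex_of_real t)))"
      using R by (intro LIMSEQ_le_const[OF tendsto_Re[OF lim]]) auto
    ultimately have "exp (\<l> (complex_of_real t)) = complex_of_real (norm (exp (\<l> (complex_of_real t))))"
      by (simp add: complex_eq_iff cmod_def)
    then show ?thesis by (simp add: norm_exp_eq_Re x_def exp_minus)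
  qed
  have eqn: "x t + (\<Sum>b\<in>blocks L c. exp t ^ block_weight c g b * (x t ^ fst b + (if block_end b \<le> g then exp t - 1 else 0) *
       (x t ^ (fst b + (g - block_end b)) - x t ^ (fst b + (g - block_end b) + 1)))) = 1"
    if t: "complex_of_real t \<in> ball 0 \<delta>" for t
  proof -
    have "complex_of_real (x t + (\<Sum>b\<in>blocks L c. exp t ^ block_weight c g b * (x t ^ fst b + (if block_end b \<le> g then exp t - 1 else 0) *
       (x t ^ (fst b + (g - block_end b)) - x t ^ (fst b + (g - block_end b) + 1)))))
      = (\<Sum>j=1..L+g+1. rec_coeff L c g j (exp (complex_of_real t)) * complex_of_real (x t) ^ j)"
      unfolding sum_rec_coeff[where u = "\<lambda>j. complex_of_real (x t) ^ j"]
      by (simp add: exp_of_real if_distrib[of complex_of_real] cong: if_cong)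
    also have "\<dots> = complex_of_real 1"
      using char[rule_format, OF t, unfolded D_def q_def exp_\<l>[OF t]]
      by (simp only: of_real_inverse power_inverse divide_inverse inverse_inverse_eq of_real_1)
    finally have "complex_of_real (x t + (\<Sum>b\<in>blocks L c. exp t ^ block_weight c g b * (x t ^ fst b + (if block_end b \<le> g then exp t - 1 else 0) *
       (x t ^ (fst b + (g - block_end b)) - x t ^ (fst b + (g - block_end b) + 1))))) = complex_of_real 1" .
    then show ?thesis unfolding of_real_eq_iff .
  qed
  obtain b\<^sub>0 l\<^sub>0 where b\<^sub>0: "b\<^sub>0 \<in> blocks L c" "0 < run_gaps c g b\<^sub>0 l\<^sub>0"
    using exists_positive_run[OF plrs cpos n0] nontriv by blast
  \<comment> \<open>At \<open>t = 0\<close> the equation reads: \<open>x 0\<close> plus a sum of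
    positive powers of \<open>x 0\<close> is \<open>1\<close>; the sum is not empty because of
    \<open>b\<^sub>0\<close>.\<close>
  have x1: "x 0 < 1"
  proof -
    have "x 0 ^ fst b\<^sub>0 \<le> (\<Sum>b\<in>blocks L c. x 0 ^ fst b)"
      using x0[of 0] b\<^sub>0 by (intro member_le_sum) (auto simp: finite_blocks)
    moreover have "x 0 + (\<Sum>b\<in>blocks L c. x 0 ^ fst b) = 1" using eqn[of 0] \<delta> by (simp cong: if_cong)
    moreover have "0 < x 0 ^ fst b\<^sub>0" using x0[of 0] by simp
    ultimately show ?thesis by linarith
  qed
  define h where "h t = Re (\<l> (complex_of_real t)) - Re (\<l> 0)" for t
  have xh: "x t = x 0 * exp (- h t)" for t by (simp add: x_def h_def flip: exp_add)
  have quot: "((\<lambda>t. (h t - \<mu> * t) / t\<^sup>2) \<longlongrightarrow> v / 2) (at 0)"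
  proof -
    have "filterlim complex_of_real (at 0) (at 0)"
      by (intro filterlim_atI tendsto_eq_intros refl) (auto simp: eventually_at_filter)
    from filterlim_compose[OF holomorphic_second_order_quotient[OF \<l> \<delta>] this]
    have "((\<lambda>t. Re ((\<l> (complex_of_real t) - \<l> 0 - deriv \<l> 0 * complex_of_real t) / (complex_of_real t)\<^sup>2)) \<longlongrightarrow> Re ((deriv ^^ 2) \<l> 0 / 2)) (at 0)"
      by (rule tendsto_Re)
    then show ?thesis by (simp add: \<mu> v h_def flip: of_real_power of_real_mult)
  qed
  have slope: "((\<lambda>t. h t / t) \<longlongrightarrow> \<mu>) (at 0)"
  proof -
    have "((\<lambda>t. (h t - \<mu> * t) / t\<^sup>2 * t + \<mu>) \<longlongrightarrow> v / 2 * 0 + \<mu>) (at 0)" by (intro tendsto_intros quot)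
    moreover have "eventually (\<lambda>t. (h t - \<mu> * t) / t\<^sup>2 * t + \<mu> = h t / t) (at 0)"
      by (auto simp: eventually_at_filter power2_eq_square field_simps)
    ultimately show ?thesis by (auto dest: Lim_transform_eventually)
  qed
  \<comment> \<open>Dividing \<open>eqn\<close> by \<open>1 - x t\<close> spreads each block over
    all numbers of zeros behind it and leaves total mass \<open>1\<close>. Continuity keeps
    \<open>x t < 1\<close>, so that the geometric series converge for \<open>t\<close> near
    \<open>0\<close>.\<close>
  have sums: "eventually (\<lambda>t. (\<lambda>l. \<Sum>b\<in>blocks L c. exp (t * real (run_gaps c g b l)) * (x 0 * exp (- h t)) ^ (fst b + l)) sums 1) (nhds 0)"
  proof -
    have "isCont \<l> (complex_of_real 0)"
      using holomorphic_on_imp_continuous_on[OF \<l>] \<delta> by (simp add: continuous_on_eq_continuous_at)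
    then have "isCont (\<lambda>t. \<l> (complex_of_real t)) 0" by (rule isCont_o2[rotated]) (intro continuous_intros)
    then have "isCont (\<lambda>t. Re (\<l> (complex_of_real t))) 0" by (rule isCont_Re)
    then have "isCont x 0" unfolding x_def by (intro continuous_intros)
    then have "(x \<longlongrightarrow> x 0) (nhds 0)" unfolding isCont_def tendsto_at_iff_tendsto_nhds .
    then have "eventually (\<lambda>t. x t < 1) (nhds 0)" using x1 by (rule order_tendstoD)
    with near show ?thesis
    proof eventually_elim
      case (elim t)
      have "(\<lambda>l. \<Sum>b\<in>blocks L c. exp (t * real (run_gaps c g b l)) * x t ^ (fst b + l)) sums
        (\<Sum>b\<in>blocks L c. exp t ^ block_weight c g b * (x t ^ fst b / (1 - x t) + (if block_end b \<le> g then exp t - 1 else 0) * x t ^ (fst b + (g - block_end b))))"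
        by (intro sums_sum run_gaps_sums x0 elim)
      also have "(\<Sum>b\<in>blocks L c. exp t ^ block_weight c g b * (x t ^ fst b / (1 - x t) + (if block_end b \<le> g then exp t - 1 else 0) * x t ^ (fst b + (g - block_end b))))
        = (\<Sum>b\<in>blocks L c. exp t ^ block_weight c g b * (x t ^ fst b + (if block_end b \<le> g then exp t - 1 else 0) *
       (x t ^ (fst b + (g - block_end b)) - x t ^ (fst b + (g - block_end b) + 1)))) / (1 - x t)"
        unfolding sum_divide_distrib using elim(2) by (intro sum.cong refl) (simp add: field_simps)
      also have "\<dots> = 1" using eqn[OF elim(1)] elim(2) by (simp add: field_simps)
      finally show ?case unfolding xh[of t] .
    qed
  qed
  have bound: "run_gaps c g b l \<le> (\<Sum>b\<in>blocks L c. block_weight c g b) + 1" if "b \<in> blocks L c" for b l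
    using member_le_sum[OF that, of "block_weight c g"] by (auto simp: run_gaps_def finite_blocks)
  have h0: "h 0 = 0" by (simp add: h_def)
  have "0 < \<mu>"
    by (rule renewal_slopes_positive(1)[OF finite_blocks x0 x1 bound h0 sums slope quot b\<^sub>0])
  obtain b\<^sub>1 l\<^sub>1 where b\<^sub>1: "b\<^sub>1 \<in> blocks L c" "real (run_gaps c g b\<^sub>1 l\<^sub>1) \<noteq> \<mu> * real (fst b\<^sub>1 + l\<^sub>1)"
    using run_gaps_not_proportional[of L c g \<mu>] b\<^sub>0 by blast
  have "0 < v"
    by (rule renewal_slopes_positive(2)[OF finite_blocks x0 x1 bound h0 sums slope quot b\<^sub>1])
  have "gap_mean L c G g = (\<lambda>n. measure_pmf.expectation (pmf_of_set (A n)) (\<lambda>a. real (num_gaps L c G g a)))"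
    "gap_variance L c G g = (\<lambda>n. measure_pmf.variance (pmf_of_set (A n)) (\<lambda>a. real (num_gaps L c G g a)))"
    "unif G = (\<lambda>n. pmf_of_set (A n))"
    by (auto simp: gap_mean_def gap_variance_def unif_def A_def fun_eq_iff)
  then show ?thesis
    unfolding grows_linearly_def using mean variance mp[OF weak \<open>0 < v\<close>] \<open>0 < \<mu>\<close> \<open>0 < v\<close> by auto
qed

end
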